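(* For each integer $N\ge1$ there exist real numbers $w_N=0<w_{N-1}<\cdots<w_1<w_0$ and a real monic polynomial $P$ of degree $d=2N+1$ which has a repelling fixed point at $w_N=0$ and, for every $0\le j\le N-1$, a parabolic fixed point of multiplier $1$ at $w_j$ with $\operatorname{r\acute esit}(P,w_j)<0$, such that the following holds. For $\varepsilon>0$ sufficiently small, the perturbations $P_\varepsilon:=P+\varepsilon$ belong to $\mathcal C(d)$, and the Hausdorff limit $\mathcal L$ of the closed rays $\overline{R_{P_\varepsilon,0}}$ as $\varepsilon\to0^+$ consists of the closed ray $\overline{R_{P,0}}=[w_0,+\infty]$ together with $N$ heteroclinic arcs along the real line and their endpoints: $$\mathcal L=\mathcal L^*=[0,+\infty]=[w_N,w_{N-1}]\cup\cdots\cup[w_1,w_0]\cup[w_0,+\infty].$$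
   Context: $\mathcal C(d)$ is the set of monic polynomials of degree $d$ with connected Julia set. For $P\in\mathcal C(d)$ with filled Julia set $K_P$ and Julia set $J_P$, let $\beta_P:\hat{\mathbb C}\setminus K_P\to\hat{\mathbb C}\setminus\overline{\mathbb D}$ be the Böttcher coordinate (the conformal isomorphism tangent to the identity at $\infty$ with $\beta_P\circ P=\beta_P^d$). The external ray of $P$ at angle $\theta$ is $R_{P,\theta}=\{\beta_P^{-1}(e^{s+2\pi i\theta}):s>0\}$; for periodic $\theta$ it lands at a point $\zeta$ (the limit as $s\to 0$) and $\overline{R_{P,\theta}}:=R_{P,\theta}\cup\{\zeta,\infty\}$. Hausdorff limits are taken in the space of non-empty compact subsets of $\hat{\mathbb C}$. The résidu itératif of a holomorphic map $f$ at an isolated fixed point $z_0$ is $$\operatorname{r\acute esit}(f,z_0):=-\frac12\operatorname{res}\Big(\frac{1+f'(z)}{z-f(z)}\,dz,\,z_0\Big)=\frac m2-\operatorname{res}\Big(\frac{dz}{z-f(z)},z_0\Big),$$ where $m$ is the multiplicity of $z_0$ as a root of $z-f(z)=0$. A heteroclinic arc of $\mathcal L$ (here the angle is $\theta=0$, which has period $q=1$) is a connected component $\gamma$ of $\mathcal L\cap\mathring K_P$ which is an open arc, invariant under $P$, whose two endpoints $w^-(\gamma)$ and $w^+(\gamma)$ (the limits of backward, respectively forward, orbits of $P$ along $\gamma$) are distinct; a homoclinic arc is one for which they coincide. The spine $\mathcal L^*$ is the set $\mathcal L$ with all homoclinic arcs removed. *)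

theory Defs
  imports "HOL-Complex_Analysis.Complex_Analysis"
begin

section \<open>The Riemann sphere and Hausdorff limits\<close>

text \<open>The Riemann sphere is the one-point compactification of the plane: \<open>Some z\<close> is the finite
  point \<open>z\<close> and \<open>None\<close> is the point at infinity.\<close>

abbreviation riemann_sphere :: "complex option topology" where
  "riemann_sphere \<equiv> Alexandroff_compactification euclidean"

text \<open>Inverse stereographic projection onto the unit sphere of \<open>\<complex> \<times> \<real>\<close>. Pulling the Euclidean
  distance back along it gives the chordal metric, which induces the topology of
  \<open>riemann_sphere\<close> (\<open>homeomorphic_map_sphere_point\<close> below).\<close>

definition sphere_point :: "complex option \<Rightarrow> complex \<times> real" where
  "sphere_point p = (case p of
      None \<Rightarrow> (0, 1)
    | Some z \<Rightarrow> (2 * z / of_real ((norm z)\<^sup>2 + 1), ((norm z)\<^sup>2 - 1) / ((norm z)\<^sup>2 + 1)))"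

lemma norm_sphere_point: "norm (sphere_point p) = 1"
proof (cases p)
  case (Some z)
  have "norm z ^ 2 + 1 > 0" by (simp add: add_nonneg_pos)
  then have "(2 * norm z / (norm z ^ 2 + 1))\<^sup>2 + ((norm z ^ 2 - 1) / (norm z ^ 2 + 1))\<^sup>2 = 1"
    by (simp add: power_divide add_divide_distrib [symmetric] divide_eq_eq) algebra
  moreover have "norm (2 * z / of_real ((norm z)\<^sup>2 + 1)) = 2 * norm z / (norm z ^ 2 + 1)"
    using \<open>norm z ^ 2 + 1 > 0\<close> by (simp only: norm_divide norm_mult norm_of_real) simp
  ultimately show ?thesis
    using Some by (simp add: sphere_point_def norm_prod_def power_divide)
qed (simp add: sphere_point_def norm_prod_def)

lemma inj_sphere_point: "inj sphere_point"
proof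
  fix p q assume eq: "sphere_point p = sphere_point q"
  have pos: "norm z ^ 2 + 1 > 0" for z :: complex by (simp add: add_nonneg_pos)
  have snd_ne: "snd (sphere_point (Some z)) \<noteq> 1" for z
    using pos[of z] by (simp add: sphere_point_def)
  show "p = q"
  proof (cases p; cases q)
    fix z w assume *: "p = Some z" "q = Some w"
    from eq * have s: "((norm z)\<^sup>2 - 1) / ((norm z)\<^sup>2 + 1) = ((norm w)\<^sup>2 - 1) / ((norm w)\<^sup>2 + 1)"
      and f: "2 * z / of_real ((norm z)\<^sup>2 + 1) = 2 * w / of_real ((norm w)\<^sup>2 + 1)"
      by (simp_all add: sphere_point_def)
    from s have n: "(norm z)\<^sup>2 = (norm w)\<^sup>2"
      using pos[of z] pos[of w] by (simp add: frac_eq_eq algebra_simps)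
    have "complex_of_real ((norm w)\<^sup>2 + 1) \<noteq> 0"
      using pos[of w] by (metis less_irrefl of_real_eq_0_iff)
    with f n show "p = q" using * by simp
  qed (use eq snd_ne in \<open>force simp: sphere_point_def\<close>)+
qed

lemma range_sphere_point: "range sphere_point = sphere 0 1"
proof
  show "sphere 0 1 \<subseteq> range sphere_point"
  proof
    fix x :: "complex \<times> real" assume "x \<in> sphere 0 1"
    then obtain u t where x: "x = (u, t)" and n: "(norm u)\<^sup>2 + t\<^sup>2 = 1"
      by (cases x) (auto simp: norm_prod_def)
    show "x \<in> range sphere_point"
    proof (cases "t = 1")
      case True
      with n x have "x = sphere_point None" by (simp add: sphere_point_def)
      then show ?thesis by blast
    next
      case False
      have "t\<^sup>2 \<le> 1" using n by (metis le_add_same_cancel2 zero_le_power2)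
      with False have t: "1 - t > 0" using power2_le_iff_abs_le[of 1 t] by simp
      define z where "z = u / of_real (1 - t)"
      have nz: "(norm z)\<^sup>2 = (1 + t) / (1 - t)"
      proof -
        have "(norm u)\<^sup>2 = (1 + t) * (1 - t)" using n by (simp add: algebra_simps power2_eq_square)
        then show ?thesis using t by (simp add: z_def norm_divide power_divide power2_eq_square
              del: of_real_diff)
      qed
      then have a: "(norm z)\<^sup>2 + 1 = 2 / (1 - t)" and b: "(norm z)\<^sup>2 - 1 = 2 * t / (1 - t)"
        using t by (simp_all add: field_simps)
      have "sphere_point (Some z) = x"
        unfolding sphere_point_def option.case a b x using t
        by (simp add: z_def field_simps del: of_real_diff)
      then show ?thesis by blast
    qed
  qed
qed (auto simp: norm_sphere_point)

lemma sphere_point_at_infinity: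
  "((\<lambda>z. sphere_point (Some z)) \<longlongrightarrow> sphere_point None) at_infinity"
proof -
  have 1: "((\<lambda>z::complex. 2 * norm z / ((norm z)\<^sup>2 + 1)) \<longlongrightarrow> 0) at_infinity"
  proof (rule filterlim_compose[OF _ filterlim_norm_at_top])
    show "((\<lambda>x::real. 2 * x / (x\<^sup>2 + 1)) \<longlongrightarrow> 0) at_top" by real_asymp
  qed
  have "norm (2 * z / of_real ((norm z)\<^sup>2 + 1)) = 2 * norm z / ((norm z)\<^sup>2 + 1)" for z :: complex
    by (simp only: norm_divide norm_mult norm_of_real) simp
  with 1 have "((\<lambda>z::complex. 2 * z / of_real ((norm z)\<^sup>2 + 1)) \<longlongrightarrow> 0) at_infinity"
    by (subst tendsto_norm_zero_iff [symmetric]) simp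
  moreover have "((\<lambda>z::complex. ((norm z)\<^sup>2 - 1) / ((norm z)\<^sup>2 + 1)) \<longlongrightarrow> 1) at_infinity"
  proof (rule filterlim_compose[OF _ filterlim_norm_at_top])
    show "((\<lambda>x::real. (x\<^sup>2 - 1) / (x\<^sup>2 + 1)) \<longlongrightarrow> 1) at_top" by real_asymp
  qed
  ultimately show ?thesis by (simp add: sphere_point_def tendsto_Pair)
qed

lemma continuous_sphere_point: "continuous_map riemann_sphere euclidean sphere_point"
  unfolding continuous_map_def
proof (intro conjI allI impI)
  fix V :: "(complex \<times> real) set" assume "openin euclidean V"
  then have V: "open V" by simp
  define U where "U = {z. sphere_point (Some z) \<in> V}"
  have ne: "complex_of_real ((norm z)\<^sup>2 + 1) \<noteq> 0" "(norm z)\<^sup>2 + 1 \<noteq> 0" for z :: complex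
    by (metis add_nonneg_pos less_irrefl of_real_eq_0_iff zero_le_power2 zero_less_one)+
  have "continuous_on UNIV (\<lambda>z. sphere_point (Some z))"
    unfolding sphere_point_def option.case by (intro continuous_intros ne ballI)
  with V have U: "open U"
    unfolding U_def using open_vimage[of V "\<lambda>z. sphere_point (Some z)"] by (simp add: vimage_def)
  show "openin riemann_sphere {p \<in> topspace riemann_sphere. sphere_point p \<in> V}" (is "openin _ ?S")
  proof (cases "sphere_point None \<in> V")
    case False
    then have "?S = Some ` U" by (auto simp: U_def image_iff)
    with U show ?thesis by simp
  next
    case True
    have "eventually (\<lambda>z. z \<in> U) at_infinity"
      unfolding U_def using sphere_point_at_infinity V True by (auto dest: topological_tendstoD)
    then have "bounded (- U)"
      by (auto simp: eventually_at_infinity bounded_iff) (meson ComplD linear)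
    with U have "compact (- U)" by (simp add: compact_eq_bounded_closed closed_Compl)
    moreover have "?S = insert None (Some ` (topspace euclidean - (- U)))"
      using True by (auto simp: U_def image_iff)
    ultimately show ?thesis
      unfolding openin_Alexandroff_compactification using U
      by (metis closed_Compl closed_closedin compactin_euclidean_iff)
  qed
qed auto

lemma homeomorphic_map_sphere_point:
  "homeomorphic_map riemann_sphere (top_of_set (sphere 0 1)) sphere_point"
proof (rule continuous_imp_homeomorphic_map)
  show "continuous_map riemann_sphere (top_of_set (sphere 0 1)) sphere_point"
    using continuous_sphere_point by (simp add: continuous_map_in_subtopology norm_sphere_point)
  have "topspace riemann_sphere = UNIV" by (auto simp: image_iff)
  then show "sphere_point ` topspace riemann_sphere = topspace (top_of_set (sphere 0 1))"
    using range_sphere_point by simp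
  show "inj_on sphere_point (topspace riemann_sphere)"
    using inj_sphere_point inj_on_subset by blast
qed (auto simp: Hausdorff_space_subtopology)

definition hausdorff_dist :: "'a::metric_space set \<Rightarrow> 'a set \<Rightarrow> real" where
  "hausdorff_dist A B = max (SUP a\<in>A. infdist a B) (SUP b\<in>B. infdist b A)"

definition hausdorff_limit ::
    "(real \<Rightarrow> complex option set) \<Rightarrow> complex option set \<Rightarrow> real filter \<Rightarrow> bool" where
  "hausdorff_limit A L F \<longleftrightarrow>
     L \<noteq> {} \<and> compactin riemann_sphere L \<and>
     (\<forall>\<^sub>F x in F. A x \<noteq> {} \<and> compactin riemann_sphere (A x)) \<and>
     ((\<lambda>x. hausdorff_dist (sphere_point ` A x) (sphere_point ` L)) \<longlongrightarrow> 0) F"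

definition real_segment :: "real \<Rightarrow> real \<Rightarrow> complex option set" where
  "real_segment a b = (\<lambda>x. Some (complex_of_real x)) ` {a..b}"

text \<open>The interval \<open>[a, +\<infinity>]\<close>, including the point at infinity.\<close>

definition real_halfline :: "real \<Rightarrow> complex option set" where
  "real_halfline a = insert None ((\<lambda>x. Some (complex_of_real x)) ` {a..})"


section \<open>Julia sets and external rays\<close>

definition filled_julia :: "complex poly \<Rightarrow> complex set" where
  "filled_julia P = {z. bounded (range (\<lambda>n. (poly P ^^ n) z))}"

definition julia :: "complex poly \<Rightarrow> complex set" where
  "julia P = frontier (filled_julia P)"

definition connectedness_locus :: "nat \<Rightarrow> complex poly set" where
  "connectedness_locus d = {P. degree P = d \<and> lead_coeff P = 1 \<and> connected (julia P)}"

text \<open>The Boettcher coordinate is described on the finite part \<open>\<complex> - K\<close> of its domain; it is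
  extended by \<open>\<infinity> \<mapsto> \<infinity>\<close>, and the last clause says that this extension is tangent
  to the identity at \<open>\<infinity>\<close>. For \<open>P \<in> connectedness_locus d\<close>, \<open>d \<ge> 2\<close>, the conditions determine
  \<open>\<beta>\<close> on \<open>\<complex> - K\<close>; its values on \<open>K\<close> play no role.\<close>

definition is_boettcher :: "complex poly \<Rightarrow> (complex \<Rightarrow> complex) \<Rightarrow> bool" where
  "is_boettcher P \<beta> \<longleftrightarrow>
     \<beta> holomorphic_on (- filled_julia P) \<and>
     bij_betw \<beta> (- filled_julia P) (- cball 0 1) \<and>
     (\<forall>z\<in>- filled_julia P. \<beta> (poly P z) = \<beta> z ^ degree P) \<and>
     ((\<lambda>z. \<beta> z / z) \<longlongrightarrow> 1) at_infinity"

definition boettcher :: "complex poly \<Rightarrow> complex \<Rightarrow> complex" where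
  "boettcher P = (SOME \<beta>. is_boettcher P \<beta>)"

definition ray_point :: "complex poly \<Rightarrow> real \<Rightarrow> real \<Rightarrow> complex" where
  "ray_point P \<theta> s =
     inv_into (- filled_julia P) (boettcher P) (exp (of_real s + 2 * of_real pi * \<i> * of_real \<theta>))"

definition external_ray :: "complex poly \<Rightarrow> real \<Rightarrow> complex set" where
  "external_ray P \<theta> = ray_point P \<theta> ` {0<..}"

definition landing_point :: "complex poly \<Rightarrow> real \<Rightarrow> complex" where
  "landing_point P \<theta> = Lim (at_right 0) (ray_point P \<theta>)"

definition closed_ray :: "complex poly \<Rightarrow> real \<Rightarrow> complex option set" where
  "closed_ray P \<theta> = Some ` external_ray P \<theta> \<union> {Some (landing_point P \<theta>), None}"


section \<open>Residu iteratif\<close>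

definition resit :: "(complex \<Rightarrow> complex) \<Rightarrow> complex \<Rightarrow> complex" where
  "resit f z0 = - (1/2) * residue (\<lambda>z. (1 + deriv f z) / (z - f z)) z0"


section \<open>Heteroclinic and homoclinic arcs\<close>

text \<open>\<open>invariant_arc P L \<gamma> a b\<close>: \<open>\<gamma>\<close> is an invariant open arc among the components of the part of
  \<open>L\<close> inside the interior of the filled Julia set, and \<open>a\<close>, \<open>b\<close> are its endpoints \<open>w\<^sup>-\<close>, \<open>w\<^sup>+\<close>. A
  \<open>simple_path\<close> may be closed, so the endpoints are allowed to coincide.\<close>

definition invariant_arc ::
    "complex poly \<Rightarrow> complex option set \<Rightarrow> complex set \<Rightarrow> complex \<Rightarrow> complex \<Rightarrow> bool" where
  "invariant_arc P L \<gamma> a b \<longleftrightarrow>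
     \<gamma> \<in> components ({z. Some z \<in> L} \<inter> interior (filled_julia P)) \<and>
     (\<exists>g. simple_path g \<and> pathstart g = a \<and> pathfinish g = b \<and> \<gamma> = g ` {0<..<1}) \<and>
     poly P ` \<gamma> = \<gamma> \<and>
     (\<forall>u. (\<forall>n. u n \<in> \<gamma> \<and> poly P (u (Suc n)) = u n) \<longrightarrow> u \<longlonglongrightarrow> a) \<and>
     (\<forall>z\<in>\<gamma>. (\<lambda>n. (poly P ^^ n) z) \<longlonglongrightarrow> b)"

definition heteroclinic_arc ::
    "complex poly \<Rightarrow> complex option set \<Rightarrow> complex set \<Rightarrow> complex \<Rightarrow> complex \<Rightarrow> bool" where
  "heteroclinic_arc P L \<gamma> a b \<longleftrightarrow> invariant_arc P L \<gamma> a b \<and> a \<noteq> b"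

definition homoclinic_arc ::
    "complex poly \<Rightarrow> complex option set \<Rightarrow> complex set \<Rightarrow> bool" where
  "homoclinic_arc P L \<gamma> \<longleftrightarrow> (\<exists>a. invariant_arc P L \<gamma> a a)"

definition spine :: "complex poly \<Rightarrow> complex option set \<Rightarrow> complex option set" where
  "spine P L = L - \<Union>{Some ` \<gamma> | \<gamma>. homoclinic_arc P L \<gamma>}"

end

(* The polynomial is P = z + Q with Q = z * prod_{j<N} (z - w_j)^2, where the w_j > 0 are small and
   rapidly decreasing.

   Each double root w_j of Q splits, for P + epsilon, into two conjugate fixed points, and the sign
   of the residu iteratif makes both of them attracting. The 2N attracting fixed points absorb all
   2N critical points (Fatou: if the simply connected immediate basin U contained no critical point,
   P : U -> U would be a covering, hence have a holomorphic inverse fixing the attracting point,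
   which contradicts Cauchy's estimate for the iterates of that inverse). So the critical orbits of
   P + epsilon are bounded, and those of P by letting epsilon tend to 0.

   If the critical orbits are bounded, P is a self-covering of the escaping set. The inverse of the
   Boettcher coordinate, known near infinity, is therefore continued to the exterior of the unit disc
   by repeatedly lifting psi(exp(d s)) through P on half-planes. The Julia set is the intersection
   of the closures of the images of shrinking annuli, hence connected.

   For real P the Boettcher coordinate commutes with conjugation, so the ray of angle 0 is the
   half-line to the right of the largest real fixed point: (w_0, infinity) for P, and (c, infinity)
   with c < 0 tending to 0 for P + epsilon, because Q >= 0 on [0, infinity). On (w_{j+1}, w_j) the
   orbits of P increase to w_j and end in an attracting petal, while the w_j and 0 are not interior
   points of the filled Julia set because P repels on their right; this determines the arcs. *)
theory Submission
  imports Defs "HOL-Computational_Algebra.Fundamental_Theorem_Algebra"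
begin

text \<open>Why the sign of the residu iteratif decides: the residue of dz/(z - f) at a simple fixed
  point of multiplier \<lambda> is 1/(1 - \<lambda>), and |\<lambda>| < 1 iff Re (1/(1 - \<lambda>))
  > 1/2. At the double fixed point w_j the residue is 1 - resit. When w_j splits, the two residues
  add up to this number in the limit and are complex conjugate, so each real part tends to (1 -
  resit)/2, which exceeds 1/2 iff resit < 0.

  Origin of the condition on the w_j: write Q = (z - w_j)^2 G_j with A = G_j(w_j) > 0 and B =
  G_j'(w_j). Then resit = 1 - B/A^2, so negativity means B/A > A. Here B/A is the logarithmic
  derivative 1/w_j + sum_k 2/(w_j - w_k) of G_j, whose terms with w_k > w_j are negative. This is
  the assumption \<open>gap\<close> of \<open>parabolic_chain\<close>.\<close>

section \<open>Proper local homeomorphisms as covering maps\<close>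

text \<open>A fibre is compact and, \<open>f\<close> being locally injective, discrete, hence
  finite. Disjoint discs around its points carry the sheets; properness keeps all other preimages of
  points near \<open>y\<close> inside these discs.\<close>

lemma proper_local_homeomorphism_covering_space:
  fixes f :: "complex \<Rightarrow> complex"
  assumes holf: "f holomorphic_on U" and "open U" "open V" and im: "f ` U = V"
    and nz: "\<And>z. z \<in> U \<Longrightarrow> deriv f z \<noteq> 0"
    and proper: "\<And>C. compact C \<Longrightarrow> C \<subseteq> V \<Longrightarrow> compact (U \<inter> f -` C)"
  shows "covering_space U f V"
  unfolding covering_space_def
proof (intro conjI ballI)
  show contf: "continuous_on U f" by (simp add: holf holomorphic_on_imp_continuous_on)
  show "f ` U = V" by fact
  fix y assume y: "y \<in> V"
  define F where "F = U \<inter> f -` {y}"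
  have cF: "compact F" unfolding F_def using proper[of "{y}"] y by auto
  have "\<exists>r>0. ball x r \<subseteq> U \<and> inj_on f (ball x r)" if "x \<in> F" for x
    using has_complex_derivative_locally_injective[OF holf _ \<open>open U\<close> nz, of x] that
    by (metis F_def IntD1)
  then obtain r where r: "\<And>x. x \<in> F \<Longrightarrow> r x > 0 \<and> ball x (r x) \<subseteq> U \<and> inj_on f (ball x (r x))"
    by metis
  have "finite (F \<inter> F)"
  proof (rule finite_not_islimpt_in_compact[OF cF])
    fix x assume x: "x \<in> F"
    have "F \<inter> ball x (r x) \<subseteq> {x}"
      using r[OF x] x by (auto simp: F_def inj_on_def)
    then show "\<not> x islimpt F"
      using r[OF x] by (metis centre_in_ball finite.emptyI finite.insertI finite_subset inf.commute islimpt_eq_infinite_ball)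
  qed
  then have fin: "finite F" by simp
  have "\<exists>d>0. \<forall>x'\<in>F. x' \<noteq> x \<longrightarrow> d \<le> dist x x'" for x
    using finite_set_avoid[OF fin] by blast
  then obtain e where e: "\<And>x. e x > 0" "\<And>x x'. x' \<in> F \<Longrightarrow> x' \<noteq> x \<Longrightarrow> e x \<le> dist x x'" by metis
  define B where "B x = ball x (min (r x) (e x / 2))" for x
  have B: "x \<in> B x" "B x \<subseteq> U" "inj_on f (B x)" "open (B x)" if "x \<in> F" for x
    using r[OF that] e(1)[of x] unfolding B_def by (auto intro: inj_on_subset)
  have Bd: "disjnt (B x) (B x')" if "x \<in> F" "x' \<in> F" "x \<noteq> x'" for x x'
  proof -
    have "False" if "z \<in> B x" "z \<in> B x'" for z
    proof -
      have "dist x z < e x / 2" "dist x' z < e x' / 2" using that by (auto simp: B_def)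
      then have "dist x x' < e x / 2 + e x' / 2"
        by (metis add_strict_mono dist_commute dist_triangle le_less_trans)
      moreover have "e x \<le> dist x x'" "e x' \<le> dist x x'"
        using e(2)[of x' x] e(2)[of x x'] \<open>x \<in> F\<close> \<open>x' \<in> F\<close> \<open>x \<noteq> x'\<close> by (auto simp: dist_commute)
      ultimately show False by linarith
    qed
    then show ?thesis by (auto simp: disjnt_def)
  qed
  obtain \<rho> where \<rho>: "\<rho> > 0" "cball y \<rho> \<subseteq> V" using y \<open>open V\<close> open_contains_cball by blast
  \<comment> \<open>The preimages of a closed disc around \<open>y\<close> outside the sheets form a
    compact set. Its image is closed and misses \<open>y\<close>, so it can be cut out of the
    neighbourhood \<open>T\<close>.\<close>
  define R where "R = (U \<inter> f -` cball y \<rho>) - (\<Union>x\<in>F. B x)"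
  have "compact R" unfolding R_def
    by (intro compact_diff proper \<rho>) (use B in auto)
  then have "closed (f ` R)"
    by (intro compact_imp_closed compact_continuous_image continuous_on_subset[OF contf]) (auto simp: R_def)
  define T where "T = ball y \<rho> \<inter> - (f ` R) \<inter> (\<Inter>x\<in>F. f ` B x)"
  have "open (f ` B x)" if "x \<in> F" for x
    by (meson B that continuous_on_subset contf invariance_of_domain holf holomorphic_on_imp_continuous_on)
  then have oT: "open T" unfolding T_def using \<open>closed (f ` R)\<close> fin by (intro open_Int open_INT) auto
  have "y \<notin> f ` R" using B by (auto simp: R_def F_def)
  then have yT: "y \<in> T" unfolding T_def using \<rho> B(1) by (auto simp: F_def)
  have TV: "T \<subseteq> V" using \<rho> by (auto simp: T_def)
  have opn: "open (B x \<inter> f -` T)" if "x \<in> F" for x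
    by (rule continuous_open_preimage[OF continuous_on_subset[OF contf]]) (use B that oT in auto)
  show "\<exists>T. y \<in> T \<and> openin (top_of_set V) T \<and>
         (\<exists>v. \<Union> v = U \<inter> f -` T \<and> (\<forall>u\<in>v. openin (top_of_set U) u) \<and> pairwise disjnt v \<and>
              (\<forall>u\<in>v. \<exists>q. homeomorphism u T f q))"
  proof (rule exI[of _ T], intro conjI, goal_cases)
    case 1 show ?case by fact
    case 2 show ?case using oT TV by (simp add: open_subset)
    let ?v = "(\<lambda>x. B x \<inter> f -` T) ` F"
    case 3 show ?case
    proof (rule exI[of _ ?v], intro conjI ballI)
    show "\<Union>?v = U \<inter> f -` T"
    proof
      show "U \<inter> f -` T \<subseteq> \<Union>?v"
      proof
        fix z assume z: "z \<in> U \<inter> f -` T"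
        then have "z \<notin> R" "f z \<in> ball y \<rho>" by (auto simp: T_def)
        then show "z \<in> \<Union>?v" using z by (auto simp: R_def)
      qed
    qed (use B in auto)
    show "openin (top_of_set U) u" if "u \<in> ?v" for u
      using that opn B by (auto intro!: open_subset)
    show "pairwise disjnt ?v"
      using Bd by (auto simp: pairwise_def disjnt_def)
    show "\<exists>q. homeomorphism u T f q" if u: "u \<in> ?v" for u
    proof -
      obtain x where x: "x \<in> F" "u = B x \<inter> f -` T" using u by auto
      have "f ` u = T"
      proof
        show "T \<subseteq> f ` u"
        proof
          fix t assume t: "t \<in> T"
          then obtain b where "b \<in> B x" "t = f b" using x(1) unfolding T_def by blast
          then show "t \<in> f ` u" using t x(2) by blast
        qed
      qed (use x in auto)
      moreover obtain q where "homeomorphism u (f ` u) f q"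
        using invariance_of_domain_homeomorphism[of u f] opn[OF x(1)] x B
        by (metis Int_lower1 Int_lower1 contf continuous_on_subset inj_on_subset order_refl subset_trans)
      ultimately show ?thesis by auto
    qed
    qed
  qed
qed

subsection \<open>Escape to infinity\<close>

lemma power_power_unbounded:
  fixes x :: real
  assumes "x > 1" "d \<ge> 2" shows "\<exists>n. B < x ^ (d ^ n)"
proof -
  obtain m where m: "B < x ^ m" using real_arch_pow[OF assms(1)] by blast
  have "m \<le> d ^ m" using assms(2) by (simp add: less_imp_le_nat power_gt_expt self_le_power)
  then have "x ^ m \<le> x ^ (d ^ m)" using assms(1) by (intro power_increasing) auto
  with m show ?thesis by (intro exI[of _ m]) linarith
qed

lemma asymptotic_to_identity_bound:
  fixes F :: "complex \<Rightarrow> complex"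
  assumes "((\<lambda>z. F z / z) \<longlongrightarrow> 1) at_infinity"
  shows "\<exists>b. \<forall>z. norm z \<ge> b \<longrightarrow> norm (F z) \<ge> norm z / 2"
proof -
  have "\<forall>\<^sub>F z in at_infinity. dist (F z / z) 1 < 1/2" using assms by (rule tendstoD) simp
  then obtain b where b: "\<And>z. norm z \<ge> b \<Longrightarrow> norm (F z / z - 1) < 1/2"
    unfolding eventually_at_infinity dist_norm by auto
  have "norm (F z) \<ge> norm z / 2" if "norm z \<ge> max b 1" for z
  proof -
    have "norm (F z / z) \<ge> 1/2"
      using b[of z] that norm_triangle_ineq2[of 1 "F z / z"] by (simp add: norm_minus_commute)
    moreover have "norm z > 0" using that by linarith
    ultimately show ?thesis by (simp add: norm_divide pos_le_divide_eq)
  qed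
  then show ?thesis by blast
qed

locale monic_poly =
  fixes P :: "complex poly"
  assumes monic: "lead_coeff P = 1" and deg: "degree P \<ge> 2"
begin

lemma poly_ratio_tendsto: "((\<lambda>z. poly P z / z ^ degree P) \<longlongrightarrow> 1) at_infinity"
  using poly_divide_tendsto_aux[of P] monic by simp

text \<open>Where P z / z^d is within 1/2 of 1 and |z| \<ge> 6, the chain |P z| \<ge> |z|^d / 2
  \<ge> |z|^2 / 2 gives the factor 3. Escape itself is driven by doubling; the surplus over 2
  absorbs a constant of modulus at most 1, so that \<open>P\<close> and its small perturbations
  share one escape radius.\<close>

lemma escape_radius:
  obtains R where "R \<ge> 1" "\<And>z. norm z \<ge> R \<Longrightarrow> norm (poly P z) \<ge> 3 * norm z"
    "\<And>z. norm z \<ge> R \<Longrightarrow> norm (poly P z / z ^ degree P - 1) \<le> 1/2"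
proof -
  have "\<forall>\<^sub>F z in at_infinity. dist (poly P z / z ^ degree P) 1 < 1/2"
    using poly_ratio_tendsto by (rule tendstoD) simp
  then obtain R0 where R0: "\<And>z. norm z \<ge> R0 \<Longrightarrow> norm (poly P z / z ^ degree P - 1) < 1/2"
    unfolding eventually_at_infinity dist_norm by auto
  show ?thesis
  proof
    show "max 6 R0 \<ge> 1" by simp
    fix z :: complex assume z: "max 6 R0 \<le> norm z"
    then show *: "norm (poly P z / z ^ degree P - 1) \<le> 1/2" using R0[of z] by simp
    have "1 - norm (poly P z / z ^ degree P) \<le> norm (poly P z / z ^ degree P - 1)"
      using norm_triangle_ineq2[of 1 "poly P z / z ^ degree P"] by (simp add: norm_minus_commute)
    with * have "1/2 \<le> norm (poly P z) / norm z ^ degree P" by (simp add: norm_divide norm_power)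
    moreover have "norm z ^ degree P > 0" using z by (intro zero_less_power) linarith
    ultimately have "norm z ^ degree P / 2 \<le> norm (poly P z)" by (simp add: pos_le_divide_eq)
    moreover have "norm z ^ 2 \<le> norm z ^ degree P" using z deg by (intro power_increasing) auto
    moreover have "6 * norm z \<le> norm z ^ 2" using z by (simp add: power2_eq_square mult_right_mono)
    ultimately show "norm (poly P z) \<ge> 3 * norm z" by linarith
  qed
qed

end

lemma iterates_escape:
  fixes f :: "complex \<Rightarrow> complex"
  assumes "\<And>z. norm z \<ge> R \<Longrightarrow> norm (f z) \<ge> 2 * norm z" "norm z \<ge> R"
  shows "norm ((f ^^ n) z) \<ge> 2 ^ n * norm z"
proof (induction n)
  case (Suc n)
  have "2 ^ n * norm z \<ge> 1 * norm z" by (intro mult_right_mono) auto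
  with Suc assms(2) have "norm ((f ^^ n) z) \<ge> R" by linarith
  from assms(1)[OF this] Suc show ?case by simp
qed simp

text \<open>An orbit that reaches modulus \<open>R\<close> at least doubles at every later step. So
  bounded orbits obey the explicit bound \<open>R\<close>, which is common to all polynomials with
  this escape radius and survives a limit of polynomials.\<close>

lemma filled_julia_eq:
  assumes "R > 0" and R: "\<And>z. norm z \<ge> R \<Longrightarrow> norm (poly P z) \<ge> 2 * norm z"
  shows "filled_julia P = {z. \<forall>n. norm ((poly P ^^ n) z) < R}"
proof (intro equalityI subsetI CollectI allI)
  fix z n assume z: "z \<in> filled_julia P"
  show "norm ((poly P ^^ n) z) < R"
  proof (rule ccontr)
    let ?w = "(poly P ^^ n) z"
    assume *: "\<not> ?thesis"
    from z obtain B where B: "\<And>m. norm ((poly P ^^ m) z) \<le> B"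
      by (auto simp: filled_julia_def bounded_iff)
    obtain m where m: "B / R < 2 ^ m" using real_arch_pow[of 2 "B / R"] by auto
    have "2 ^ m * R \<le> 2 ^ m * norm ?w" using * by (intro mult_left_mono) auto
    also have "\<dots> \<le> norm ((poly P ^^ m) ?w)" using iterates_escape[of R "poly P" ?w m] R * by simp
    also have "\<dots> \<le> B" using B[of "m + n"] by (simp add: funpow_add)
    finally show False using m \<open>R > 0\<close> by (simp add: field_simps)
  qed
next
  fix z assume "z \<in> {z. \<forall>n. norm ((poly P ^^ n) z) < R}"
  then have "norm ((poly P ^^ n) z) \<le> R" for n by (simp add: less_imp_le)
  then show "z \<in> filled_julia P"
    unfolding filled_julia_def by (auto intro!: boundedI[of _ R])
qed

lemma notin_filled_julia:
  assumes "R > 0" "\<And>z. norm z \<ge> R \<Longrightarrow> norm (poly P z) \<ge> 2 * norm z" "norm z \<ge> R"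
  shows "z \<notin> filled_julia P"
proof
  assume "z \<in> filled_julia P"
  then have "\<forall>n. norm ((poly P ^^ n) z) < R" using filled_julia_eq[of R P] assms by blast
  from this[rule_format, of 0] show False using assms(3) by simp
qed

lemma filled_julia_poly_iff: "poly P z \<in> filled_julia P \<longleftrightarrow> z \<in> filled_julia P"
proof -
  have "range (\<lambda>n. (poly P ^^ n) z) = insert z (range (\<lambda>n. (poly P ^^ n) (poly P z)))"
    by (subst UNIV_nat_eq) (simp add: image_image funpow_swap1)
  then show ?thesis unfolding filled_julia_def mem_Collect_eq by (simp only: bounded_insert)
qed

lemma filled_julia_funpow_iff: "(poly P ^^ n) z \<in> filled_julia P \<longleftrightarrow> z \<in> filled_julia P"
  by (induction n) (auto simp: filled_julia_poly_iff)

lemma continuous_on_funpow_poly: "continuous_on A (poly P ^^ n)" for P :: "complex poly"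
proof (induction n)
  case (Suc n)
  then show ?case
    by (simp add: o_def) (intro continuous_intros)
qed (simp add: continuous_on_id[unfolded id_def[symmetric]])

lemma holomorphic_on_funpow_poly: "(poly P ^^ n) holomorphic_on A"
proof (induction n)
  case (Suc n)
  then show ?case
    by (simp add: o_def) (intro holomorphic_intros)
qed (simp add: id_def)

context monic_poly begin

lemma escape_radius2:
  "\<exists>R\<ge>1. \<forall>z. norm z \<ge> R \<longrightarrow> norm (poly P z) \<ge> 2 * norm z"
proof -
  obtain R where R: "R \<ge> 1" "\<And>z. norm z \<ge> R \<Longrightarrow> norm (poly P z) \<ge> 3 * norm z"
    "\<And>z. norm z \<ge> R \<Longrightarrow> norm (poly P z / z ^ degree P - 1) \<le> 1/2" using escape_radius by blast
  have R2: "norm (poly P z) \<ge> 2 * norm z" if "norm z \<ge> R" for z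
    using R(2)[OF that] norm_ge_zero[of z] by linarith
  show ?thesis using R(1) R2 by auto
qed

lemma bounded_filled_julia: "bounded (filled_julia P)"
proof -
  obtain R where R: "R \<ge> 1" "\<And>z. norm z \<ge> R \<Longrightarrow> norm (poly P z) \<ge> 2 * norm z"
    using escape_radius2 by auto
  have "norm z \<le> R" if "z \<in> filled_julia P" for z
    using notin_filled_julia[of R P z] R that by (cases "norm z \<le> R") auto
  then show ?thesis by (auto simp: bounded_iff)
qed

lemma closed_filled_julia: "closed (filled_julia P)"
proof -
  obtain R where R: "R \<ge> 1" "\<And>z. norm z \<ge> R \<Longrightarrow> norm (poly P z) \<ge> 2 * norm z"
    using escape_radius2 by auto
  have "filled_julia P = {z. \<forall>n. norm ((poly P ^^ n) z) \<le> R}"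
  proof
    show "filled_julia P \<subseteq> {z. \<forall>n. norm ((poly P ^^ n) z) \<le> R}"
      using filled_julia_eq[of R P] R by (auto intro: less_imp_le)
    show "{z. \<forall>n. norm ((poly P ^^ n) z) \<le> R} \<subseteq> filled_julia P"
      unfolding filled_julia_def by (auto intro!: boundedI[of _ R])
  qed
  moreover have "closed {z. \<forall>n. norm ((poly P ^^ n) z) \<le> R}"
    by (intro closed_Collect_all closed_Collect_le continuous_intros continuous_on_funpow_poly)
  ultimately show ?thesis by simp
qed

lemma compact_vimage_poly:
  assumes "compact C" shows "compact (poly P -` C)"
proof -
  obtain R where R: "R \<ge> 1" "\<And>z. norm z \<ge> R \<Longrightarrow> norm (poly P z) \<ge> 2 * norm z"
    using escape_radius2 by auto
  obtain B where B: "\<And>z. z \<in> C \<Longrightarrow> norm z \<le> B"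
    using assms compact_imp_bounded bounded_iff by metis
  have "norm z \<le> max R B" if "z \<in> poly P -` C" for z
  proof (cases "norm z \<ge> R")
    case True
    have "norm (poly P z) \<le> B" using B[of "poly P z"] that by simp
    with R(2)[OF True] norm_ge_zero[of z] show ?thesis by linarith
  qed simp
  then have "bounded (poly P -` C)" unfolding bounded_iff by blast
  moreover have "closed (poly P -` C)"
    using assms compact_imp_closed by (intro closed_vimage) (auto intro!: continuous_intros)
  ultimately show ?thesis by (simp add: compact_eq_bounded_closed)
qed

lemma iterates_at_infinity:
  assumes "z \<notin> filled_julia P"
  shows "filterlim (\<lambda>n. (poly P ^^ n) z) at_infinity sequentially"
proof -
  obtain R where R: "R \<ge> 1" "\<And>z. norm z \<ge> R \<Longrightarrow> norm (poly P z) \<ge> 2 * norm z"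
    using escape_radius2 by auto
  obtain m where m: "norm ((poly P ^^ m) z) \<ge> R"
    using assms filled_julia_eq[of R P] R by (auto simp: not_less)
  have "filterlim (\<lambda>n. 2 ^ n :: real) at_top sequentially" by real_asymp
  then have "filterlim (\<lambda>n. inverse (2 ^ m) * 2 ^ n :: real) at_top sequentially"
    by (intro filterlim_tendsto_pos_mult_at_top[OF tendsto_const]) auto
  moreover have "inverse (2 ^ m) * 2 ^ n \<le> norm ((poly P ^^ n) z)" if "n \<ge> m" for n
  proof -
    have "inverse (2 ^ m) * 2 ^ n = (2 ^ (n - m) :: real)"
      using that by (simp add: power_diff field_simps)
    also have "2 ^ (n - m) * 1 \<le> 2 ^ (n - m) * norm ((poly P ^^ m) z)" using m R by (intro mult_left_mono) auto
    then have "2 ^ (n - m) \<le> 2 ^ (n - m) * norm ((poly P ^^ m) z)" by simp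
    also have "\<dots> \<le> norm ((poly P ^^ (n - m)) ((poly P ^^ m) z))"
      by (rule iterates_escape[of R]) (use R m in auto)
    also have "(poly P ^^ (n - m)) ((poly P ^^ m) z) = (poly P ^^ n) z"
      using that by (metis add.commute comp_apply funpow_add le_add_diff_inverse)
    finally show ?thesis .
  qed
  ultimately have "filterlim (\<lambda>n. norm ((poly P ^^ n) z)) at_top sequentially"
    by (rule filterlim_at_top_mono[OF _ eventually_sequentiallyI[of m]])
  then show ?thesis by (rule filterlim_norm_at_top_imp_at_infinity)
qed

subsection \<open>Attracting fixed points\<close>

lemma attracting_basin_contains_critical_point:
  assumes fp: "poly P p = p" and att: "norm (poly (pderiv P) p) < 1"
  obtains c where "poly (pderiv P) c = 0" "(\<lambda>n. (poly P ^^ n) c) \<longlonglongrightarrow> p"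
proof (rule ccontr)
  assume "\<not> thesis"
  then have nocrit: "poly (pderiv P) c \<noteq> 0" if "(\<lambda>n. (poly P ^^ n) c) \<longlonglongrightarrow> p" for c
    using that \<open>\<And>c. poly (pderiv P) c = 0 \<Longrightarrow> (\<lambda>n. (poly P ^^ n) c) \<longlonglongrightarrow> p \<Longrightarrow> thesis\<close> by blast
  define A where "A = {z. (\<lambda>n. (poly P ^^ n) z) \<longlonglongrightarrow> p}"
  have fixn: "(poly P ^^ n) p = p" for n by (induction n) (auto simp: fp)
  have pA: "p \<in> A" by (simp add: A_def fixn)
  have derivP: "deriv (poly P) z = poly (pderiv P) z" for z
    by (simp add: DERIV_imp_deriv poly_DERIV)
  obtain r k where rk: "r > 0" "0 \<le> k" "k < 1" "\<And>z. norm (z - p) < r \<Longrightarrow> norm (poly P z - p) \<le> k * norm (z - p)"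
  proof -
    obtain k where k: "norm (poly (pderiv P) p) < k" "k < 1" using att dense by blast
    have "((\<lambda>z. norm ((poly P z - poly P p) / (z - p))) \<longlongrightarrow> norm (poly (pderiv P) p)) (at p)"
      using poly_DERIV[of P p] unfolding has_field_derivative_iff by (rule tendsto_norm)
    then have "\<forall>\<^sub>F z in at p. norm ((poly P z - poly P p) / (z - p)) < k"
      using k by (intro order_tendstoD(2))
    then obtain r where r: "r > 0" "\<And>z. z \<noteq> p \<Longrightarrow> dist z p < r \<Longrightarrow> norm ((poly P z - poly P p) / (z - p)) < k"
      unfolding eventually_at by auto
    have "norm (poly P z - p) \<le> k * norm (z - p)" if "norm (z - p) < r" for z
    proof (cases "z = p")
      case False
      with r(2)[of z] that show ?thesis by (simp add: norm_divide dist_norm fp field_simps)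
    qed (simp add: fp)
    moreover have "0 \<le> k" using k norm_ge_zero[of "poly (pderiv P) p"] by linarith
    ultimately show ?thesis using that r k by blast
  qed
  have iter: "norm ((poly P ^^ n) z - p) \<le> k ^ n * norm (z - p)" if "norm (z - p) < r" for z n
  proof (induction n)
    case (Suc n)
    have "k ^ n \<le> 1" using rk by (simp add: power_le_one)
    then have "k ^ n * norm (z - p) \<le> norm (z - p)" by (simp add: mult_left_le_one_le rk)
    with Suc that have "norm ((poly P ^^ n) z - p) < r" by linarith
    then have "norm ((poly P ^^ Suc n) z - p) \<le> k * norm ((poly P ^^ n) z - p)" using rk(4) by simp
    also have "\<dots> \<le> k * (k ^ n * norm (z - p))" using Suc rk by (intro mult_left_mono)
    finally show ?case by (simp add: mult_ac)
  qed simp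
  have kto: "(\<lambda>n. k ^ n * C) \<longlonglongrightarrow> 0" for C
    using tendsto_mult_left_zero[OF LIMSEQ_realpow_zero[of k], of C] rk by simp
  have ballA: "ball p r \<subseteq> A"
  proof
    fix z assume "z \<in> ball p r"
    then have "norm (z - p) < r" by (simp add: dist_norm norm_minus_commute)
    then have "(\<lambda>n. (poly P ^^ n) z - p) \<longlonglongrightarrow> 0"
      using iter by (intro tendsto_0_le[OF kto[of "norm (z-p)"], of _ 1]) (auto simp: rk)
    then show "z \<in> A" by (simp add: A_def LIM_zero_iff)
  qed
  have A_funpow: "(poly P ^^ n) z \<in> A \<longleftrightarrow> z \<in> A" for n z
    using LIMSEQ_ignore_initial_segment[of "\<lambda>m. (poly P ^^ m) z" p n]
          LIMSEQ_offset[of "\<lambda>m. (poly P ^^ m) z" n p] by (auto simp: A_def funpow_add)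
  \<comment> \<open>Convergence to \<open>p\<close> is only pointwise on \<open>A\<close>. The open
    sets \<open>D n\<close> increase to \<open>A\<close>, so a compact part of the basin enters the
    contracting disc after one common number of iterations.\<close>
  define D where "D n = (poly P ^^ n) -` ball p r" for n
  have oD: "open (D n)" for n
    unfolding D_def using continuous_on_funpow_poly[of UNIV n P] by (intro open_vimage) auto
  have A_eq: "A = (\<Union>n. D n)"
  proof (intro equalityI subsetI)
    fix z assume "z \<in> A"
    then have "\<forall>\<^sub>F n in sequentially. dist ((poly P ^^ n) z) p < r"
      unfolding A_def using rk(1) by (auto dest: tendstoD)
    then obtain n where "dist ((poly P ^^ n) z) p < r" by (auto simp: eventually_sequentially)
    then show "z \<in> (\<Union>n. D n)" by (auto simp: D_def dist_commute)
  next
    fix z assume "z \<in> (\<Union>n. D n)"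
    then obtain n where "(poly P ^^ n) z \<in> ball p r" by (auto simp: D_def)
    then show "z \<in> A" using ballA A_funpow by blast
  qed
  then have oA: "open A" using oD by auto
  have D_mono: "D m \<subseteq> D n" if mn: "m \<le> n" for m n
  proof -
    obtain j where n: "n = j + m" using mn by (metis add.commute le_Suc_ex)
    have "(poly P ^^ n) z \<in> ball p r" if "(poly P ^^ m) z \<in> ball p r" for z
    proof -
      let ?w = "(poly P ^^ m) z"
      have w: "norm (?w - p) < r" using that by (simp add: dist_norm norm_minus_commute)
      have "norm ((poly P ^^ j) ?w - p) \<le> k ^ j * norm (?w - p)" by (rule iter[OF w])
      also have "\<dots> \<le> norm (?w - p)" using rk by (simp add: mult_left_le_one_le power_le_one)
      finally show ?thesis using w n by (simp add: funpow_add dist_norm norm_minus_commute)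
    qed
    then show ?thesis by (auto simp: D_def)
  qed
  have comp: "\<exists>m. C \<subseteq> D m" if C: "compact C" "C \<subseteq> A" for C
  proof -
    obtain F where F: "finite F" "C \<subseteq> (\<Union>n\<in>F. D n)"
      using compactE_image[OF C(1), of UNIV D] C(2) A_eq oD by auto
    obtain m where m: "F \<subseteq> {..m}" using F(1) finite_nat_iff_bounded_le by auto
    have "D n \<subseteq> D m" if "n \<in> F" for n using D_mono that m by auto
    with F(2) show ?thesis by blast
  qed
  define U where "U = connected_component_set A p"
  have U: "open U" "connected U" "p \<in> U" "U \<subseteq> A"
    unfolding U_def using oA pA by (auto intro: open_connected_component connected_component_subset[THEN subsetD])
  have Umax: "X \<subseteq> U" if X: "connected X" "X \<subseteq> A" "X \<inter> U \<noteq> {}" for X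
  proof -
    obtain x where x: "x \<in> X" "x \<in> U" using X by blast
    then have "connected_component_set A p = connected_component_set A x"
      unfolding U_def using connected_component_eq by fastforce
    then show ?thesis unfolding U_def using connected_component_maximal[of x X A] X x by simp
  qed
  have AK: "A \<subseteq> filled_julia P"
    unfolding A_def filled_julia_def using convergent_imp_bounded by auto
  have bU: "bounded U" using bounded_filled_julia AK U(4) bounded_subset by blast
  have contP: "continuous_on S (poly P)" for S by (intro continuous_intros)
  have PU: "poly P ` U \<subseteq> U"
  proof (rule Umax)
    show "connected (poly P ` U)" using contP U(2) connected_continuous_image by blast
    show "poly P ` U \<subseteq> A" using A_funpow[of 1] U(4) by auto
    show "poly P ` U \<inter> U \<noteq> {}" using U(3) fp by (metis IntI empty_iff imageI)
  qed
  have proper: "compact (U \<inter> poly P -` C)" if C: "compact C" "C \<subseteq> U" for C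
  proof -
    have cp: "compact (poly P -` C)" using compact_vimage_poly C by blast
    have sub: "poly P -` C \<subseteq> A" using C U(4) A_funpow[of 1] by auto
    have "closedin (top_of_set A) U" unfolding U_def by (rule closedin_connected_component)
    then obtain T where T: "closed T" "U = A \<inter> T" by (auto simp: closedin_closed)
    then have "U \<inter> poly P -` C = poly P -` C \<inter> T" using sub by auto
    then show ?thesis using cp T by (simp add: compact_Int_closed)
  qed
  have surj: "poly P ` U = U"
  proof -
    have 1: "closedin (top_of_set U) (poly P ` U)"
      by (rule proper_map[of U]) (use proper PU in auto)
    have "open (poly P ` U)"
    proof (rule open_mapping_thm)
      show "\<not> poly P constant_on U"
      proof
        assume "poly P constant_on U"
        then obtain c where c: "\<And>x. x \<in> U \<Longrightarrow> poly P x = c" by (auto simp: constant_on_def)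
        have "((\<lambda>x. c) has_field_derivative poly (pderiv P) p) (at p)"
          by (rule has_field_derivative_transform_within_open[OF poly_DERIV U(1,3)]) (use c in auto)
        then have "poly (pderiv P) p = 0" using DERIV_unique DERIV_const by blast
        then show False using nocrit[of p] pA by (simp add: A_def)
      qed
    qed (use U in \<open>auto intro!: holomorphic_intros\<close>)
    then have 2: "openin (top_of_set U) (poly P ` U)" using PU by (simp add: open_subset)
    show ?thesis using U(2,3) 1 2 connected_clopen by blast
  qed
  have cov: "covering_space U (poly P) U"
    by (rule proper_local_homeomorphism_covering_space)
       (use U surj proper nocrit in \<open>auto simp: derivP A_def intro!: holomorphic_intros\<close>)
  \<comment> \<open>\<open>U\<close> has no holes: by the maximum principle an iterate that maps a
    continuum \<open>C\<close> into the disc around \<open>p\<close> maps the region inside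
    \<open>C\<close> there as well. So loops in \<open>U\<close> have winding number 0 about points
    outside \<open>U\<close>.\<close>
  have insideA: "C \<union> inside C \<subseteq> U" if C: "compact C" "connected C" "C \<subseteq> U" "C \<noteq> {}" for C
  proof (rule Umax)
    have cl: "closed C" using C compact_imp_closed by blast
    show "connected (C \<union> inside C)" using connected_with_inside[OF cl C(2)] .
    obtain m where m: "C \<subseteq> D m" using comp[of C] C U(4) by blast
    have "continuous_on C (\<lambda>z. norm ((poly P ^^ m) z - p))"
      by (intro continuous_intros continuous_on_funpow_poly)
    then obtain x where x: "x \<in> C" "\<And>y. y \<in> C \<Longrightarrow> norm ((poly P ^^ m) y - p) \<le> norm ((poly P ^^ m) x - p)"
      using continuous_attains_sup[OF C(1,4)] by blast
    have "inside C \<subseteq> D m"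
    proof
      fix z assume z: "z \<in> inside C"
      have "norm ((poly P ^^ m) z - p) \<le> norm ((poly P ^^ m) x - p)"
      proof (rule maximum_modulus_frontier[of "\<lambda>z. (poly P ^^ m) z - p" "inside C"])
        show "(\<lambda>z. (poly P ^^ m) z - p) holomorphic_on interior (inside C)"
          using holomorphic_on_funpow_poly by (intro holomorphic_intros)
        show "continuous_on (closure (inside C)) (\<lambda>z. (poly P ^^ m) z - p)"
          using continuous_on_funpow_poly[of _ m P] by (intro continuous_intros)
        show "bounded (inside C)" using C compact_imp_bounded bounded_inside by blast
        show "norm ((poly P ^^ m) w - p) \<le> norm ((poly P ^^ m) x - p)" if "w \<in> frontier (inside C)" for w
          using frontier_inside_subset[OF cl] that x(2) by blast
      qed (rule z)
      also have "\<dots> < r" using x(1) m by (auto simp: D_def dist_norm norm_minus_commute)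
      finally show "z \<in> D m" by (simp add: D_def dist_norm norm_minus_commute)
    qed
    then show "C \<union> inside C \<subseteq> A" using C(3) U(4) A_eq by auto
    show "(C \<union> inside C) \<inter> U \<noteq> {}" using C by auto
  qed
  have sc: "simply_connected U"
    unfolding simply_connected_eq_winding_number_zero[OF U(1)]
  proof (intro conjI allI impI U(2))
    fix g z assume g: "path g \<and> path_image g \<subseteq> U \<and> pathfinish g = pathstart g \<and> z \<notin> U"
    then have "path_image g \<union> inside (path_image g) \<subseteq> U"
      by (intro insideA) (auto simp: connected_path_image compact_path_image)
    then have "z \<in> outside (path_image g)" using g by (auto simp: outside_inside)
    then show "winding_number g z = 0" using g winding_number_zero_in_outside by blast
  qed
  \<comment> \<open>A lift of the identity is a global inverse branch of \<open>P\<close> on the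
    bounded domain \<open>U\<close>, here one fixing \<open>p\<close>.\<close>
  obtain g where g: "continuous_on U g" "g \<in> U \<rightarrow> U" "g p = p" "\<And>y. y \<in> U \<Longrightarrow> poly P (g y) = id y"
    using covering_space_lift_strong[OF cov U(3) U(3) sc open_imp_locally_path_connected[OF U(1)], of id] fp by auto
  have holg: "g holomorphic_on U"
    by (rule covering_space_lift_is_holomorphic[OF cov U(1), of id])
       (use g in \<open>auto intro!: holomorphic_intros simp: id_def\<close>)
  have dg: "(g has_field_derivative deriv g p) (at p)"
    using holg U holomorphic_derivI by blast
  have "((\<lambda>y. poly P (g y)) has_field_derivative poly (pderiv P) p * deriv g p) (at p)"
    using DERIV_chain[OF _ dg, of "poly P" "poly (pderiv P) p"] by (simp add: o_def g(3) poly_DERIV)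
  moreover have "((\<lambda>y. poly P (g y)) has_field_derivative 1) (at p)"
    by (rule has_field_derivative_transform_within_open[OF DERIV_ident U(1,3)]) (use g in auto)
  ultimately have "poly (pderiv P) p * deriv g p = 1" by (rule DERIV_unique)
  then have "norm (poly (pderiv P) p) * norm (deriv g p) = 1" by (metis norm_mult norm_one)
  then have big: "norm (deriv g p) > 1"
  proof -
    have "norm (poly (pderiv P) p) * norm (deriv g p) \<le> norm (poly (pderiv P) p) * 1" if "norm (deriv g p) \<le> 1"
      using that by (intro mult_left_mono) auto
    with att \<open>norm (poly (pderiv P) p) * norm (deriv g p) = 1\<close> show ?thesis by fastforce
  qed
  have gn: "(g ^^ n) holomorphic_on U \<and> (g ^^ n) ` U \<subseteq> U \<and> (g ^^ n) p = p \<and>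
        ((g ^^ n) has_field_derivative (deriv g p ^ n)) (at p)" for n
  proof (induction n)
    case (Suc n)
    have "(\<lambda>x. g ((g ^^ n) x)) holomorphic_on U"
      using holomorphic_on_compose_gen[of "g ^^ n" U g U] Suc holg by (auto simp: o_def)
    moreover have "((\<lambda>x. g ((g ^^ n) x)) has_field_derivative deriv g p * deriv g p ^ n) (at p)"
      using DERIV_chain[of g "deriv g p" "g ^^ n" p] Suc dg by (simp add: o_def)
    ultimately show ?case using Suc g by (auto simp: o_def)
  qed (auto simp: id_def)
  obtain s where s: "s > 0" "cball p s \<subseteq> U" using U open_contains_cball by blast
  obtain B where B: "\<And>z. z \<in> U \<Longrightarrow> norm z \<le> B" using bU bounded_iff by metis
  have "norm (deriv g p) ^ n \<le> B / s" for n
  proof -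
    have "norm ((deriv ^^ 1) (g ^^ n) p) \<le> fact 1 * B / s ^ 1"
    proof (rule Cauchy_inequality)
      show "(g ^^ n) holomorphic_on ball p s"
        using gn[of n] s(2) by (rule holomorphic_on_subset[OF conjunct1 subset_trans[OF ball_subset_cball]])
      show "continuous_on (cball p s) (g ^^ n)"
        using gn[of n] s(2) by (blast intro: holomorphic_on_imp_continuous_on continuous_on_subset)
      show "norm ((g ^^ n) x) \<le> B" if "norm (p - x) = s" for x
      proof (rule B)
        have "x \<in> U" using that s by (auto simp: dist_norm)
        then show "(g ^^ n) x \<in> U" using gn by blast
      qed
    qed (rule s)
    moreover have "deriv (g ^^ n) p = deriv g p ^ n" using gn[of n] by (intro DERIV_imp_deriv) simp
    ultimately show ?thesis by (simp add: norm_power)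
  qed
  moreover obtain n where "B / s < norm (deriv g p) ^ n" using real_arch_pow[OF big] by auto
  ultimately show False using not_less by blast
qed

end

subsection \<open>The Boettcher coordinate near infinity\<close>

text \<open>In the coordinate u = 1/z the map becomes k(u) = 1/h(1/u), which extends holomorphically
  over 0 with k(0) = 0 and k'(0) = 1. The inverse function theorem at 0 does the rest.\<close>

lemma holomorphic_inverse_near_infinity:
  fixes h :: "complex \<Rightarrow> complex"
  assumes holh: "h holomorphic_on {z. norm z > R}" and lim: "((\<lambda>z. h z / z) \<longlongrightarrow> 1) at_infinity"
  obtains \<rho> R' \<psi> where "\<rho> \<ge> 1" "R' \<ge> 1" "\<psi> holomorphic_on {w. norm w > \<rho>}"
    "\<And>w. norm w > \<rho> \<Longrightarrow> norm (\<psi> w) > R \<and> h (\<psi> w) = w"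
    "\<And>z. norm z > R' \<Longrightarrow> norm (h z) > \<rho> \<and> \<psi> (h z) = z"
    "((\<lambda>w. \<psi> w / w) \<longlongrightarrow> 1) at_infinity"
proof -
  obtain R0 where R0: "\<And>z. norm z \<ge> R0 \<Longrightarrow> norm (h z) \<ge> norm z / 2"
    using asymptotic_to_identity_bound[OF lim] by blast
  define R1 where "R1 = max 1 (max R (R0))"
  have R1: "R1 \<ge> 1" "R1 \<ge> R" "R1 \<ge> R0" by (auto simp: R1_def)
  have hz: "norm (h z) \<ge> norm z / 2" "h z \<noteq> 0" if z: "norm z > R1" for z
  proof -
    show "norm (h z) \<ge> norm z / 2" using R0 z R1 by simp
    then show "h z \<noteq> 0" using z R1 by auto
  qed
  \<comment> \<open>\<open>m u\<close> is k(u)/u. Its value 1 at 0 is the hypothesis on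
    \<open>h z / z\<close>, so the singularity is removable and k'(0) = 1.\<close>
  define m where "m u = (if u = 0 then 1 else inverse (h (inverse u) / inverse u))" for u
  define S where "S = ball (0::complex) (inverse R1)"
  have inv: "norm (inverse u) > R1" if "u \<in> S" "u \<noteq> 0" for u
    using that R1 by (simp add: S_def norm_inverse) (metis inverse_less_imp_less inverse_inverse_eq zero_less_norm_iff inverse_positive_iff_positive)
  have "open S" by (simp add: S_def)
  have holm0: "m holomorphic_on S - {0}"
  proof -
    have sub: "inverse ` (S - {0}) \<subseteq> {z. norm z > R}" using inv R1(2) by force
    have "inverse holomorphic_on S - {0}"
      using holomorphic_on_inverse[OF holomorphic_on_ident, of "S - {0}"] by auto
    then have "(\<lambda>u. h (inverse u)) holomorphic_on S - {0}"
      using holomorphic_on_compose_gen[of inverse "S - {0}" h "{z. norm z > R}"] holh sub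
      by (auto simp: o_def)
    then have "(\<lambda>u. inverse (h (inverse u) / inverse u)) holomorphic_on S - {0}"
      using hz inv by (intro holomorphic_intros) auto
    then show ?thesis by (rule holomorphic_transform) (auto simp: m_def)
  qed
  have "((\<lambda>u. inverse (h (inverse u) / inverse u)) \<longlongrightarrow> inverse 1) (at 0)"
    by (intro tendsto_inverse filterlim_compose[OF lim] filterlim_inverse_at_infinity) auto
  then have "(m \<longlongrightarrow> 1) (at 0)"
    unfolding inverse_1 by (rule Lim_transform_eventually) (auto simp: m_def eventually_at intro!: exI[of _ 1])
  then have "isCont m 0" by (simp add: isCont_def m_def)
  have "continuous_on S m"
    unfolding continuous_on_eq_continuous_at[OF \<open>open S\<close>]
  proof
    fix u assume "u \<in> S"
    show "isCont m u"
    proof (cases "u = 0")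
      case False
      have "continuous_on (S - {0}) m" using holm0 holomorphic_on_imp_continuous_on by blast
      then show ?thesis using False \<open>u \<in> S\<close> \<open>open S\<close>
        by (metis Diff_iff continuous_on_eq_continuous_at empty_iff insert_iff open_delete)
    qed (use \<open>isCont m 0\<close> in simp)
  qed
  then have holm: "m holomorphic_on S"
    using no_isolated_singularity[OF _ holm0 \<open>open S\<close>] by simp
  define k where "k u = u * m u" for u
  have holk: "k holomorphic_on S" unfolding k_def using holm by (intro holomorphic_intros)
  have S0: "0 \<in> S" using R1 by (simp add: S_def)
  have "(m has_field_derivative deriv m 0) (at 0)" using holm S0 \<open>open S\<close> holomorphic_derivI by blast
  then have "((\<lambda>u. u * m u) has_field_derivative 1 * m 0 + deriv m 0 * 0) (at 0)"
    by (intro DERIV_mult DERIV_ident)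
  then have "(k has_field_derivative 1) (at 0)"
    by (simp add: k_def[abs_def] m_def)
  then have "deriv k 0 \<noteq> 0" using DERIV_imp_deriv by fastforce
  then obtain r where r: "r > 0" "ball 0 r \<subseteq> S" "inj_on k (ball 0 r)"
    using has_complex_derivative_locally_injective[OF holk S0 \<open>open S\<close>] by blast
  have k0: "k 0 = 0" by (simp add: k_def)
  have kh: "k u = inverse (h (inverse u))" if "u \<noteq> 0" for u using that by (simp add: k_def m_def divide_inverse)
  have holkr: "k holomorphic_on ball 0 r" using holk r(2) holomorphic_on_subset by blast
  obtain g where g: "g holomorphic_on k ` ball 0 r" "\<And>u. u \<in> ball 0 r \<Longrightarrow> g (k u) = u"
    using holomorphic_has_inverse[OF holkr open_ball r(3)] by metis
  have "open (k ` ball 0 r)" using open_mapping_thm3[OF holkr open_ball r(3)] .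
  moreover have "0 \<in> k ` ball 0 r" using k0 r(1) by (intro image_eqI[of _ _ 0]) auto
  ultimately obtain s where s: "s > 0" "ball 0 s \<subseteq> k ` ball 0 r" using open_contains_ball by blast
  have g0: "g 0 = 0" using g(2)[of 0] k0 r(1) by simp
  have isCont_g: "isCont g 0"
    using g(1) s by (metis centre_in_ball continuous_on_eq_continuous_at continuous_on_subset holomorphic_on_imp_continuous_on open_ball)
  define \<rho> where "\<rho> = max 1 (inverse s)"
  have inv_s: "inverse w \<in> ball 0 s" "w \<noteq> 0" if "norm w > \<rho>" for w :: complex
  proof -
    show "w \<noteq> 0" using that by (auto simp: \<rho>_def)
    have "inverse s < norm w" using that by (simp add: \<rho>_def)
    then have "inverse (norm w) < s" using s(1) by (metis inverse_inverse_eq inverse_positive_iff_positive less_imp_inverse_less)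
    then show "inverse w \<in> ball 0 s" by (simp add: norm_inverse)
  qed
  have pre: "\<exists>u. u \<in> ball 0 r \<and> u \<noteq> 0 \<and> k u = inverse w \<and> g (inverse w) = u" if w: "norm w > \<rho>" for w :: complex
  proof -
    obtain u where u: "u \<in> ball 0 r" "k u = inverse w" using inv_s[OF w] s(2) by (metis imageE subsetD)
    then have "u \<noteq> 0" using k0 inv_s[OF w] by auto
    then show ?thesis using u g(2)[OF u(1)] by auto
  qed
  define \<psi> where "\<psi> w = inverse (g (inverse w))" for w
  have \<psi>: "norm (\<psi> w) > R \<and> h (\<psi> w) = w" if w: "norm w > \<rho>" for w
  proof -
    obtain u where u: "u \<in> ball 0 r" "u \<noteq> 0" "k u = inverse w" "g (inverse w) = u" using pre[OF w] by blast
    have "norm (inverse u) > R1" using inv u r(2) by blast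
    moreover have "h (inverse u) = w" using u(3) kh[OF u(2)] by (metis inverse_inverse_eq)
    ultimately show ?thesis using u R1 by (simp add: \<psi>_def)
  qed
  have hol: "\<psi> holomorphic_on {w. norm w > \<rho>}"
  proof -
    have "(g \<circ> inverse) holomorphic_on {w. norm w > \<rho>}"
      by (rule holomorphic_on_compose_gen[OF _ holomorphic_on_subset[OF g(1) s(2)]])
         (use inv_s in \<open>auto intro!: holomorphic_intros\<close>)
    then show ?thesis unfolding \<psi>_def o_def using pre by (intro holomorphic_intros) fastforce+
  qed
  have "((\<lambda>w. g (inverse w)) \<longlongrightarrow> 0) at_infinity"
    using isCont_tendsto_compose[OF isCont_g tendsto_inverse_0] by (simp add: g0)
  moreover have "\<forall>\<^sub>F w in at_infinity. g (inverse w) \<noteq> 0"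
    unfolding eventually_at_infinity using pre by (intro exI[of _ "\<rho> + 1"]) force
  ultimately have "filterlim \<psi> at_infinity at_infinity"
    unfolding \<psi>_def by (intro filterlim_compose[OF filterlim_inverse_at_infinity] filterlim_atI)
  then have "((\<lambda>w. inverse (h (\<psi> w) / \<psi> w)) \<longlongrightarrow> inverse 1) at_infinity"
    by (intro tendsto_inverse filterlim_compose[OF lim]) auto
  moreover have "\<forall>\<^sub>F w in at_infinity. inverse (h (\<psi> w) / \<psi> w) = \<psi> w / w"
    unfolding eventually_at_infinity using \<psi> by (intro exI[of _ "\<rho> + 1"]) auto
  ultimately have limpsi: "((\<lambda>w. \<psi> w / w) \<longlongrightarrow> 1) at_infinity"
    using Lim_transform_eventually by fastforce
  \<comment> \<open>\<open>inverse r\<close> puts 1/z into the disc on which \<open>k\<close> is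
    injective; \<open>2 * \<rho>\<close> makes |h z| \<ge> |z|/2 > \<rho>, an estimate valid beyond
    \<open>R1\<close>.\<close>
  define R' where "R' = max (inverse r) (max (2 * \<rho>) R1)"
  have "norm (h z) > \<rho> \<and> \<psi> (h z) = z" if z: "norm z > R'" for z
  proof -
    have z': "norm z > inverse r" "norm z > 2 * \<rho>" "norm z > R1" using z by (auto simp: R'_def)
    then have "norm (h z) > \<rho>" using hz(1)[of z] by simp
    have "z \<noteq> 0" using z' R1 by auto
    have "inverse (norm z) < r" using z'(1) r(1) by (metis inverse_inverse_eq inverse_positive_iff_positive less_imp_inverse_less)
    then have "g (k (inverse z)) = inverse z" by (intro g(2)) (simp add: norm_inverse)
    then show ?thesis using \<open>norm (h z) > \<rho>\<close> \<open>z \<noteq> 0\<close> by (simp add: \<psi>_def kh)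
  qed
  moreover have "\<rho> \<ge> 1" "R' \<ge> 1" using R1 by (auto simp: \<rho>_def R'_def)
  ultimately show ?thesis using that[OF _ _ hol \<psi> _ limpsi] by blast
qed

context monic_poly begin

text \<open>Boettcher's product z * prod_n q(P^n z)^(1/d^(n+1)) with q(z) = P(z)/z^d. Near infinity
  all values of \<open>q\<close> lie in a disc around 1 that avoids the slit, so \<open>Ln\<close>
  supplies the roots and the product becomes the exponential of a geometrically dominated
  series.\<close>

lemma boettcher_near_infinity:
  obtains R h where "R \<ge> 1" "h holomorphic_on {z. norm z > R}"
    "\<And>z. norm z > R \<Longrightarrow> norm (poly P z) \<ge> 2 * norm z"
    "\<And>z. norm z > R \<Longrightarrow> h (poly P z) = h z ^ degree P"
    "((\<lambda>z. h z / z) \<longlongrightarrow> 1) at_infinity"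
proof -
  define q where "q z = poly P z / z ^ degree P" for z
  obtain R where R: "R \<ge> 1" "\<And>z. norm z \<ge> R \<Longrightarrow> norm (poly P z) \<ge> 3 * norm z"
    "\<And>z. norm z \<ge> R \<Longrightarrow> norm (q z - 1) \<le> 1/2"
    unfolding q_def using escape_radius by blast
  have R2: "norm (poly P z) \<ge> 2 * norm z" if "norm z \<ge> R" for z
    using R(2)[OF that] norm_ge_zero[of z] by linarith
  define A where "A = {z::complex. norm z > R}"
  have "open A" unfolding A_def by (intro open_Collect_less continuous_intros)
  have grow: "norm ((poly P ^^ n) z) \<ge> norm z" if "z \<in> A" for z n
  proof -
    have "1 * norm z \<le> 2 ^ n * norm z" by (intro mult_right_mono) auto
    also have "\<dots> \<le> norm ((poly P ^^ n) z)" by (rule iterates_escape[of R]) (use R2 that in \<open>auto simp: A_def\<close>)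
    finally show ?thesis by simp
  qed
  have inA: "(poly P ^^ n) z \<in> A" if "z \<in> A" for z n using grow[OF that, of n] that by (simp add: A_def)
  have A0: "z \<noteq> 0" if "z \<in> A" for z using that R(1) by (auto simp: A_def)
  have slit: "w \<notin> \<real>\<^sub>\<le>\<^sub>0" if "w \<in> cball 1 (1/2)" for w :: complex
  proof
    assume "w \<in> \<real>\<^sub>\<le>\<^sub>0"
    then have "Re w \<le> 0" by (auto simp: complex_nonpos_Reals_iff)
    moreover have "\<bar>Re (1 - w)\<bar> \<le> 1/2" using that abs_Re_le_cmod[of "1 - w"] by (simp add: dist_norm)
    ultimately show False by simp
  qed
  have qA: "q z \<in> cball 1 (1/2)" if "z \<in> A" for z
    using R(3)[of z] that by (simp add: A_def dist_norm norm_minus_commute)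
  have "compact (Ln ` cball 1 (1/2))"
    by (intro compact_continuous_image continuous_intros) (use slit in auto)
  then obtain C where C: "\<And>w. w \<in> cball 1 (1/2) \<Longrightarrow> norm (Ln w) \<le> C"
    using compact_imp_bounded bounded_iff by (metis imageI)
  define d where "d = degree P"
  have d: "d \<ge> 2" using deg by (simp add: d_def)
  define a where "a n z = Ln (q ((poly P ^^ n) z)) / of_nat d ^ Suc n" for n z
  \<comment> \<open>The parameter \<open>e\<close> serves twice: a bound valid on all of
    \<open>A\<close> gives uniform convergence, and a small bound valid near infinity gives the
    limit 0 of \<open>S\<close> there.\<close>
  have abound: "norm (a n z) \<le> e * (1/2) ^ Suc n" if "norm (Ln (q ((poly P ^^ n) z))) \<le> e" for n z e
  proof -
    have "e \<ge> 0" using that norm_ge_zero order_trans by blast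
    have "norm (a n z) = norm (Ln (q ((poly P ^^ n) z))) / real d ^ Suc n"
      by (simp only: a_def norm_divide norm_power norm_of_nat)
    also have "\<dots> \<le> e / 2 ^ Suc n"
      using that d \<open>e \<ge> 0\<close> by (intro frac_le power_mono) auto
    finally show ?thesis by (simp add: power_one_over field_simps)
  qed
  have abound': "norm (a n z) \<le> C * (1/2) ^ Suc n" if "z \<in> A" for n z
    using abound[OF C[OF qA[OF inA[OF that]]]] .
  have summ: "summable (\<lambda>n. e * (1/2::real) ^ Suc n)" for e
    by (intro summable_mult) (simp add: summable_geometric summable_Suc_iff)
  define S where "S z = (\<Sum>n. a n z)" for z
  have sum_a: "summable (\<lambda>n. a n z)" if "z \<in> A" for z
    by (rule summable_comparison_test'[OF summ[of C], of 0]) (use abound' that in auto)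
  have ul: "uniform_limit A (\<lambda>n z. \<Sum>k<n. a k z) S sequentially"
    unfolding S_def by (rule Weierstrass_m_test[OF _ summ[of C]]) (use abound' in auto)
  have hola: "(\<lambda>z. a n z) holomorphic_on A" for n
  proof -
    have "(\<lambda>z. q ((poly P ^^ n) z)) holomorphic_on A"
      unfolding q_def using holomorphic_on_funpow_poly[of n P A] A0[OF inA]
      by (intro holomorphic_intros) auto
    then have "(Ln \<circ> (\<lambda>z. q ((poly P ^^ n) z))) holomorphic_on A"
      by (rule holomorphic_on_compose_gen[where t = "cball 1 (1/2)"])
         (use slit qA inA in \<open>auto intro!: holomorphic_intros\<close>)
    then show ?thesis unfolding a_def o_def using d by (intro holomorphic_on_divide holomorphic_on_const) auto
  qed
  have holS: "S holomorphic_on A"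
  proof (rule holomorphic_uniform_sequence[OF \<open>open A\<close>])
    show "(\<lambda>z. \<Sum>k<n. a k z) holomorphic_on A" for n using hola by (intro holomorphic_intros)
    show "\<exists>d>0. cball x d \<subseteq> A \<and> uniform_limit (cball x d) (\<lambda>n z. \<Sum>k<n. a k z) S sequentially" if "x \<in> A" for x
      using that \<open>open A\<close> ul by (meson open_contains_cball uniform_limit_on_subset)
  qed
  define h where "h z = z * exp (S z)" for z
  have "h (poly P z) = h z ^ d" if z: "z \<in> A" for z
  proof -
    \<comment> \<open>Evaluating the series at \<open>poly P z\<close> shifts its index and
      multiplies it by \<open>d\<close>. The dropped first term produces the division by
      \<open>q z\<close>, which turns the factor \<open>poly P z\<close> of \<open>h\<close> into
      z^d.\<close>
    have "a n (poly P z) = of_nat d * a (Suc n) z" for n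
      using d by (simp add: a_def funpow_swap1)
    moreover have "summable (\<lambda>n. a (Suc n) z)" using sum_a[OF z] by (subst summable_Suc_iff)
    ultimately have "S (poly P z) = of_nat d * (\<Sum>n. a (Suc n) z)"
      unfolding S_def by (simp add: suminf_mult)
    also have "(\<Sum>n. a (Suc n) z) = S z - a 0 z"
      unfolding S_def using suminf_split_head[OF sum_a[OF z]] by simp
    finally have 1: "S (poly P z) = of_nat d * S z - of_nat d * a 0 z" by (simp add: algebra_simps)
    have "q z \<noteq> 0" using slit[OF qA[OF z]] by auto
    have "of_nat d * a 0 z = Ln (q z)" using d by (simp add: a_def)
    then have "exp (S (poly P z)) = exp (S z) ^ d / q z"
      using \<open>q z \<noteq> 0\<close> by (simp add: 1 exp_diff exp_of_nat_mult)
    moreover have "z \<noteq> 0" using z R(1) by (auto simp: A_def)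
    ultimately show ?thesis using \<open>q z \<noteq> 0\<close>
      by (simp add: h_def power_mult_distrib q_def d_def field_simps)
  qed
  moreover have "h holomorphic_on A" unfolding h_def using holS by (intro holomorphic_intros)
  moreover have "((\<lambda>z. h z / z) \<longlongrightarrow> 1) at_infinity"
  proof -
    have "(S \<longlongrightarrow> 0) at_infinity"
    proof (rule tendstoI)
      fix e :: real assume "e > 0"
      have "((\<lambda>z. Ln (q z)) \<longlongrightarrow> Ln 1) at_infinity"
        using poly_ratio_tendsto unfolding q_def by (intro tendsto_Ln) auto
      then have "\<forall>\<^sub>F z in at_infinity. norm (Ln (q z)) < e / 2"
        using tendstoD[of "\<lambda>z. Ln (q z)" 0 at_infinity "e/2"] \<open>e > 0\<close> by simp
      then obtain B where B: "\<And>z. norm z \<ge> B \<Longrightarrow> norm (Ln (q z)) < e / 2"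
        unfolding eventually_at_infinity by auto
      have "dist (S z) 0 < e" if z: "norm z \<ge> max B (R + 1)" for z
      proof -
        have "z \<in> A" using z by (simp add: A_def)
        then have "norm (Ln (q ((poly P ^^ n) z))) \<le> e / 2" for n
          using B[of "(poly P ^^ n) z"] grow[of z n] z by auto
        then have "norm (a n z) \<le> e/2 * (1/2) ^ Suc n" for n by (rule abound)
        then have "norm (S z) \<le> (\<Sum>n. e/2 * (1/2) ^ Suc n)"
          unfolding S_def by (intro norm_suminf_le summ) 
        also have "\<dots> = e/2 * (\<Sum>n. (1/2) ^ Suc n)"
          using summ[of 1] by (subst suminf_mult[symmetric]) auto
        also have "(\<Sum>n. (1/2::real) ^ Suc n) = 1" using power_half_series sums_iff by blast
        finally show ?thesis using \<open>e > 0\<close> by simp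
      qed
      then show "\<forall>\<^sub>F x in at_infinity. dist (S x) 0 < e" unfolding eventually_at_infinity by blast
    qed
    then have "((\<lambda>z. exp (S z)) \<longlongrightarrow> exp 0) at_infinity" by (intro tendsto_exp)
    then have "((\<lambda>z. exp (S z)) \<longlongrightarrow> 1) at_infinity" by simp
    then show ?thesis
      by (rule Lim_transform_eventually) (auto simp: h_def eventually_at_infinity intro!: exI[of _ 1])
  qed
  ultimately show ?thesis using R(1) R2 by (intro that[of R h]) (auto simp: A_def d_def)
qed

end

subsection \<open>Continuation of the inverse Boettcher coordinate\<close>

text \<open>Each extension of the inverse Boettcher coordinate replaces the radius by its
  \<open>d\<close>-th root; this tells which points are reached after \<open>n\<close> of
  them.\<close>

lemma root_funpow_less_iff:
  assumes "d > 0" "r > 0" "x > 0"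
  shows "(root d ^^ n) r < x \<longleftrightarrow> r < x ^ (d ^ n)"
proof -
  have *: "root d y < x \<longleftrightarrow> y < x ^ d" if "x > 0" for x y
    using assms(1) that by (metis less_imp_le real_root_less_iff real_root_power_cancel)
  have "(root d ^^ n) r < x \<longleftrightarrow> r < x ^ (d ^ n)" if "x > 0" for x
    using that
  proof (induction n arbitrary: x)
    case (Suc n)
    have "(root d ^^ Suc n) r < x \<longleftrightarrow> (root d ^^ n) r < x ^ d" using *[OF Suc.prems] by simp
    also have "\<dots> \<longleftrightarrow> r < (x ^ d) ^ (d ^ n)" using Suc by simp
    finally show ?case by (simp add: power_mult[symmetric] mult.commute)
  qed simp
  then show ?thesis using assms by blast
qed

locale critically_bounded = monic_poly +
  assumes crit: "\<And>c. poly (pderiv P) c = 0 \<Longrightarrow> c \<in> filled_julia P"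
begin

lemma covering_space_escaping_set: "covering_space (- filled_julia P) (poly P) (- filled_julia P)"
proof (rule proper_local_homeomorphism_covering_space)
  show "open (- filled_julia P)" using closed_filled_julia by auto
  then show "open (- filled_julia P)" .
  show "poly P holomorphic_on - filled_julia P" by (intro holomorphic_intros)
  show "poly P ` (- filled_julia P) = - filled_julia P"
  proof (intro equalityI subsetI)
    fix y assume y: "y \<in> - filled_julia P"
    have "degree (P + [:- y:]) = degree P" using deg by (intro degree_add_eq_left) auto
    then have "\<not> constant (poly (P + [:- y:]))"
      using deg by (simp add: constant_degree)
    then have "\<exists>z. poly (P + [:- y:]) z = 0" by (rule Fundamental_Theorem_Algebra.fundamental_theorem_of_algebra)
    then obtain z where "poly P z = y" by auto
    then show "y \<in> poly P ` (- filled_julia P)" using y filled_julia_poly_iff[of P z] by auto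
  qed (auto simp: filled_julia_poly_iff)
  show "deriv (poly P) z \<noteq> 0" if "z \<in> - filled_julia P" for z
    using that crit DERIV_imp_deriv[OF poly_DERIV[of P z]] by auto
  show "compact (- filled_julia P \<inter> poly P -` C)" if C: "compact C" "C \<subseteq> - filled_julia P" for C
  proof -
    have "- filled_julia P \<inter> poly P -` C = poly P -` C"
      using C(2) filled_julia_poly_iff[of P] by auto
    then show ?thesis using compact_vimage_poly[OF C(1)] by simp
  qed
qed

text \<open>The candidate inverse of the Boettcher coordinate outside radius \<open>r\<close>,
  described by its semiconjugacy and its normalisation. Injectivity is not carried through the
  extensions; it is recovered at the end for the map beyond radius 1.\<close>

definition inverse_boettcher_beyond :: "real \<Rightarrow> (complex \<Rightarrow> complex) \<Rightarrow> bool" where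
  "inverse_boettcher_beyond r \<psi> \<longleftrightarrow> \<psi> holomorphic_on {w. norm w > r} \<and>
     (\<forall>w. norm w > r \<longrightarrow> \<psi> w \<notin> filled_julia P \<and> poly P (\<psi> w) = \<psi> (w ^ degree P)) \<and>
     ((\<lambda>w. \<psi> w / w) \<longlongrightarrow> 1) at_infinity"

text \<open>For |w| > r^(1/d) the power w^d lies in the old domain, so the new value must be a
  preimage of \<psi>(w^d) under \<open>P\<close>. The exterior of a disc is not simply connected;
  hence the preimage is chosen for the logarithm s of w, on a half-plane. Uniqueness of lifts shows
  that this choice extends \<psi>(exp s) and has period 2 pi i, so it descends to w.\<close>

lemma inverse_boettcher_extend:
  assumes \<psi>: "inverse_boettcher_beyond r \<psi>" and r: "r > 1"
  obtains \<psi>' where "inverse_boettcher_beyond (root (degree P) r) \<psi>'"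
    "\<And>w. norm w > r \<Longrightarrow> \<psi>' w = \<psi> w"
proof -
  let ?\<Omega> = "- filled_julia P"
  define d where "d = degree P"
  have d: "d \<ge> 2" using deg by (simp add: d_def)
  have hol\<psi>: "\<psi> holomorphic_on {w. norm w > r}" and \<psi>K: "\<And>w. norm w > r \<Longrightarrow> \<psi> w \<in> ?\<Omega>"
    and \<psi>d: "\<And>w. norm w > r \<Longrightarrow> poly P (\<psi> w) = \<psi> (w ^ d)"
    and \<psi>lim: "((\<lambda>w. \<psi> w / w) \<longlongrightarrow> 1) at_infinity"
    using \<psi> by (auto simp: inverse_boettcher_beyond_def d_def)
  define H where "H = {s. Re s > ln r / d}"
  define T where "T = {s. Re s > ln r}"
  have lnr: "ln r > 0" "ln r / d < ln r" using r d by (simp_all add: field_simps)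
  have TH: "T \<subseteq> H" using lnr by (auto simp: T_def H_def)
  have convH: "convex H" "convex T" and oH: "open H"
    unfolding H_def T_def by (auto simp: convex_halfspace_Re_gt open_halfspace_Re_gt)
  define g where "g s = \<psi> (exp (of_nat d * s))" for s
  have norm_exp: "norm (exp (of_nat d * s)) > r" if "s \<in> H" for s
  proof -
    have "ln r < d * Re s" using that d by (simp add: H_def field_simps)
    then have "exp (ln r) < exp (d * Re s)" by simp
    then show ?thesis using r by simp
  qed
  have norm_expT: "norm (exp s) > r" if "s \<in> T" for s
  proof -
    have "exp (ln r) < exp (Re s)" using that by (simp add: T_def)
    then show ?thesis using r by simp
  qed
  have holg: "g holomorphic_on H"
  proof -
    have "(\<psi> \<circ> (\<lambda>s. exp (of_nat d * s))) holomorphic_on H"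
      by (rule holomorphic_on_compose_gen[OF _ hol\<psi>]) (use norm_exp in \<open>auto intro!: holomorphic_intros\<close>)
    then show ?thesis by (simp add: g_def[abs_def] o_def)
  qed
  then have contg: "continuous_on H g" by (rule holomorphic_on_imp_continuous_on)
  have gim: "g \<in> H \<rightarrow> ?\<Omega>" using \<psi>K norm_exp by (auto simp: g_def)
  define s0 :: complex where "s0 = of_real (ln r + 1)"
  have s0: "s0 \<in> T" "s0 \<in> H" using TH by (auto simp: s0_def T_def)
  have gT: "g s = poly P (\<psi> (exp s))" if "s \<in> T" for s
    using \<psi>d[OF norm_expT[OF that]] by (simp add: g_def exp_of_nat_mult)
  have cov: "covering_space ?\<Omega> (poly P) ?\<Omega>" by (rule covering_space_escaping_set)
  obtain F where F: "continuous_on H F" "F \<in> H \<rightarrow> ?\<Omega>" "F s0 = \<psi> (exp s0)" "\<And>s. s \<in> H \<Longrightarrow> poly P (F s) = g s"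
    by (rule covering_space_lift_strong[OF cov \<psi>K[OF norm_expT[OF s0(1)]] s0(2)
          convex_imp_simply_connected[OF convH(1)] convex_imp_locally_path_connected[OF convH(1)] contg gim gT[OF s0(1)]])
       blast
  have holF: "F holomorphic_on H"
    by (rule covering_space_lift_is_holomorphic[OF cov _ _ holg gim F(2,1,4)])
       (use closed_filled_julia in \<open>auto intro!: holomorphic_intros\<close>)
  have FT: "F s = \<psi> (exp s)" if "s \<in> T" for s
  proof (rule covering_space_lift_unique[OF cov, where T = T and a = s0 and f = g and ?g1.0 = F
        and ?g2.0 = "\<lambda>s. \<psi> (exp s)" and x = s])
    show "continuous_on T g" "continuous_on T F" using contg F(1) TH continuous_on_subset by blast+
    have "(\<psi> \<circ> exp) holomorphic_on T"
      by (rule holomorphic_on_compose_gen[OF _ hol\<psi>]) (use norm_expT in \<open>auto intro!: holomorphic_intros\<close>)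
    then show "continuous_on T (\<lambda>s. \<psi> (exp s))" by (simp add: o_def holomorphic_on_imp_continuous_on)
  qed (use F gim TH s0 gT \<psi>K norm_expT that convH convex_connected in auto)
  \<comment> \<open>Since \<open>g\<close> has period 2 pi i, the shifted map is again a lift of
    \<open>g\<close>. At \<open>s0\<close> both lifts take the value of \<psi>(exp s), so they
    coincide.\<close>
  have period: "F (s + 2 * of_real pi * \<i>) = F s" if "s \<in> H" for s
  proof (rule covering_space_lift_unique[OF cov, where T = H and a = s0 and f = g
        and ?g1.0 = "\<lambda>s. F (s + 2 * of_real pi * \<i>)" and ?g2.0 = F and x = s])
    have plus: "s + 2 * of_real pi * \<i> \<in> H" if "s \<in> H" for s using that by (simp add: H_def)
    have "s0 + 2 * of_real pi * \<i> \<in> T" using s0 by (simp add: T_def)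
    then show "F (s0 + 2 * of_real pi * \<i>) = F s0" using FT s0 by (simp add: exp_add)
    show "continuous_on H (\<lambda>s. F (s + 2 * of_real pi * \<i>))"
      by (rule continuous_on_compose2[OF F(1)]) (use plus in \<open>auto intro!: continuous_intros\<close>)
    show "(\<lambda>s. F (s + 2 * of_real pi * \<i>)) \<in> H \<rightarrow> ?\<Omega>" using plus F(2) by auto
    show "g x = poly P (F (x + 2 * of_real pi * \<i>))" if "x \<in> H" for x
    proof -
      have "g (x + 2 * of_real pi * \<i>) = g x"
      proof -
        have "exp (of_nat d * (x + 2 * of_real pi * \<i>)) = (exp (x + 2 * of_real pi * \<i>)) ^ d"
          by (rule exp_of_nat_mult)
        also have "\<dots> = exp (of_nat d * x)" by (simp add: exp_add exp_of_nat_mult)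
        finally show ?thesis by (simp add: g_def)
      qed
      then show ?thesis using F(4)[OF plus[OF that]] by simp
    qed
  qed (use F gim contg s0 that convH convex_connected in auto)
  have period_nat: "F (s + of_nat n * (2 * of_real pi * \<i>)) = F s" if "s \<in> H" for s n
  proof (induction n)
    case (Suc n)
    have "s + of_nat n * (2 * of_real pi * \<i>) \<in> H" using that by (simp add: H_def)
    from period[OF this] Suc show ?case by (simp add: algebra_simps)
  qed simp
  have Fexp: "F s = F s'" if "s \<in> H" "s' \<in> H" "exp s = exp s'" for s s'
  proof -
    have "\<exists>n::int. s = s' + (of_int (2 * n) * of_real pi) * \<i>" using that(3) by (simp add: exp_eq)
    then obtain n :: int where n: "s = s' + (of_int (2 * n) * of_real pi) * \<i>" by blast
    show ?thesis
    proof (cases "n \<ge> 0")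
      case True
      then have "s = s' + of_nat (nat n) * (2 * of_real pi * \<i>)" using n by (simp add: algebra_simps)
      then show ?thesis using period_nat[OF that(2)] by simp
    next
      case False
      then have "s' = s + of_nat (nat (-n)) * (2 * of_real pi * \<i>)" using n by (simp add: algebra_simps)
      then show ?thesis using period_nat[OF that(1)] by simp
    qed
  qed
  define \<psi>' where "\<psi>' w = F (Ln w)" for w
  define r' where "r' = root d r"
  have r': "r' > 1" using r d by (simp add: r'_def)
  have lnr': "ln r' = ln r / d" using r d by (simp add: r'_def ln_root)
  have LnH: "Ln w \<in> H" "w \<noteq> 0" if "norm w > r'" for w
  proof -
    show "w \<noteq> 0" using that r' by auto
    have "ln r' < ln (norm w)" using that r' \<open>w \<noteq> 0\<close> by simp
    then show "Ln w \<in> H" using \<open>w \<noteq> 0\<close> by (simp add: H_def lnr')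
  qed
  have LnT: "Ln w \<in> T" "w \<noteq> 0" if "norm w > r" for w
  proof -
    show "w \<noteq> 0" using that r by auto
    have "ln r < ln (norm w)" using that r \<open>w \<noteq> 0\<close> by simp
    then show "Ln w \<in> T" using \<open>w \<noteq> 0\<close> by (simp add: T_def)
  qed
  have ext: "\<psi>' w = \<psi> w" if "norm w > r" for w
    using FT[OF LnT(1)[OF that]] LnT(2)[OF that] by (simp add: \<psi>'_def)
  have pow: "norm (w ^ d) > r" if "norm w > r'" for w :: complex
  proof -
    have "r' ^ d < norm w ^ d" using that r' d by (intro power_strict_mono) auto
    then show ?thesis using r d by (simp add: r'_def norm_power)
  qed
  have "\<psi>' field_differentiable (at w0)" if w0: "norm w0 > r'" for w0
  proof -
    \<comment> \<open>\<open>Ln\<close> jumps across the negative axis, so near \<open>w0\<close>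
      the branch Ln (w / w0) + Ln w0 takes its place. In the disc of radius |w0| about
      \<open>w0\<close> the quotient w / w0 avoids the slit, and by \<open>Fexp\<close> the value of
      \<open>F\<close> does not depend on the branch.\<close>
    define V where "V = {w. norm w > r'} \<inter> ball w0 (norm w0)"
    have "open V" unfolding V_def by (intro open_Int open_ball open_Collect_less continuous_intros)
    have "w0 \<in> V" using w0 LnH(2)[OF w0] by (simp add: V_def)
    have slit: "w / w0 \<notin> \<real>\<^sub>\<le>\<^sub>0" if "w \<in> V" for w
    proof
      assume "w / w0 \<in> \<real>\<^sub>\<le>\<^sub>0"
      then obtain t where t: "t \<le> 0" "w / w0 = of_real t" by (auto elim: nonpos_Reals_cases)
      then have "w = of_real t * w0" using LnH(2)[OF w0] by (simp add: field_simps)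
      then have "norm (w0 - w) = (1 - t) * norm w0"
        using t by (metis (no_types, opaque_lifting) abs_of_nonneg diff_ge_0_iff_ge dual_order.trans left_diff_distrib mult_1 norm_mult norm_of_real of_real_1 of_real_diff zero_le_one)
      also have "\<dots> \<ge> norm w0" using t mult_right_mono[of 1 "1 - t" "norm w0"] by simp
      finally show False using that by (simp add: V_def dist_norm)
    qed
    have LH: "Ln (w / w0) + Ln w0 \<in> H" "exp (Ln (w / w0) + Ln w0) = w" if "w \<in> V" for w
    proof -
      have n: "norm w > r'" using that by (simp add: V_def)
      have nz: "w \<noteq> 0" "w0 \<noteq> 0" using LnH(2)[OF n] LnH(2)[OF w0] by auto
      then show "exp (Ln (w / w0) + Ln w0) = w" by (simp add: exp_add)
      have "Re (Ln (w / w0) + Ln w0) = Re (Ln w)" using nz by (simp add: norm_divide ln_div)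
      then show "Ln (w / w0) + Ln w0 \<in> H" using LnH(1)[OF n] by (simp add: H_def)
    qed
    have "(F \<circ> (\<lambda>w. Ln (w / w0) + Ln w0)) holomorphic_on V"
      by (rule holomorphic_on_compose_gen[OF _ holF])
         (use LH slit LnH(2)[OF w0] in \<open>auto intro!: holomorphic_intros\<close>)
    then have "\<psi>' holomorphic_on V"
    proof (rule holomorphic_transform)
      fix w assume w: "w \<in> V"
      then have "norm w > r'" by (simp add: V_def)
      then show "(F \<circ> (\<lambda>w. Ln (w / w0) + Ln w0)) w = \<psi>' w"
        using Fexp[OF LH(1)[OF w] LnH(1)] LH(2)[OF w] LnH(2) by (simp add: \<psi>'_def)
    qed
    then show ?thesis using \<open>open V\<close> \<open>w0 \<in> V\<close> holomorphic_on_imp_differentiable_at by blast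
  qed
  then have "\<psi>' holomorphic_on {w. norm w > r'}"
    by (simp add: holomorphic_on_def field_differentiable_at_within)
  moreover have "\<psi>' w \<notin> filled_julia P \<and> poly P (\<psi>' w) = \<psi>' (w ^ d)" if w: "norm w > r'" for w
  proof
    show "\<psi>' w \<notin> filled_julia P" using F(2) LnH(1)[OF w] by (auto simp: \<psi>'_def)
    have "poly P (\<psi>' w) = \<psi> (w ^ d)"
      using F(4)[OF LnH(1)[OF w]] LnH(2)[OF w] by (simp add: \<psi>'_def g_def exp_of_nat_mult)
    then show "poly P (\<psi>' w) = \<psi>' (w ^ d)" using ext[OF pow[OF w]] by simp
  qed
  moreover have "((\<lambda>w. \<psi>' w / w) \<longlongrightarrow> 1) at_infinity"
    by (rule Lim_transform_eventually[OF \<psi>lim]) (use ext in \<open>auto simp: eventually_at_infinity intro!: exI[of _ "r+1"]\<close>)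
  ultimately have "inverse_boettcher_beyond (root (degree P) r) \<psi>'"
    by (simp add: inverse_boettcher_beyond_def r'_def d_def)
  then show ?thesis using that ext by blast
qed

text \<open>The radii r^(1/d^n) decrease to 1 and each extension agrees with its predecessor, so
  together they cover the exterior of the unit disc, and at a given point every admissible index
  yields the same value.\<close>

lemma inverse_boettcher_glue:
  assumes \<psi>0: "inverse_boettcher_beyond r \<psi>0" and r: "r > 1"
  obtains \<psi> where "inverse_boettcher_beyond 1 \<psi>" "\<And>w. norm w > r \<Longrightarrow> \<psi> w = \<psi>0 w"
proof -
  define d where "d = degree P"
  have d: "d \<ge> 2" using deg by (simp add: d_def)
  define rr where "rr n = (root d ^^ n) r" for n
  have rr1: "rr n > 1" for n unfolding rr_def using r d by (induction n) auto
  have rr_Suc: "rr (Suc n) \<le> rr n" for n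
  proof -
    have "rr n ^ 1 \<le> rr n ^ d" using rr1[of n] d by (intro power_increasing) auto
    then have "root d (rr n) \<le> root d (rr n ^ d)" using d by simp
    also have "\<dots> = rr n" using rr1[of n] d by (intro real_root_power_cancel) auto
    finally show ?thesis by (simp add: rr_def)
  qed
  have "decseq rr" using rr_Suc by (rule decseq_SucI)
  have "\<exists>\<Psi>. \<forall>n. (inverse_boettcher_beyond (rr n) (\<Psi> n) \<and> (n = 0 \<longrightarrow> \<Psi> n = \<psi>0)) \<and>
        (\<forall>w. norm w > rr n \<longrightarrow> \<Psi> (Suc n) w = \<Psi> n w)"
  proof (rule dependent_nat_choice)
    show "\<exists>x. inverse_boettcher_beyond (rr 0) x \<and> (0 = (0::nat) \<longrightarrow> x = \<psi>0)" using \<psi>0 by (simp add: rr_def)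
    fix x :: "complex \<Rightarrow> complex" and n
    assume x: "inverse_boettcher_beyond (rr n) x \<and> (n = 0 \<longrightarrow> x = \<psi>0)"
    then obtain y where "inverse_boettcher_beyond (root (degree P) (rr n)) y" "\<And>w. norm w > rr n \<Longrightarrow> y w = x w"
      using inverse_boettcher_extend[OF _ rr1] by blast
    then show "\<exists>y. (inverse_boettcher_beyond (rr (Suc n)) y \<and> (Suc n = 0 \<longrightarrow> y = \<psi>0)) \<and> (\<forall>w. rr n < norm w \<longrightarrow> y w = x w)"
      by (auto simp: rr_def d_def)
  qed
  then obtain \<Psi> where \<Psi>: "\<And>n. inverse_boettcher_beyond (rr n) (\<Psi> n)" "\<Psi> 0 = \<psi>0"
     "\<And>n w. norm w > rr n \<Longrightarrow> \<Psi> (Suc n) w = \<Psi> n w" by blast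
  have \<Psi>_add: "\<Psi> (n + k) w = \<Psi> n w" if "norm w > rr n" for n k w
  proof (induction k)
    case (Suc k)
    have "rr (n + k) \<le> rr n" using \<open>decseq rr\<close> by (simp add: decseq_def)
    then show ?case using \<Psi>(3)[of "n + k" w] that Suc by simp
  qed simp
  define N where "N w = (LEAST n. norm (w::complex) > rr n)" for w
  define \<psi> where "\<psi> w = \<Psi> (N w) w" for w
  have \<psi>eq: "\<psi> w = \<Psi> n w" if "norm w > rr n" for n w
  proof -
    have "N w \<le> n" unfolding N_def using that by (rule Least_le)
    moreover have "norm w > rr (N w)" unfolding N_def using that by (rule LeastI)
    ultimately show ?thesis using \<Psi>_add[of "N w" w "n - N w"] by (simp add: \<psi>_def)
  qed
  have ex: "\<exists>n. norm w > rr n" if w: "norm w > 1" for w :: complex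
  proof -
    obtain m where "r < norm w ^ (d ^ m)" using power_power_unbounded[OF w d] by blast
    then have "rr m < norm w" unfolding rr_def using w r d by (subst root_funpow_less_iff) auto
    then show ?thesis by blast
  qed
  have "\<psi> field_differentiable at w" if w: "norm w > 1" for w
  proof -
    obtain n where n: "norm w > rr n" using ex[OF w] by blast
    have "open {w::complex. norm w > rr n}" by (intro open_Collect_less continuous_intros)
    moreover have "\<psi> holomorphic_on {w. norm w > rr n}"
      by (rule holomorphic_transform[of "\<Psi> n"]) (use \<Psi>(1)[of n] \<psi>eq in \<open>auto simp: inverse_boettcher_beyond_def\<close>)
    ultimately show ?thesis using n holomorphic_on_imp_differentiable_at by blast
  qed
  then have "\<psi> holomorphic_on {w. norm w > 1}"
    by (simp add: holomorphic_on_def field_differentiable_at_within)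
  moreover have "\<psi> w \<notin> filled_julia P \<and> poly P (\<psi> w) = \<psi> (w ^ degree P)" if w: "norm w > 1" for w
  proof -
    obtain n where n: "norm w > rr n" using ex[OF w] by blast
    have "norm w ^ 1 \<le> norm w ^ degree P" using w deg by (intro power_increasing) auto
    then have "norm (w ^ degree P) > rr n" using n by (simp add: norm_power)
    then show ?thesis using \<Psi>(1)[of n] n \<psi>eq by (simp add: inverse_boettcher_beyond_def)
  qed
  moreover have eq0: "\<psi> w = \<psi>0 w" if "norm w > r" for w using \<psi>eq[of 0 w] that \<Psi>(2) by (simp add: rr_def)
  moreover have "((\<lambda>w. \<psi> w / w) \<longlongrightarrow> 1) at_infinity"
    using \<psi>0 unfolding inverse_boettcher_beyond_def
    by (auto intro!: Lim_transform_eventually[of "\<lambda>w. \<psi>0 w / w"] simp: eq0 eventually_at_infinity intro!: exI[of _ "r+1"])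
  ultimately show ?thesis using that by (auto simp: inverse_boettcher_beyond_def)
qed

end

lemma is_boettcher_norm_gt:
  assumes "is_boettcher P \<beta>" "z \<notin> filled_julia P" shows "norm (\<beta> z) > 1"
proof -
  have "\<beta> ` (- filled_julia P) = - cball 0 1" using assms(1) by (simp add: is_boettcher_def bij_betw_def)
  then have "\<beta> z \<in> - cball 0 1" using assms(2) by blast
  then show ?thesis by simp
qed

subsection \<open>Existence of the Boettcher coordinate\<close>

lemma connected_exterior: "connected {w::complex. norm w > 1}"
proof -
  have "{w::complex. norm w > 1} = - cball 0 1" by auto
  then show ?thesis using connected_complement_bounded_convex[of "cball 0 1 :: complex set"] by simp
qed

context critically_bounded begin

text \<open>After the continuation, bijectivity of \<open>\<psi>\<close> onto the escaping set
  remains. Injectivity spreads inwards from infinity by uniqueness of lifts, surjectivity by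
  counting preimages.\<close>

theorem boettcher_exists: "\<exists>\<beta>. is_boettcher P \<beta>"
proof -
  define d where "d = degree P"
  have d: "d \<ge> 2" using deg by (simp add: d_def)
  obtain R h where R: "R \<ge> 1" "h holomorphic_on {z. norm z > R}"
    "\<And>z. norm z > R \<Longrightarrow> norm (poly P z) \<ge> 2 * norm z"
    "\<And>z. norm z > R \<Longrightarrow> h (poly P z) = h z ^ d"
    "((\<lambda>z. h z / z) \<longlongrightarrow> 1) at_infinity"
    using boettcher_near_infinity unfolding d_def by blast
  obtain \<rho> R' \<psi>0 where \<psi>0: "\<rho> \<ge> 1" "R' \<ge> 1" "\<psi>0 holomorphic_on {w. norm w > \<rho>}"
    "\<And>w. norm w > \<rho> \<Longrightarrow> norm (\<psi>0 w) > R \<and> h (\<psi>0 w) = w"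
    "\<And>z. norm z > R' \<Longrightarrow> norm (h z) > \<rho> \<and> \<psi>0 (h z) = z"
    "((\<lambda>w. \<psi>0 w / w) \<longlongrightarrow> 1) at_infinity"
    using holomorphic_inverse_near_infinity[OF R(2,5)] by blast
  obtain b0 where b0: "\<And>w. norm w \<ge> b0 \<Longrightarrow> norm (\<psi>0 w) \<ge> norm w / 2" using asymptotic_to_identity_bound[OF \<psi>0(6)] by blast
  obtain b1 where b1: "\<And>w. norm w \<ge> b1 \<Longrightarrow> norm (h w) \<ge> norm w / 2" using asymptotic_to_identity_bound[OF R(5)] by blast
  \<comment> \<open>Beyond \<open>r\<close> the estimate |\<psi>0 w| \<ge> |w|/2 lands past
    \<open>R'\<close>, where \<open>\<psi>0\<close> inverts \<open>h\<close>, and past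
    \<open>R + 1\<close>, outside the filled Julia set.\<close>
  define r where "r = max (max 2 \<rho>) (max b0 (max (2 * R') (2 * (R + 1))))"
  have r: "r > 1" "r \<ge> \<rho>" "r \<ge> b0" "r \<ge> 2 * R'" "r \<ge> 2 * (R + 1)" unfolding r_def by linarith+
  have \<psi>0_large: "norm (\<psi>0 w) > R'" "norm (\<psi>0 w) > R + 1" if "norm w > r" for w
  proof -
    have "norm w \<ge> b0" using that r(3) by linarith
    note b = b0[OF this]
    show "norm (\<psi>0 w) > R'" using b that r(4) by linarith
    have "2 * R + 2 \<le> r" using r(5) by (simp add: algebra_simps)
    with b that show "R + 1 < norm (\<psi>0 w)" by argo
  qed
  have esc: "z \<notin> filled_julia P" if "norm z > R + 1" for z
    by (rule notin_filled_julia[of "R + 1"]) (use R(1,3) that in auto)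
  have \<psi>0d: "poly P (\<psi>0 w) = \<psi>0 (w ^ d)" if w: "norm w > r" for w
  proof -
    have n: "norm (\<psi>0 w) > R" using \<psi>0_large(2)[OF w] by simp
    have "norm (poly P (\<psi>0 w)) > R'" using R(3)[OF n] \<psi>0_large(1)[OF w] norm_ge_zero[of "\<psi>0 w"] by linarith
    then have "\<psi>0 (h (poly P (\<psi>0 w))) = poly P (\<psi>0 w)" using \<psi>0(5) by blast
    moreover have "h (poly P (\<psi>0 w)) = w ^ d" using R(4)[OF n] \<psi>0(4)[of w] w r by simp
    ultimately show ?thesis by simp
  qed
  have "inverse_boettcher_beyond r \<psi>0"
    unfolding inverse_boettcher_beyond_def
  proof (intro conjI allI impI)
    show "\<psi>0 holomorphic_on {w. r < norm w}" by (rule holomorphic_on_subset[OF \<psi>0(3)]) (use r in auto)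
  qed (use \<psi>0d esc \<psi>0_large \<psi>0(6) in \<open>auto simp: d_def\<close>)
  then obtain \<psi> where \<psi>': "inverse_boettcher_beyond 1 \<psi>" and \<psi>eq: "\<And>w. norm w > r \<Longrightarrow> \<psi> w = \<psi>0 w"
    using inverse_boettcher_glue r(1) by blast
  define W where "W = {w::complex. norm w > 1}"
  have conW: "connected W" and oW: "open W"
    unfolding W_def by (auto simp: connected_exterior intro!: open_Collect_less continuous_intros)
  have \<psi>: "\<psi> holomorphic_on W" "\<And>w. w \<in> W \<Longrightarrow> \<psi> w \<in> - filled_julia P"
      "\<And>w. w \<in> W \<Longrightarrow> poly P (\<psi> w) = \<psi> (w ^ d)" "((\<lambda>w. \<psi> w / w) \<longlongrightarrow> 1) at_infinity"
    using \<psi>' by (auto simp: inverse_boettcher_beyond_def W_def d_def)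
  have Wpow: "w ^ n \<in> W" if "w \<in> W" "n > 0" for w n
    using that by (simp add: W_def norm_power one_less_power)
  have contpsi: "continuous_on W \<psi>" using \<psi>(1) holomorphic_on_imp_continuous_on by blast
  \<comment> \<open>Here b = \<zeta> a with \<zeta>^d = 1. Both \<psi>(\<zeta> w) and \<psi>(w) lift
    \<psi>(w^d) through \<open>P\<close> and they agree at w = a, hence everywhere; the
    normalisation at infinity then forces \<zeta> = 1.\<close>
  have step: "a = b" if ab: "a \<in> W" "b \<in> W" "a ^ d = b ^ d" "\<psi> a = \<psi> b" for a b
  proof -
    define \<zeta> where "\<zeta> = b / a"
    have nz: "a \<noteq> 0" using ab by (auto simp: W_def)
    then have b: "b = \<zeta> * a" by (simp add: \<zeta>_def)
    have \<zeta>1: "\<zeta> ^ d = 1" using ab(3) nz by (simp add: \<zeta>_def power_divide flip: ab(3))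
    then have n\<zeta>: "norm \<zeta> = 1" using d by (metis norm_power norm_one norm_ge_zero power_eq_1_iff not_numeral_le_zero)
    have \<zeta>W: "\<zeta> * w \<in> W" if "w \<in> W" for w using that n\<zeta> by (simp add: W_def norm_mult)
    have "\<psi> (\<zeta> * w) = \<psi> w" if w: "w \<in> W" for w
    proof (rule covering_space_lift_unique[OF covering_space_escaping_set, where T = W and a = a
            and f = "\<lambda>w. \<psi> (w ^ d)" and ?g1.0 = "\<lambda>w. \<psi> (\<zeta> * w)" and ?g2.0 = \<psi> and x = w])
      show "continuous_on W (\<lambda>w. \<psi> (w ^ d))"
        by (rule continuous_on_compose2[OF contpsi]) (use Wpow d in \<open>auto intro!: continuous_intros\<close>)
      show "continuous_on W (\<lambda>w. \<psi> (\<zeta> * w))"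
        by (rule continuous_on_compose2[OF contpsi]) (use \<zeta>W in \<open>auto intro!: continuous_intros\<close>)
      show "\<psi> (x ^ d) = poly P (\<psi> (\<zeta> * x))" if "x \<in> W" for x
        using \<psi>(3)[OF \<zeta>W[OF that]] \<zeta>1 by (simp add: power_mult_distrib)
      show "\<psi> (\<zeta> * a) = \<psi> a" using ab(4) b by simp
    qed (use w conW contpsi \<psi> \<zeta>W ab Wpow d in auto)
    then have eq: "\<psi> (\<zeta> * w) = \<psi> w" if "norm w > 1" for w using that by (simp add: W_def)
    have "\<zeta> \<noteq> 0" using n\<zeta> by auto
    have "filterlim (\<lambda>w. \<zeta> * w) at_infinity at_infinity"
      by (rule tendsto_mult_filterlim_at_infinity[OF tendsto_const \<open>\<zeta> \<noteq> 0\<close> filterlim_ident])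
    then have "((\<lambda>w. \<zeta> * (\<psi> (\<zeta> * w) / (\<zeta> * w))) \<longlongrightarrow> \<zeta> * 1) at_infinity"
      by (intro tendsto_mult tendsto_const filterlim_compose[OF \<psi>(4)])
    then have "((\<lambda>w. \<psi> w / w) \<longlongrightarrow> \<zeta> * 1) at_infinity"
      by (rule Lim_transform_eventually)
         (use \<open>\<zeta> \<noteq> 0\<close> eq in \<open>auto simp: eventually_at_infinity intro!: exI[of _ 2]\<close>)
    from tendsto_unique[OF trivial_limit_at_infinity this \<psi>(4)] have "\<zeta> = 1" by simp
    then show ?thesis using b by simp
  qed
  have iter: "\<psi> (a ^ (d ^ n)) = \<psi> (b ^ (d ^ n))" if "a \<in> W" "b \<in> W" "\<psi> a = \<psi> b" for a b n
  proof (induction n)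
    case (Suc n)
    have "poly P (\<psi> (a ^ (d ^ n))) = poly P (\<psi> (b ^ (d ^ n)))" using Suc by simp
    then show ?case using \<psi>(3)[OF Wpow] that d by (simp add: power_mult[symmetric] mult.commute)
  qed (use that in simp)
  have down: "a = b" if "a \<in> W" "b \<in> W" "\<psi> a = \<psi> b" "a ^ (d ^ n) = b ^ (d ^ n)" for a b n
    using that(4)
  proof (induction n)
    case (Suc n)
    have "(a ^ (d ^ n)) ^ d = (b ^ (d ^ n)) ^ d"
      using Suc.prems by (simp add: power_mult[symmetric] mult.commute)
    moreover have "a ^ (d ^ n) \<in> W" "b ^ (d ^ n) \<in> W" using that d by (auto intro!: Wpow)
    ultimately have "a ^ (d ^ n) = b ^ (d ^ n)" using step iter[OF that(1-3)] by blast
    then show ?case by (rule Suc.IH)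
  qed simp
  \<comment> \<open>Raise both points to the power d^k until they lie where \<open>h\<close> is a
    left inverse of \<open>\<psi>\<close>. The powers are then equal, and \<open>down\<close> takes
    the d-th roots back one at a time.\<close>
  have inj: "inj_on \<psi> W"
  proof (rule inj_onI)
    fix a b assume ab: "a \<in> W" "b \<in> W" "\<psi> a = \<psi> b"
    obtain n where n: "norm a ^ (d ^ n) > r" using power_power_unbounded[of "norm a" d r] ab(1) d by (auto simp: W_def)
    obtain m where m: "norm b ^ (d ^ m) > r" using power_power_unbounded[of "norm b" d r] ab(2) d by (auto simp: W_def)
    define k where "k = max n m"
    have k1: "norm a ^ (d ^ n) \<le> norm a ^ (d ^ k)" and k2: "norm b ^ (d ^ m) \<le> norm b ^ (d ^ k)"
      using ab d by (auto intro!: power_increasing simp: k_def W_def)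
    have na: "norm (a ^ (d ^ k)) > r" using k1 n by (simp add: norm_power)
    have nb: "norm (b ^ (d ^ k)) > r" using k2 m by (simp add: norm_power)
    have "h (\<psi> (a ^ (d ^ k))) = h (\<psi> (b ^ (d ^ k)))" using iter[OF ab] by simp
    then have "a ^ (d ^ k) = b ^ (d ^ k)"
      using \<psi>eq[OF na] \<psi>eq[OF nb] \<psi>0(4)[of "a ^ (d ^ k)"] \<psi>0(4)[of "b ^ (d ^ k)"] na nb r(2) by simp
    then show "a = b" using down ab by blast
  qed
  define R'' where "R'' = max R' (max b1 (2 * r))"
  have near: "norm (h z) > r \<and> \<psi> (h z) = z" if z: "norm z > R''" for z
  proof -
    have "norm (h z) > r" using b1[of z] z by (simp add: R''_def)
    moreover have "\<psi>0 (h z) = z" using \<psi>0(5)[of z] z by (simp add: R''_def)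
    ultimately show ?thesis using \<psi>eq by simp
  qed
  \<comment> \<open>The \<open>d\<close> roots of \<open>v\<close> give \<open>d\<close> distinct preimages of \<open>\<psi> v\<close>, so there are no others.\<close>
  have descend: "z \<in> \<psi> ` W" if "poly P z \<in> \<psi> ` W" for z
  proof -
    from that obtain v where v: "v \<in> W" "poly P z = \<psi> v" by auto
    define V where "V = {u. u ^ d = v}"
    have vnz: "v \<noteq> 0" using v by (auto simp: W_def)
    have VW: "V \<subseteq> W"
    proof
      fix u assume u: "u \<in> V"
      then have "norm u ^ d > 1" using v by (auto simp: V_def W_def norm_power[symmetric])
      then show "u \<in> W" using power_le_one[of "norm u" d] by (auto simp: W_def not_le[symmetric])
    qed
    have cV: "card V = d" unfolding V_def using vnz d by (intro card_nth_roots) auto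
    define Y where "Y = {y. poly (P + [:- poly P z:]) y = 0}"
    have dY: "degree (P + [:- poly P z:]) = d" unfolding d_def using deg by (intro degree_add_eq_left) auto
    then have nzp: "P + [:- poly P z:] \<noteq> 0" using d by auto
    then have "finite Y" "card Y \<le> d" unfolding Y_def using dY poly_roots_finite card_poly_roots_bound by metis+
    moreover have "\<psi> ` V \<subseteq> Y"
    proof
      fix y assume "y \<in> \<psi> ` V"
      then obtain u where u: "u \<in> V" "y = \<psi> u" by auto
      then have "poly P y = \<psi> (u ^ d)" using \<psi>(3) VW by auto
      then show "y \<in> Y" using u v by (simp add: Y_def V_def)
    qed
    moreover have "card (\<psi> ` V) = d"
      using cV inj_on_subset[OF inj VW] by (simp add: card_image)
    ultimately have "\<psi> ` V = Y" by (metis card_subset_eq card_mono le_antisym)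
    moreover have "z \<in> Y" by (simp add: Y_def)
    ultimately show ?thesis using VW by auto
  qed
  \<comment> \<open>Far out \<open>\<psi>\<close> is onto because it inverts \<open>h\<close> there.
    Every escaping orbit gets there, and \<open>descend\<close> pulls membership in the image back
    along the orbit.\<close>
  have surj: "\<psi> ` W = - filled_julia P"
  proof
    show "- filled_julia P \<subseteq> \<psi> ` W"
    proof
      fix z assume z: "z \<in> - filled_julia P"
      have "\<forall>\<^sub>F n in sequentially. norm ((poly P ^^ n) z) > R''"
        using iterates_at_infinity[of z] z
        by (auto simp: filterlim_at_infinity_conv_norm_at_top filterlim_at_top_dense)
      then obtain n where n: "norm ((poly P ^^ n) z) > R''" by (auto simp: eventually_sequentially)
      have "(poly P ^^ n) z \<in> \<psi> ` W"
        using near[OF n] r(1) by (intro image_eqI[of _ _ "h ((poly P ^^ n) z)"]) (auto simp: W_def)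
      then show "z \<in> \<psi> ` W"
      proof (induction n)
        case (Suc n)
        then show ?case using descend by simp
      qed simp
    qed
  qed (use \<psi>(2) in auto)
  obtain \<beta> where \<beta>: "\<beta> holomorphic_on \<psi> ` W" "\<And>w. w \<in> W \<Longrightarrow> \<beta> (\<psi> w) = w"
    using holomorphic_has_inverse[OF \<psi>(1) oW inj] by metis
  have "is_boettcher P \<beta>"
    unfolding is_boettcher_def
  proof (intro conjI ballI)
    show "\<beta> holomorphic_on - filled_julia P" using \<beta>(1) surj by simp
    have "bij_betw \<beta> (\<psi> ` W) W"
      by (rule bij_betw_byWitness[of _ \<psi>]) (use \<beta>(2) in auto)
    moreover have "W = - cball 0 1" by (auto simp: W_def)
    ultimately show "bij_betw \<beta> (- filled_julia P) (- cball 0 1)" using surj by simp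
    show "\<beta> (poly P z) = \<beta> z ^ degree P" if z: "z \<in> - filled_julia P" for z
    proof -
      have "z \<in> \<psi> ` W" using z surj by simp
      then obtain w where w: "w \<in> W" "z = \<psi> w" by blast
      have "w ^ d \<in> W" using w d by (intro Wpow) auto
      then show ?thesis using w \<psi>(3)[OF w(1)] \<beta>(2) by (simp add: d_def)
    qed
    show "((\<lambda>z. \<beta> z / z) \<longlongrightarrow> 1) at_infinity"
    proof (rule Lim_transform_eventually[OF R(5)])
      have "h z / z = \<beta> z / z" if "norm z \<ge> R'' + 1" for z
      proof -
        have "norm z > R''" using that by simp
        from near[OF this] r(1) have "h z \<in> W" "\<psi> (h z) = z" by (auto simp: W_def)
        moreover from this(1) have "\<beta> (\<psi> (h z)) = h z" by (rule \<beta>(2))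
        ultimately show ?thesis by simp
      qed
      then show "\<forall>\<^sub>F z in at_infinity. h z / z = \<beta> z / z" unfolding eventually_at_infinity by blast
    qed
  qed
  then show ?thesis by blast
qed

end

section \<open>Connectedness of the escaping set and of the Julia set\<close>

context monic_poly begin

lemma is_boettcher_inverse:
  assumes "is_boettcher P \<beta>"
  obtains \<psi> where "\<psi> holomorphic_on (- cball 0 1)" "\<And>z. z \<notin> filled_julia P \<Longrightarrow> \<psi> (\<beta> z) = z"
    "\<And>w. norm w > 1 \<Longrightarrow> \<psi> w \<notin> filled_julia P \<and> \<beta> (\<psi> w) = w"
proof -
  have \<beta>: "\<beta> holomorphic_on - filled_julia P" "bij_betw \<beta> (- filled_julia P) (- cball 0 1)"
    using assms by (auto simp: is_boettcher_def)
  have "open (- filled_julia P)" using closed_filled_julia by auto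
  then obtain \<psi> where \<psi>: "\<psi> holomorphic_on \<beta> ` (- filled_julia P)" "\<And>z. z \<in> - filled_julia P \<Longrightarrow> \<psi> (\<beta> z) = z"
    using holomorphic_has_inverse[OF \<beta>(1)] \<beta>(2) by (metis bij_betw_imp_inj_on)
  have im: "\<beta> ` (- filled_julia P) = - cball 0 1" using \<beta>(2) by (simp add: bij_betw_def)
  show ?thesis
  proof
    show "\<psi> holomorphic_on - cball 0 1" using \<psi>(1) im by simp
    fix w :: complex assume "norm w > 1"
    then have "w \<in> \<beta> ` (- filled_julia P)" using im by auto
    then show "\<psi> w \<notin> filled_julia P \<and> \<beta> (\<psi> w) = w" using \<psi>(2) by auto
  qed (use \<psi>(2) in auto)
qed

lemma connected_escaping_set:
  assumes "is_boettcher P \<beta>" shows "connected (- filled_julia P)"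
proof -
  obtain \<psi> where \<psi>: "\<psi> holomorphic_on (- cball 0 1)" "\<And>z. z \<notin> filled_julia P \<Longrightarrow> \<psi> (\<beta> z) = z"
    "\<And>w. norm w > 1 \<Longrightarrow> \<psi> w \<notin> filled_julia P \<and> \<beta> (\<psi> w) = w"
    using is_boettcher_inverse[OF assms] by blast
  have *: "norm (\<beta> z) > 1" if "z \<notin> filled_julia P" for z
    using is_boettcher_norm_gt[OF assms that] .
  have "- filled_julia P = \<psi> ` {w. norm w > 1}"
    using \<psi>(2,3) * by (auto simp: image_iff) metis
  moreover have "continuous_on {w. norm w > 1} \<psi>"
    using \<psi>(1) by (intro holomorphic_on_imp_continuous_on) (auto elim!: holomorphic_on_subset)
  ultimately show ?thesis using connected_continuous_image connected_exterior by metis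
qed

theorem connected_julia:
  assumes \<beta>: "is_boettcher P \<beta>"
  shows "connected (julia P)"
proof -
  let ?K = "filled_julia P"
  have \<beta>hol: "\<beta> holomorphic_on - ?K" and \<beta>d: "\<And>z. z \<notin> ?K \<Longrightarrow> \<beta> (poly P z) = \<beta> z ^ degree P"
    and \<beta>lim: "((\<lambda>z. \<beta> z / z) \<longlongrightarrow> 1) at_infinity" and inj: "inj_on \<beta> (- ?K)"
    using \<beta> by (auto simp: is_boettcher_def bij_betw_def)
  note \<beta>1 = is_boettcher_norm_gt[OF \<beta>]
  obtain \<psi> where \<psi>: "\<psi> holomorphic_on (- cball 0 1)" "\<And>z. z \<notin> ?K \<Longrightarrow> \<psi> (\<beta> z) = z"
    "\<And>w. norm w > 1 \<Longrightarrow> \<psi> w \<notin> ?K \<and> \<beta> (\<psi> w) = w"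
    using is_boettcher_inverse[OF \<beta>] by blast
  have oK: "open (- ?K)" using closed_filled_julia by auto
  define c where "c n = 1 + 1 / real (Suc n)" for n
  have c1: "c n > 1" for n by (simp add: c_def)
  define A where "A n = {z. z \<notin> ?K \<and> norm (\<beta> z) < c n}" for n
  have A_eq: "A n = \<psi> ` {w. 1 < norm w \<and> norm w < c n}" for n
    using \<psi>(2,3) \<beta>1 by (auto simp: A_def image_iff) metis
  have conA: "connected (A n)" for n
  proof -
    have "connected {w::complex. 1 < norm w \<and> norm w < c n}"
      using connected_annulus(1)[of 1 "0::complex" "c n"] by simp
    moreover have "continuous_on {w. 1 < norm w \<and> norm w < c n} \<psi>"
      using \<psi>(1) by (intro holomorphic_on_imp_continuous_on) (auto elim!: holomorphic_on_subset)
    ultimately show ?thesis unfolding A_eq by (simp add: connected_continuous_image)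
  qed
  have bA: "bounded (A n)" for n
  proof -
    obtain b where b: "\<And>z. norm z \<ge> b \<Longrightarrow> norm (\<beta> z) \<ge> norm z / 2"
      using asymptotic_to_identity_bound[OF \<beta>lim] by blast
    have "norm z \<le> max b (2 * c n)" if "z \<in> A n" for z
      using b[of z] that by (cases "norm z \<ge> b") (auto simp: A_def)
    then show ?thesis by (auto simp: bounded_iff)
  qed
  have "julia P = \<Inter> (range (\<lambda>n. closure (A n)))"
  proof (intro equalityI subsetI)
    fix z assume "z \<in> julia P"
    then have z: "z \<in> ?K" "z \<in> closure (- ?K)"
      using closed_filled_julia by (auto simp: julia_def frontier_def closure_complement)
    have "z \<in> closure (A n)" for n
    proof -
      obtain R where R: "R \<ge> 1" "\<And>z. norm z \<ge> R \<Longrightarrow> norm (poly P z) \<ge> 2 * norm z"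
        using escape_radius2 by auto
      have "\<beta> holomorphic_on {z. norm z > max R (Sup (norm ` ?K))}"
      proof (rule holomorphic_on_subset[OF \<beta>hol])
        have "norm z \<le> Sup (norm ` ?K)" if "z \<in> ?K" for z
          using that bounded_filled_julia
          by (intro cSup_upper) (auto simp: bounded_iff bdd_above_def)
        then show "{z. norm z > max R (Sup (norm ` ?K))} \<subseteq> - ?K" by force
      qed
      from holomorphic_inverse_near_infinity[OF this \<beta>lim] obtain \<rho> \<phi> where \<rho>:
        "\<And>w. norm w > \<rho> \<Longrightarrow> norm (\<phi> w) > max R (Sup (norm ` ?K)) \<and> \<beta> (\<phi> w) = w"
        by metis
      have notK: "y \<notin> ?K" if "norm y \<ge> R" for y
        by (rule notin_filled_julia[of R]) (use R that in auto)
      \<comment> \<open>A large |\<beta> y| forces a large |y|: \<open>\<phi>\<close> is a right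
        inverse of \<open>\<beta>\<close> with values beyond \<open>R\<close>, and injectivity of
        \<open>\<beta>\<close> identifies \<open>\<phi> (\<beta> y)\<close> with
        \<open>y\<close>.\<close>
      have far: "norm y \<ge> R" if y: "y \<notin> ?K" "norm (\<beta> y) > \<rho>" for y
      proof -
        have p: "norm (\<phi> (\<beta> y)) > R" "\<beta> (\<phi> (\<beta> y)) = \<beta> y" using \<rho>[OF y(2)] by auto
        moreover have "\<phi> (\<beta> y) \<notin> ?K" using notK p by simp
        ultimately have "\<phi> (\<beta> y) = y" using inj y(1) by (auto simp: inj_on_def)
        then show ?thesis using p by simp
      qed
      obtain m where m': "\<rho> < c n ^ (degree P ^ m)" using power_power_unbounded[OF c1 deg] by blast
      have \<beta>it: "\<beta> ((poly P ^^ k) y) = \<beta> y ^ (degree P ^ k)" if "y \<notin> ?K" for y k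
        using that by (induction k) (auto simp: \<beta>d filled_julia_funpow_iff power_mult[symmetric] mult.commute)
      \<comment> \<open>Points with |\<beta>| \<ge> \<open>c n\<close> reach modulus
        \<open>R\<close> after \<open>m\<close> iterations, with \<open>m\<close> independent of the
        point. They lie in this closed set of escaping points, so a boundary point of the filled
        Julia set can be approached from outside only through \<open>A n\<close>.\<close>
      define C where "C = {y. R \<le> norm ((poly P ^^ m) y)}"
      have "closed C" unfolding C_def
        using continuous_on_funpow_poly[of UNIV m P] by (intro closed_Collect_le continuous_intros)
      have CK: "C \<subseteq> - ?K" using notK filled_julia_funpow_iff by (auto simp: C_def)
      have "- ?K \<subseteq> A n \<union> C"
      proof
        fix y assume y: "y \<in> - ?K"
        show "y \<in> A n \<union> C"
        proof (cases "norm (\<beta> y) < c n")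
          case False
          then have "c n ^ (degree P ^ m) \<le> norm (\<beta> y) ^ (degree P ^ m)"
            using c1[of n] by (intro power_mono) auto
          with m' have "norm (\<beta> ((poly P ^^ m) y)) > \<rho>" using \<beta>it y by (simp add: norm_power)
          then show ?thesis using far y by (simp add: C_def filled_julia_funpow_iff)
        qed (use y in \<open>auto simp: A_def\<close>)
      qed
      then have "closure (- ?K) \<subseteq> closure (A n) \<union> C"
        using \<open>closed C\<close> by (metis closure_Un closure_closed closure_mono)
      then show ?thesis using z CK by blast
    qed
    then show "z \<in> \<Inter> (range (\<lambda>n. closure (A n)))" by blast
  next
    fix z assume "z \<in> \<Inter> (range (\<lambda>n. closure (A n)))"
    then have z: "z \<in> closure (A n)" for n by blast
    have "A 0 \<subseteq> - ?K" by (auto simp: A_def)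
    then have zc: "z \<in> closure (- ?K)" using z[of 0] closure_mono by blast
    have "z \<in> ?K"
    proof (rule ccontr)
      assume zK: "z \<notin> ?K"
      then have "norm (\<beta> z) - 1 > 0" using \<beta>1 by simp
      then obtain n where "inverse (real (Suc n)) < norm (\<beta> z) - 1" using reals_Archimedean by blast
      then have n: "c n < norm (\<beta> z)" by (simp add: c_def inverse_eq_divide)
      have "continuous_on (- ?K) (\<lambda>z. norm (\<beta> z))"
        using \<beta>hol holomorphic_on_imp_continuous_on by (intro continuous_intros) blast
      then have "open ((- ?K) \<inter> (\<lambda>z. norm (\<beta> z)) -` {c n<..})"
        by (rule continuous_open_preimage) (use oK in auto)
      moreover have "z \<in> (- ?K) \<inter> (\<lambda>z. norm (\<beta> z)) -` {c n<..}" using n zK by auto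
      moreover have "((- ?K) \<inter> (\<lambda>z. norm (\<beta> z)) -` {c n<..}) \<inter> A n = {}" by (auto simp: A_def)
      ultimately show False using z[of n] by (meson disjoint_iff open_Int_closure_eq_empty)
    qed
    then show "z \<in> julia P"
      using zc closed_filled_julia by (auto simp: julia_def frontier_def closure_complement)
  qed
  moreover have "connected (\<Inter> (range (\<lambda>n. closure (A n))))"
  proof (rule connected_nest)
    show "compact (closure (A n))" for n using bA by simp
    show "connected (closure (A n))" for n using conA connected_imp_connected_closure by blast
    show "closure (A n) \<subseteq> closure (A m)" if "m \<le> n" for m n
    proof (rule closure_mono)
      have "1 / real (Suc n) \<le> 1 / real (Suc m)" using that by (intro divide_left_mono) auto
      then have "c n \<le> c m" by (simp add: c_def)
      then show "A n \<subseteq> A m" by (auto simp: A_def)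
    qed
  qed
  ultimately show ?thesis by simp
qed

end

subsection \<open>The ray of angle zero of a real polynomial\<close>

lemma fixed_point_limit:
  fixes p :: "real \<Rightarrow> real"
  assumes "continuous_on UNIV p" "u \<longlonglongrightarrow> l" "(\<lambda>n. p (u n)) \<longlonglongrightarrow> l"
  shows "p l = l"
proof -
  have "(\<lambda>n. p (u n)) \<longlonglongrightarrow> p l"
    using assms by (intro isCont_tendsto_compose[of l p]) (auto simp: continuous_on_eq_continuous_at)
  then show ?thesis using assms(3) by (rule LIMSEQ_unique)
qed

context monic_poly begin

text \<open>Near infinity the ratio \<open>q\<close> of two Boettcher coordinates satisfies \<open>q \<circ> P = q ^ d\<close> and stays
  close to \<open>1\<close>; so \<open>d ^ n * Ln q\<close> stays bounded, which forces \<open>Ln q = 0\<close>.\<close>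

lemma boettcher_unique:
  assumes \<beta>1: "is_boettcher P \<beta>1" and \<beta>2: "is_boettcher P \<beta>2" and z: "z \<notin> filled_julia P"
  shows "\<beta>1 z = \<beta>2 z"
proof -
  let ?K = "filled_julia P"
  define d where "d = degree P"
  have d: "d \<ge> 2" using deg by (simp add: d_def)
  define q where "q z = \<beta>1 z / \<beta>2 z" for z
  have nz: "\<beta>1 z \<noteq> 0" "\<beta>2 z \<noteq> 0" if "z \<notin> ?K" for z
    using is_boettcher_norm_gt[OF \<beta>1 that] is_boettcher_norm_gt[OF \<beta>2 that] by auto
  have lim: "((\<lambda>z. \<beta>1 z / z) \<longlongrightarrow> 1) at_infinity" "((\<lambda>z. \<beta>2 z / z) \<longlongrightarrow> 1) at_infinity"
    using \<beta>1 \<beta>2 by (auto simp: is_boettcher_def)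
  have "((\<lambda>z. (\<beta>1 z / z) / (\<beta>2 z / z)) \<longlongrightarrow> 1 / 1) at_infinity"
    by (intro tendsto_divide lim) simp
  then have "((\<lambda>z. (\<beta>1 z / z) / (\<beta>2 z / z)) \<longlongrightarrow> 1) at_infinity" by simp
  moreover have "(\<beta>1 z / z) / (\<beta>2 z / z) = q z" if "norm z \<ge> 1" for z
  proof -
    have "z \<noteq> 0" using that by auto
    then show ?thesis by (simp add: q_def)
  qed
  then have "\<forall>\<^sub>F z in at_infinity. (\<beta>1 z / z) / (\<beta>2 z / z) = q z"
    unfolding eventually_at_infinity by blast
  ultimately have qlim: "(q \<longlongrightarrow> 1) at_infinity" by (rule Lim_transform_eventually)
  then have "((\<lambda>z. Ln (q z)) \<longlongrightarrow> Ln 1) at_infinity"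
    by (intro tendsto_Ln) auto
  then have "((\<lambda>z. Ln (q z)) \<longlongrightarrow> 0) at_infinity" by simp
  then have "\<forall>\<^sub>F z in at_infinity. dist (Ln (q z)) 0 < 1 / d" by (rule tendstoD) (use d in simp)
  then obtain b where b: "\<And>z. norm z \<ge> b \<Longrightarrow> norm (Ln (q z)) < 1 / d"
    unfolding eventually_at_infinity dist_norm by auto
  obtain R where R: "R \<ge> 1" "\<And>z. norm z \<ge> R \<Longrightarrow> norm (poly P z) \<ge> 2 * norm z"
    using escape_radius2 by auto
  define B where "B = max b R"
  have notK: "z \<notin> ?K" if "norm z \<ge> B" for z
    by (rule notin_filled_julia[of R]) (use R that in \<open>auto simp: B_def\<close>)
  have near: "\<beta>1 z = \<beta>2 z" if zB: "norm z \<ge> B" for z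
  proof -
    have grow: "norm ((poly P ^^ n) z) \<ge> B" for n
    proof -
      have "1 * norm z \<le> 2 ^ n * norm z" by (intro mult_right_mono) auto
      also have "\<dots> \<le> norm ((poly P ^^ n) z)" by (rule iterates_escape[of R]) (use R(2) zB in \<open>auto simp: B_def\<close>)
      finally show ?thesis using zB by simp
    qed
    \<comment> \<open>The bound |Ln (q y)| < 1/d keeps d * Ln (q y) in the strip |Im| < pi, so the
      principal logarithm turns the d-th power into an exact factor d.\<close>
    have Lnq: "Ln (q (poly P y)) = of_nat d * Ln (q y)" if y: "norm y \<ge> B" for y
    proof -
      have yK: "y \<notin> ?K" using notK y .
      have "q (poly P y) = q y ^ d"
        using \<beta>1 \<beta>2 yK by (simp add: q_def is_boettcher_def d_def power_divide)
      also have "\<dots> = exp (of_nat d * Ln (q y))"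
        using nz[OF yK] by (simp add: exp_of_nat_mult q_def)
      finally have e: "q (poly P y) = exp (of_nat d * Ln (q y))" .
      have "\<bar>Im (of_nat d * Ln (q y))\<bar> \<le> norm (of_nat d * Ln (q y))" by (rule abs_Im_le_cmod)
      also have "\<dots> = d * norm (Ln (q y))" by (simp add: norm_mult)
      also have "\<dots> < 1" using b[of y] y d by (simp add: B_def field_simps)
      finally have "\<bar>Im (of_nat d * Ln (q y))\<bar> < pi" using pi_gt3 by linarith
      then show ?thesis unfolding e by (intro Ln_exp) auto
    qed
    have "Ln (q ((poly P ^^ n) z)) = of_nat d ^ n * Ln (q z)" for n
      by (induction n) (auto simp: Lnq[OF grow])
    then have "norm (of_nat d ^ n * Ln (q z)) < 1 / d" for n
      using b[of "(poly P ^^ n) z"] grow[of n] by (simp add: B_def)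
    then have bound: "real d ^ n * norm (Ln (q z)) < 1 / d" for n by (simp add: norm_mult norm_power)
    have "Ln (q z) = 0"
    proof (rule ccontr)
      assume "Ln (q z) \<noteq> 0"
      then have pos: "norm (Ln (q z)) > 0" by simp
      obtain n where "(1 / d) / norm (Ln (q z)) < real d ^ n"
        using real_arch_pow[of "real d"] d by fastforce
      then have "1 / d < real d ^ n * norm (Ln (q z))" using pos by (simp only: pos_divide_less_eq)
      then show False using bound[of n] by simp
    qed
    moreover have "q z \<noteq> 0" using nz[OF notK[OF zB]] by (simp add: q_def)
    ultimately have "q z = 1" using exp_Ln[of "q z"] by simp
    then show ?thesis using nz[OF notK[OF zB]] by (simp add: q_def)
  qed
  show ?thesis
  proof (rule analytic_continuation_open[of "{z. norm z > B}" "- ?K" \<beta>1 \<beta>2])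
    show "open {z::complex. norm z > B}" by (intro open_Collect_less continuous_intros)
    show "open (- ?K)" using closed_filled_julia by auto
    have "of_real (\<bar>B\<bar> + 1) \<in> {z::complex. norm z > B}" by auto
    then show "{z::complex. norm z > B} \<noteq> {}" by blast
    show "connected (- ?K)" using connected_escaping_set[OF \<beta>1] .
    show "{z. norm z > B} \<subseteq> - ?K" using notK by auto
    show "\<beta>1 holomorphic_on - ?K" "\<beta>2 holomorphic_on - ?K" using \<beta>1 \<beta>2 by (auto simp: is_boettcher_def)
    show "\<beta>1 z = \<beta>2 z" if "z \<in> {z. norm z > B}" for z using near that by simp
    show "z \<in> - ?K" using z by simp
  qed
qed

lemma filled_julia_cnj:
  assumes real: "\<And>i. coeff P i \<in> \<real>"
  shows "cnj z \<in> filled_julia P \<longleftrightarrow> z \<in> filled_julia P"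
proof -
  have "(poly P ^^ n) (cnj z) = cnj ((poly P ^^ n) z)" for n z
    by (induction n) (auto simp: poly_cnj_real[OF real])
  then show ?thesis by (simp add: filled_julia_def bounded_iff)
qed

text \<open>Conjugating \<open>\<beta>\<close> on both sides gives another Boettcher coordinate of
  the real polynomial \<open>P\<close>, so uniqueness applies.\<close>

lemma boettcher_cnj:
  assumes real: "\<And>i. coeff P i \<in> \<real>" and \<beta>: "is_boettcher P \<beta>" and z: "z \<notin> filled_julia P"
  shows "\<beta> (cnj z) = cnj (\<beta> z)"
proof -
  let ?K = "filled_julia P"
  have cnjK: "cnj ` (- ?K) = - ?K"
  proof (intro equalityI subsetI)
    fix x assume "x \<in> - ?K" then show "x \<in> cnj ` (- ?K)"
      using filled_julia_cnj[OF real, of x] by (intro image_eqI[of _ _ "cnj x"]) auto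
  qed (use filled_julia_cnj[OF real] in auto)
  have \<beta>lim: "((\<lambda>z. \<beta> z / z) \<longlongrightarrow> 1) at_infinity" using \<beta> by (simp add: is_boettcher_def)
  have bij: "bij_betw \<beta> (- ?K) (- cball 0 1)" using \<beta> by (auto simp: is_boettcher_def)
  have "is_boettcher P (cnj \<circ> \<beta> \<circ> cnj)"
    unfolding is_boettcher_def
  proof (intro conjI ballI)
    show "cnj \<circ> \<beta> \<circ> cnj holomorphic_on - ?K"
      by (rule holomorphic_on_compose_cnj_cnj) (use \<beta> cnjK closed_filled_julia in \<open>auto simp: is_boettcher_def\<close>)
    have c1: "bij_betw cnj (- ?K) (- ?K)" using cnjK by (auto simp: bij_betw_def inj_on_def)
    have "cnj ` (- cball 0 1) = - cball 0 1"
    proof (intro equalityI subsetI)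
      fix x :: complex assume "x \<in> - cball 0 1" then show "x \<in> cnj ` (- cball 0 1)"
        by (intro image_eqI[of _ _ "cnj x"]) auto
    qed auto
    then have c2: "bij_betw cnj (- cball 0 1) (- cball 0 1)" by (auto simp: bij_betw_def inj_on_def)
    show "bij_betw (cnj \<circ> \<beta> \<circ> cnj) (- ?K) (- cball 0 1)"
      using bij_betw_trans[OF bij_betw_trans[OF c1 bij] c2] by (simp add: o_assoc)
    show "(cnj \<circ> \<beta> \<circ> cnj) (poly P z) = (cnj \<circ> \<beta> \<circ> cnj) z ^ degree P" if "z \<in> - ?K" for z
      using \<beta> that filled_julia_cnj[OF real] by (auto simp: is_boettcher_def poly_cnj_real[OF real])
    have "filterlim cnj at_infinity at_infinity"
      by (subst filterlim_at_infinity_conv_norm_at_top) (simp add: filterlim_norm_at_top)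
    then have "((\<lambda>z. \<beta> (cnj z) / cnj z) \<longlongrightarrow> 1) at_infinity"
      using filterlim_compose[OF \<beta>lim] by blast
    from tendsto_cnj[OF this] show "((\<lambda>z. (cnj \<circ> \<beta> \<circ> cnj) z / z) \<longlongrightarrow> 1) at_infinity" by simp
  qed
  from arg_cong[OF boettcher_unique[OF this \<beta> z], of cnj] show ?thesis by simp
qed

text \<open>A bounded orbit would increase to a real fixed point beyond \<open>c\<close>, and there
  is none.\<close>

lemma of_real_escapes:
  assumes real: "\<And>i. coeff P i \<in> \<real>"
    and gt: "\<And>x. x > c \<Longrightarrow> Re (poly P (of_real x)) > x" and x: "x > c"
  shows "of_real x \<notin> filled_julia P"
proof
  assume xK: "of_real x \<in> filled_julia P"
  define p where "p x = Re (poly P (of_real x))" for x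
  have P_of_real: "poly P (of_real x) = of_real (p x)" for x
    unfolding p_def by (metis Reals_cnj_iff complex_cnj_complex_of_real of_real_Re poly_cnj_real[OF real])
  have p_gt: "p x > x" if "x > c" for x using gt that by (simp add: p_def)
  have contp: "continuous_on S p" for S unfolding p_def by (intro continuous_intros)
  have it: "(poly P ^^ n) (of_real x) = of_real ((p ^^ n) x)" for n
    by (induction n) (auto simp: P_of_real)
  have gc: "(p ^^ n) x > c" for n
  proof (induction n)
    case (Suc n) then show ?case using p_gt[of "(p ^^ n) x"] by simp
  qed (use x in simp)
  have inc: "incseq (\<lambda>n. (p ^^ n) x)" by (intro incseq_SucI) (use p_gt gc in \<open>auto intro: less_imp_le\<close>)
  obtain M where M: "\<And>n. norm ((poly P ^^ n) (of_real x)) \<le> M"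
    using xK by (auto simp: filled_julia_def bounded_iff)
  have "(p ^^ n) x \<le> M" for n using M[of n] by (simp add: it)
  then obtain L where L: "(\<lambda>n. (p ^^ n) x) \<longlonglongrightarrow> L" "\<forall>n. (p ^^ n) x \<le> L"
    using incseq_convergent[OF inc] by metis
  have "p L = L"
    using fixed_point_limit[of p, OF contp L(1)] LIMSEQ_Suc[OF L(1)] by simp
  moreover have "L > c" using L(2)[rule_format, of 0] x by simp
  ultimately show False using p_gt[of L] by simp
qed

text \<open>By symmetry \<open>\<beta>\<close> is real on (c, \<infinity>). Its restriction
  \<open>b\<close> satisfies b(p x) = b(x)^d and is shown to be an increasing bijection onto (1,
  \<infinity>): surjectivity gives the ray of angle 0, monotonicity its landing at
  \<open>c\<close>.\<close>

theorem closed_ray_zero_real: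
  assumes real: "\<And>i. coeff P i \<in> \<real>" and ex: "\<exists>\<beta>. is_boettcher P \<beta>"
    and fp: "poly P (of_real c) = of_real c"
    and gt: "\<And>x. x > c \<Longrightarrow> Re (poly P (of_real x)) > x"
  shows "closed_ray P 0 = real_halfline c"
proof -
  let ?K = "filled_julia P"
  define \<beta> where "\<beta> = boettcher P"
  have \<beta>: "is_boettcher P \<beta>" unfolding \<beta>_def boettcher_def using ex by (rule someI_ex)
  define d where "d = degree P"
  have d: "d \<ge> 2" using deg by (simp add: d_def)
  have \<beta>lim: "((\<lambda>z. \<beta> z / z) \<longlongrightarrow> 1) at_infinity" using \<beta> by (simp add: is_boettcher_def)
  define p where "p x = Re (poly P (of_real x))" for x
  have realI: "z = of_real (Re z)" if "cnj z = z" for z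
    using that by (metis Reals_cnj_iff of_real_Re)
  have P_of_real: "poly P (of_real x) = of_real (p x)" for x
    unfolding p_def by (rule realI) (simp add: poly_cnj_real[OF real])
  have p_c: "p c = c" using fp by (simp add: p_def)
  have p_gt: "p x > x" if "x > c" for x using gt that by (simp add: p_def)
  have contp: "continuous_on S p" for S unfolding p_def by (intro continuous_intros)
  have esc: "of_real x \<notin> ?K" if "x > c" for x
    by (rule of_real_escapes[where c = c]) (use real gt that in auto)
  define b where "b x = Re (\<beta> (of_real x))" for x
  have \<beta>_of_real: "\<beta> (of_real x) = of_real (b x)" if "x > c" for x
    unfolding b_def by (rule realI) (use boettcher_cnj[OF real \<beta> esc[OF that]] in simp)
  have b_abs: "\<bar>b x\<bar> > 1" if "x > c" for x
    using is_boettcher_norm_gt[OF \<beta> esc[OF that]] \<beta>_of_real[OF that] by simp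
  have contb: "continuous_on {c<..} b"
  proof -
    have "continuous_on (- ?K) \<beta>" using \<beta> by (auto simp: is_boettcher_def holomorphic_on_imp_continuous_on)
    then have "continuous_on {c<..} (\<lambda>x. \<beta> (of_real x))"
      by (rule continuous_on_compose2) (use esc in \<open>auto intro!: continuous_intros\<close>)
    then show ?thesis unfolding b_def by (intro continuous_intros)
  qed
  have "filterlim (\<lambda>x::real. complex_of_real x) at_infinity at_top" by (rule filterlim_of_real_at_infinity)
  then have "((\<lambda>x. \<beta> (of_real x) / of_real x) \<longlongrightarrow> 1) at_top"
    using filterlim_compose[OF \<beta>lim] by blast
  then have "((\<lambda>x. Re (\<beta> (of_real x) / of_real x)) \<longlongrightarrow> Re 1) at_top" by (rule tendsto_Re)
  then have "((\<lambda>x. b x / x) \<longlongrightarrow> 1) at_top" by (simp add: b_def)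
  then have "\<forall>\<^sub>F x in at_top. b x / x > 1/2" by (rule order_tendstoD) simp
  then obtain x0 where x0: "\<And>x. x \<ge> x0 \<Longrightarrow> b x / x > 1/2" by (auto simp: eventually_at_top_linorder)
  have b_large: "\<exists>x>a. b x > B" for a B
  proof -
    define x where "x = max (max x0 1) (max (a + 1) (2 * \<bar>B\<bar> + 1))"
    have "b x / x > 1/2" "x \<ge> 1" "x \<ge> a + 1" "x \<ge> 2 * \<bar>B\<bar> + 1" using x0[of x] by (auto simp: x_def)
    then have "b x > x / 2" by (simp add: field_simps)
    then show ?thesis using \<open>x \<ge> a + 1\<close> \<open>x \<ge> 2 * \<bar>B\<bar> + 1\<close> by (intro exI[of _ x]) auto
  qed
  \<comment> \<open>\<open>b\<close> omits [-1, 1] and is positive far out, so by the intermediate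
    value theorem it never becomes negative.\<close>
  have b_gt1: "b x > 1" if x: "x > c" for x
  proof (rule ccontr)
    assume "\<not> b x > 1"
    then have "b x < 0" using b_abs[OF x] by linarith
    obtain y where y: "y > x" "b y > 0" using b_large[of x 0] by blast
    have "continuous_on {x..y} b" by (rule continuous_on_subset[OF contb]) (use x in auto)
    then obtain t where "t \<ge> x" "b t = 0" using IVT'[of b x 0 y] \<open>b x < 0\<close> y by auto
    then show False using b_abs[of t] x by auto
  qed
  have b_p: "b (p x) = b x ^ d" if "x > c" for x
  proof -
    have "p x > c" using p_gt[OF that] that by simp
    have "\<beta> (poly P (of_real x)) = \<beta> (of_real x) ^ d" using \<beta> esc[OF that] by (simp add: is_boettcher_def d_def)
    then have "complex_of_real (b (p x)) = of_real (b x ^ d)"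
      using \<beta>_of_real[OF that] \<beta>_of_real[OF \<open>p x > c\<close>] by (simp add: P_of_real)
    then show ?thesis by (simp only: of_real_eq_iff)
  qed
  have b_inj: "x = y" if "x > c" "y > c" "b x = b y" for x y
  proof -
    have "inj_on \<beta> (- ?K)" using \<beta> by (auto simp: is_boettcher_def bij_betw_def)
    then have "complex_of_real x = of_real y"
      by (rule inj_onD) (use that esc \<beta>_of_real in auto)
    then show ?thesis by simp
  qed
  \<comment> \<open>Successive preimages of c + 1 inside (c, \<infinity>) extract a
    \<open>d\<close>-th root of \<open>b\<close> at each step, so the values of \<open>b\<close>
    tend to 1.\<close>
  have b_small: "\<exists>x>c. b x < t" if t: "t > 1" for t
  proof -
    have "\<exists>y>c. b y ^ d ^ n = b (c + 1)" for n
    proof (induction n)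
      case (Suc n)
      then obtain y where y: "y > c" "b y ^ d ^ n = b (c + 1)" by blast
      have "\<exists>u\<ge>c. u \<le> y \<and> p u = y"
        by (rule IVT'[OF _ _ _ contp]) (use p_c p_gt[OF y(1)] y(1) in simp_all)
      then obtain u where u: "c \<le> u" "u \<le> y" "p u = y" by blast
      with p_c y(1) have "u > c" by (cases "u = c") simp_all
      then have "b u ^ d ^ Suc n = b y ^ d ^ n" using b_p[OF \<open>u > c\<close>] u by (simp add: power_mult)
      then show ?case using \<open>u > c\<close> y by auto
    qed (auto intro!: exI[of _ "c + 1"])
    then obtain Y where Y: "\<And>n. Y n > c" "\<And>n. b (Y n) ^ d ^ n = b (c + 1)" by metis
    obtain m where "b (c + 1) < t ^ d ^ m" using power_power_unbounded[OF t d] by blast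
    with Y(2)[of m] have "b (Y m) ^ d ^ m < t ^ d ^ m" by linarith
    then have "b (Y m) < t" by (rule power_less_imp_less_base) (use t in simp)
    then show ?thesis using Y(1) by blast
  qed
  have b_surj: "\<exists>x>c. b x = t" if t: "t > 1" for t
  proof -
    obtain x where x: "x > c" "b x < t" using b_small[OF t] by blast
    obtain y where y: "y > x" "b y > t" using b_large by blast
    have "continuous_on {x..y} b" by (rule continuous_on_subset[OF contb]) (use x in auto)
    then obtain u where "u \<ge> x" "b u = t" using IVT'[of b x t y] x y by auto
    then show ?thesis using x by (intro exI[of _ u]) auto
  qed
  \<comment> \<open>A continuous injection of an interval is monotone; the large values of
    \<open>b\<close> to the right of \<open>y\<close> exclude a decreasing one.\<close>
  have b_mono: "b x < b y" if xy: "c < x" "x < y" for x y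
  proof -
    obtain z where z: "z > y" "b z > b x" using b_large by blast
    have "continuous_on {x..z} b" by (rule continuous_on_subset[OF contb]) (use xy in auto)
    moreover have "inj_on b {x..z}" using b_inj xy by (auto simp: inj_on_def)
    ultimately show ?thesis using continuous_inj_imp_mono[of x y z b] xy z by auto
  qed
  have ray: "ray_point P 0 (ln (b x)) = of_real x" if x: "x > c" for x
  proof -
    have "exp (of_real (ln (b x)) + 2 * of_real pi * \<i> * of_real 0) = complex_of_real (exp (ln (b x)))"
      by (simp flip: exp_of_real)
    also have "\<dots> = \<beta> (of_real x)" using b_gt1[OF x] \<beta>_of_real[OF x] by simp
    finally have "ray_point P 0 (ln (b x)) = inv_into (- ?K) \<beta> (\<beta> (of_real x))"
      by (simp only: ray_point_def \<beta>_def)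
    also have "\<dots> = of_real x"
      using \<beta> esc[OF x] by (intro inv_into_f_f) (auto simp: is_boettcher_def bij_betw_def)
    finally show ?thesis .
  qed
  have param: "\<exists>x>c. s = ln (b x)" if s: "s > 0" for s
  proof -
    obtain x where "x > c" "b x = exp s" using b_surj[of "exp s"] s by auto
    then show ?thesis by (intro exI[of _ x]) auto
  qed
  have ext: "external_ray P 0 = of_real ` {c<..}"
  proof (intro equalityI subsetI)
    fix z assume "z \<in> external_ray P 0"
    then obtain s where "s > 0" "z = ray_point P 0 s" by (auto simp: external_ray_def)
    then show "z \<in> of_real ` {c<..}" using param[of s] ray by auto
  next
    fix z :: complex assume "z \<in> of_real ` {c<..}"
    then obtain x where "x > c" "z = of_real x" by auto
    moreover from this have "ln (b x) > 0" using b_gt1 by (intro ln_gt_zero)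
    ultimately show "z \<in> external_ray P 0" unfolding external_ray_def
      using ray by (intro image_eqI[of _ _ "ln (b x)"]) auto
  qed
  have "(ray_point P 0 \<longlongrightarrow> of_real c) (at_right 0)"
  proof (rule tendstoI)
    fix e :: real assume e: "e > 0"
    have b1: "b (c + e) > 1" using b_gt1 e by simp
    have "dist (ray_point P 0 s) (of_real c) < e" if s: "0 < s" "s < ln (b (c + e))" for s
    proof -
      obtain x where x: "x > c" "s = ln (b x)" using param s by blast
      then have "b x < b (c + e)" using s b1 b_gt1[of x] by simp
      then have "x < c + e" using b_mono[of "c + e" x] x e by (cases "x = c + e") (auto simp: not_less[symmetric] intro: ccontr)
      have "dist (ray_point P 0 s) (of_real c) = norm (complex_of_real (x - c))"
        using ray[OF x(1)] x(2) by (simp add: dist_norm)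
      also have "\<dots> = x - c" using x(1) by (simp only: norm_of_real)
      finally show ?thesis using \<open>x < c + e\<close> by simp
    qed
    then show "\<forall>\<^sub>F s in at_right 0. dist (ray_point P 0 s) (of_real c) < e"
      unfolding eventually_at_right_field using b1 by (intro exI[of _ "ln (b (c + e))"]) auto
  qed
  then have "landing_point P 0 = of_real c"
    unfolding landing_point_def by (intro tendsto_Lim) auto
  then have "closed_ray P 0 = Some ` of_real ` {c<..} \<union> {Some (of_real c), None}"
    by (simp add: closed_ray_def ext)
  moreover have "{c..} = insert c {c<..}" by auto
  ultimately show ?thesis
    by (auto simp: real_halfline_def image_image)
qed

end

lemma tendsto_poly:
  fixes p :: "'a::real_normed_field poly"
  assumes "(f \<longlongrightarrow> a) F" shows "((\<lambda>x. poly p (f x)) \<longlongrightarrow> poly p a) F"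
  using isCont_tendsto_compose[OF DERIV_isCont[OF poly_DERIV] assms] .

subsection \<open>Polynomials with many attracting fixed points\<close>

context monic_poly begin

text \<open>An orbit has only one limit, so distinct attracting points own distinct critical points.
  As P' has at most degree - 1 zeros, no critical point is left over.\<close>

lemma attracting_fixed_points_imp_critically_bounded:
  assumes card: "card T + 1 \<ge> degree P"
    and T: "\<And>p. p \<in> T \<Longrightarrow> poly P p = p \<and> norm (poly (pderiv P) p) < 1"
  shows "critically_bounded P"
proof
  have "\<exists>c. poly (pderiv P) c = 0 \<and> (\<lambda>n. (poly P ^^ n) c) \<longlonglongrightarrow> p" if "p \<in> T" for p
    using attracting_basin_contains_critical_point[of p] T[OF that] by blast
  then obtain c where c: "\<And>p. p \<in> T \<Longrightarrow> poly (pderiv P) (c p) = 0"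
      "\<And>p. p \<in> T \<Longrightarrow> (\<lambda>n. (poly P ^^ n) (c p)) \<longlonglongrightarrow> p"
    by metis
  have inj: "inj_on c T" using c(2) by (metis LIMSEQ_unique inj_onI)
  \<comment> \<open>An infinite \<open>T\<close> would have \<open>card T = 0\<close>, which
    contradicts the bound because the degree is at least 2.\<close>
  have "finite T" by (rule ccontr) (use card deg in simp)
  define Z where "Z = {x. poly (pderiv P) x = 0}"
  have "pderiv P \<noteq> 0" using deg pderiv_eq_0_iff[of P] by auto
  then have "finite Z" "card Z \<le> degree P - 1"
    unfolding Z_def using poly_roots_finite card_poly_roots_bound[of "pderiv P"] by (auto simp: degree_pderiv)
  moreover have "c ` T \<subseteq> Z" using c(1) by (auto simp: Z_def)
  moreover have "card (c ` T) = card T" using inj by (rule card_image)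
  ultimately have "c ` T = Z" using card by (intro card_seteq) auto
  fix x assume "poly (pderiv P) x = 0"
  then obtain p where "p \<in> T" "x = c p" using \<open>c ` T = Z\<close> by (auto simp: Z_def)
  then show "x \<in> filled_julia P"
    using c(2)[of p] convergent_imp_bounded unfolding filled_julia_def by blast
qed

lemma monic_poly_add_const: "monic_poly (P + [:a:])"
proof
  have "degree (P + [:a:]) = degree P" using deg by (intro degree_add_eq_left) auto
  moreover have "coeff [:a:] (degree P) = 0" using deg by (intro coeff_eq_0) auto
  ultimately show "lead_coeff (P + [:a:]) = 1" "degree (P + [:a:]) \<ge> 2"
    using monic deg by (simp_all only: coeff_add add_0_right)
qed

text \<open>Adding a constant does not move the critical points, and all
  \<open>P + \<epsilon>\<close> with 0 < \<epsilon> \<le> 1 share the escape radius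
  \<open>R\<close>. So for each fixed n the bound \<open>R\<close> on the n-th iterate of
  \<open>c\<close> passes to the limit. This takes the place of an analysis of the parabolic basins
  of \<open>P\<close>.\<close>

lemma critically_bounded_limit:
  assumes ev: "\<forall>\<^sub>F \<epsilon> in at_right (0::real). critically_bounded (P + [:of_real \<epsilon>:])"
  shows "critically_bounded P"
proof
  obtain R where R: "R \<ge> 1" "\<And>z. norm z \<ge> R \<Longrightarrow> norm (poly P z) \<ge> 3 * norm z"
    using escape_radius by metis
  fix c assume c: "poly (pderiv P) c = 0"
  have small: "\<forall>\<^sub>F \<epsilon> in at_right (0::real). 0 < \<epsilon> \<and> \<epsilon> \<le> 1"
    by (auto simp: eventually_at_right_field intro!: exI[of _ 1])
  have bound: "\<forall>\<^sub>F \<epsilon> in at_right (0::real). norm ((poly (P + [:of_real \<epsilon>:]) ^^ n) c) \<le> R" for n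
    using ev small
  proof eventually_elim
    case (elim \<epsilon>)
    let ?P = "P + [:of_real \<epsilon>:]"
    have "norm (poly ?P z) \<ge> 2 * norm z" if z: "norm z \<ge> R" for z
    proof -
      have "norm (poly P z) \<le> norm (poly ?P z) + norm (complex_of_real \<epsilon>)"
        using norm_triangle_ineq4[of "poly ?P z" "complex_of_real \<epsilon>"] by simp
      moreover have "norm (complex_of_real \<epsilon>) \<le> 1" using elim by simp
      ultimately show ?thesis using R(2)[OF z] R(1) z by linarith
    qed
    then have K: "filled_julia ?P = {z. \<forall>n. norm ((poly ?P ^^ n) z) < R}"
      using R(1) by (intro filled_julia_eq) auto
    have "c \<in> filled_julia ?P"
      using critically_bounded.crit[of ?P c] elim c by (auto simp: pderiv_add pderiv_pCons)
    then show ?case unfolding K by (auto intro: less_imp_le)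
  qed
  have conv: "((\<lambda>\<epsilon>. (poly (P + [:of_real \<epsilon>:]) ^^ n) c) \<longlongrightarrow> (poly P ^^ n) c) (at_right 0)" for n
  proof (induction n)
    case (Suc n)
    have "((\<lambda>\<epsilon>. complex_of_real \<epsilon>) \<longlongrightarrow> of_real 0) (at_right 0)" by (intro tendsto_of_real tendsto_ident_at)
    then have "((\<lambda>\<epsilon>. poly P ((poly (P + [:of_real \<epsilon>:]) ^^ n) c) + complex_of_real \<epsilon>) \<longlongrightarrow>
        poly P ((poly P ^^ n) c) + of_real 0) (at_right 0)"
      by (intro tendsto_add tendsto_poly Suc)
    moreover have "(poly (P + [:of_real \<epsilon>:]) ^^ Suc n) c =
        poly P ((poly (P + [:of_real \<epsilon>:]) ^^ n) c) + complex_of_real \<epsilon>" for \<epsilon> by simp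
    ultimately show ?case by (simp only: funpow.simps o_apply of_real_0 add_0_right)
  qed simp
  have "norm ((poly P ^^ n) c) \<le> R" for n
    by (rule tendsto_le[OF _ tendsto_const tendsto_norm[OF conv] bound]) simp
  then show "c \<in> filled_julia P" unfolding filled_julia_def by (auto intro!: boundedI[of _ R])
qed

end

subsection \<open>Splitting of a double fixed point\<close>

text \<open>A fixed point is attracting iff \<open>Re (1 / (1 - \<lambda>)) > 1/2\<close> for its multiplier \<open>\<lambda>\<close>; with
  \<open>z \<mapsto> z + Q z + \<epsilon>\<close> this is the condition \<open>Re (- 1 / Q' z) > 1/2\<close>. On the roots of \<open>Q + \<epsilon>\<close> near the
  double root \<open>w\<close> of \<open>Q = (z - w)\<^sup>2 G\<close>, the quantity \<open>Re (- 1 / Q' z)\<close> tends to \<open>B / (2 A\<^sup>2)\<close>.\<close>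

lemma double_root_splits_attracting:
  fixes G :: "complex poly"
  assumes A: "poly G w = of_real A" "A > 0" and B: "poly (pderiv G) w = of_real B" "B > A\<^sup>2"
  defines "Q \<equiv> [:- w, 1:]\<^sup>2 * G"
  shows "\<forall>\<^sub>F z in at w. \<forall>\<epsilon>>0. poly Q z = - of_real \<epsilon> \<longrightarrow> norm (1 + poly (pderiv Q) z) < 1"
proof -
  define g where "g u = poly G (w + u)" for u
  define g' where "g' u = poly (pderiv G) (w + u)" for u
  \<comment> \<open>The displacements from \<open>w\<close> of solutions of Q = -\<epsilon> with
    \<epsilon> > 0. All limits are taken along \<open>S\<close>, since it is the sign of Q there
    that controls the real part of the pole of 1/Q'.\<close>
  define S where "S = {u. u \<noteq> 0 \<and> (\<exists>\<epsilon>>0. u\<^sup>2 * g u = - of_real \<epsilon>)}"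
  define F where "F = at (0::complex) within S"
  have combine: "of_real (- (1/2)) * (1 / (a * b)) + c / (2 * b * s) = (- s + a * c) / (2 * a * b * s)"
    if "a \<noteq> 0" "b \<noteq> 0" "s \<noteq> 0" for a b c s :: complex
    using that by (simp add: field_simps)
  have Re_scale: "Re (of_real r * z) = r * Re z" for r z by simp
  have Q: "poly Q (w + u) = u\<^sup>2 * g u" for u by (simp add: Q_def g_def)
  have Q': "poly (pderiv Q) (w + u) = 2 * u * g u + u\<^sup>2 * g' u" for u
    by (simp add: Q_def g_def g'_def pderiv_mult pderiv_power pderiv_pCons algebra_simps)
  have toz: "((\<lambda>u. w + u) \<longlongrightarrow> w) F"
    unfolding F_def by (rule tendsto_eq_intros | simp)+
  have gA: "(g \<longlongrightarrow> of_real A) F"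
    unfolding g_def A(1)[symmetric] by (intro tendsto_poly toz)
  have gB: "(g' \<longlongrightarrow> of_real B) F"
    unfolding g'_def B(1)[symmetric] by (intro tendsto_poly toz)
  have uto: "((\<lambda>u. u) \<longlongrightarrow> 0) F" unfolding F_def by (rule tendsto_ident_at)
  have Ane: "complex_of_real A \<noteq> 0" using A(2) by simp
  have inS: "\<forall>\<^sub>F u in F. u \<in> S" unfolding F_def by (auto simp: eventually_at_filter)
  have gne: "\<forall>\<^sub>F u in F. g u \<noteq> 0" using tendsto_imp_eventually_ne[OF gA Ane] .
  have dG: "((\<lambda>u. (g u - of_real A) / u) \<longlongrightarrow> of_real B) F"
  proof -
    have "((\<lambda>u. (poly G (w + u) - poly G w) / u) \<longlongrightarrow> poly (pderiv G) w) (at 0)"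
      using poly_DERIV[of G w] by (simp add: DERIV_def)
    then show ?thesis unfolding g_def A(1)[symmetric] B(1)[symmetric] F_def
      by (rule tendsto_within_subset) auto
  qed
  \<comment> \<open>This is Re (1/u). On \<open>S\<close> the number u^2 g(u) is negative, so Re
    (1/(u g(u))) = -\<xi>/|g(u)|, whereas Re (1/(A u)) = \<xi>/A. Their difference tends to -B/A^2,
    which gives \<xi> the limit B/(2A) although 1/u itself is unbounded.\<close>
  define \<xi> where "\<xi> u = Re u / (norm u)\<^sup>2" for u :: complex
  have "((\<lambda>u. - ((g u - of_real A) / u) * (1 / (of_real A * g u))) \<longlongrightarrow> - of_real B * (1 / (of_real A * of_real A))) F"
    by (intro tendsto_mult tendsto_minus dG tendsto_divide tendsto_const gA) (use Ane in auto)
  from tendsto_Re[OF this]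
  have l1: "((\<lambda>u. Re (- ((g u - of_real A) / u) * (1 / (of_real A * g u)))) \<longlongrightarrow> - (B / A\<^sup>2)) F"
    by (simp add: power2_eq_square flip: of_real_mult of_real_divide of_real_minus)
  have Sfact: "Re (1 / (u * g u)) = - \<xi> u / norm (g u) \<and>
      Re (- ((g u - of_real A) / u) * (1 / (of_real A * g u))) = - \<xi> u * (1 / norm (g u) + 1 / A)"
    if u: "u \<in> S" "g u \<noteq> 0" for u
  proof -
    obtain \<epsilon> where e: "\<epsilon> > 0" "u\<^sup>2 * g u = - of_real \<epsilon>" and u0: "u \<noteq> 0" using u by (auto simp: S_def)
    have "norm (u\<^sup>2 * g u) = \<epsilon>" using e by simp
    then have \<epsilon>: "\<epsilon> = (norm u)\<^sup>2 * norm (g u)" by (simp add: norm_mult norm_power)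
    have "1 / (u * g u) = u / (u\<^sup>2 * g u)" using u0 by (simp add: power2_eq_square)
    also have "\<dots> = of_real (- 1 / \<epsilon>) * u" using e by simp
    finally have "Re (1 / (u * g u)) = (- 1 / \<epsilon>) * Re u" by (simp only: Re_scale)
    then have 1: "Re (1 / (u * g u)) = - \<xi> u / norm (g u)" by (simp add: \<epsilon> \<xi>_def)
    have "Re (1 / (of_real A * u)) = \<xi> u / A"
    proof -
      have "1 / (of_real A * u) = of_real (1 / A) * inverse u" using Ane by (simp add: field_simps)
      then have "Re (1 / (of_real A * u)) = (1 / A) * Re (inverse u)" by simp
      then show ?thesis by (simp add: \<xi>_def cmod_power2)
    qed
    moreover have "- ((g u - of_real A) / u) * (1 / (of_real A * g u)) = 1 / (u * g u) - 1 / (of_real A * u)"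
      using u0 u(2) Ane by (simp add: field_simps)
    ultimately show ?thesis using 1 A(2) u(2) by (simp add: algebra_simps add_divide_distrib)
  qed
  have ev: "\<forall>\<^sub>F u in F. u \<in> S \<and> g u \<noteq> 0" using inS gne by (rule eventually_conj)
  have l2: "((\<lambda>u. - \<xi> u * (1 / norm (g u) + 1 / A)) \<longlongrightarrow> - (B / A\<^sup>2)) F"
    by (rule Lim_transform_eventually[OF l1]) (use ev Sfact in \<open>auto elim!: eventually_mono\<close>)
  have ng: "((\<lambda>u. norm (g u)) \<longlongrightarrow> A) F" using tendsto_norm[OF gA] A(2) by simp
  have l3: "((\<lambda>u. 1 / norm (g u) + 1 / A) \<longlongrightarrow> 1 / A + 1 / A) F"
    by (intro tendsto_intros ng) (use A(2) in auto)
  have "((\<lambda>u. (- \<xi> u * (1 / norm (g u) + 1 / A)) / (1 / norm (g u) + 1 / A) * (1 / norm (g u)))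
     \<longlongrightarrow> - (B / A\<^sup>2) / (1 / A + 1 / A) * (1 / A)) F"
    by (intro tendsto_mult tendsto_divide l2 l3 ng tendsto_const) (use A(2) in auto)
  then have "((\<lambda>u. Re (1 / (u * g u))) \<longlongrightarrow> - (B / A\<^sup>2) / (1 / A + 1 / A) * (1 / A)) F"
  proof (rule Lim_transform_eventually)
    show "\<forall>\<^sub>F u in F. (- \<xi> u * (1 / norm (g u) + 1 / A)) / (1 / norm (g u) + 1 / A) * (1 / norm (g u)) = Re (1 / (u * g u))"
      using ev
    proof eventually_elim
      case (elim u)
      have "1 / norm (g u) + 1 / A > 0" using elim A(2) by (intro add_pos_pos) auto
      then show ?case using Sfact[of u] elim by simp
    qed
  qed
  moreover have "- (B / A\<^sup>2) / (1 / A + 1 / A) * (1 / A) = - (B / (2 * A\<^sup>2))"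
    using A(2) by (simp add: field_simps power2_eq_square)
  ultimately have l4: "((\<lambda>u. Re (1 / (u * g u))) \<longlongrightarrow> - (B / (2 * A\<^sup>2))) F" by simp
  have l5: "((\<lambda>u. Re (g' u / (2 * g u * (2 * g u + u * g' u)))) \<longlongrightarrow>
     Re (of_real B / (2 * of_real A * (2 * of_real A + 0 * of_real B)))) F"
    by (intro tendsto_intros gA gB uto) (use Ane in auto)
  have "Re (of_real B / (2 * of_real A * (2 * of_real A + 0 * of_real B))) = B / (4 * A\<^sup>2)"
  proof -
    have "(of_real B / (2 * of_real A * (2 * of_real A + 0 * of_real B)) :: complex) = of_real (B / (4 * A\<^sup>2))"
      by (simp add: power2_eq_square)
    then show ?thesis by (simp only: Re_complex_of_real)
  qed
  with l4 l5 have "((\<lambda>u. - (1/2) * Re (1 / (u * g u)) + Re (g' u / (2 * g u * (2 * g u + u * g' u)))) \<longlongrightarrow>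
      - (1/2) * - (B / (2 * A\<^sup>2)) + B / (4 * A\<^sup>2)) F"
    by (intro tendsto_add tendsto_mult tendsto_const) auto
  moreover have "- (1/2) * - (B / (2 * A\<^sup>2)) + B / (4 * A\<^sup>2) > 1/2"
    using A(2) B(2) by (simp add: field_simps)
  ultimately have ev1: "\<forall>\<^sub>F u in F. - (1/2) * Re (1 / (u * g u)) + Re (g' u / (2 * g u * (2 * g u + u * g' u))) > 1/2"
    by (rule order_tendstoD(1))
  have "((\<lambda>u. 2 * g u + u * g' u) \<longlongrightarrow> 2 * of_real A + 0 * of_real B) F"
    by (intro tendsto_intros gA gB uto)
  then have ev2: "\<forall>\<^sub>F u in F. 2 * g u + u * g' u \<noteq> 0"
    by (rule tendsto_imp_eventually_ne) (use Ane in simp)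
  have "\<forall>\<^sub>F u in F. norm (1 + poly (pderiv Q) (w + u)) < 1"
    using ev ev1 ev2
  proof eventually_elim
    case (elim u)
    define q where "q = poly (pderiv Q) (w + u)"
    have u0: "u \<noteq> 0" using elim by (auto simp: S_def)
    have q: "q = u * (2 * g u + u * g' u)" unfolding q_def Q' by (simp add: power2_eq_square algebra_simps)
    then have "q \<noteq> 0" using elim u0 by simp
    \<comment> \<open>-1/Q' is split into -1/2 times the singular term controlled above and a
      remainder continuous at u = 0. Each part contributes B/(4A^2) to the limit of the real
      part.\<close>
    have "- 1 / q = of_real (- (1/2)) * (1 / (u * g u)) + g' u / (2 * g u * (2 * g u + u * g' u))"
    proof -
      let ?s = "2 * g u + u * g' u"
      have "of_real (- (1/2)) * (1 / (u * g u)) + g' u / (2 * g u * ?s) = (- ?s + u * g' u) / (2 * u * g u * ?s)"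
        by (rule combine) (use u0 elim in auto)
      also have "\<dots> = - (2 * g u) / (2 * u * g u * ?s)" by simp
      also have "\<dots> = - 1 / (u * ?s)" using elim by (simp add: divide_simps)
      finally show ?thesis by (simp add: q)
    qed
    then have "Re (- 1 / q) > 1/2" using elim by (simp only: plus_complex.sel Re_scale)
    moreover have "Re (- 1 / q) = - Re q / (norm q)\<^sup>2" by (simp add: Re_divide cmod_power2)
    ultimately have "1/2 < - Re q / (norm q)\<^sup>2" by simp
    moreover have "(norm q)\<^sup>2 > 0" using \<open>q \<noteq> 0\<close> by simp
    ultimately have "1/2 * (norm q)\<^sup>2 < - Re q" by (simp only: pos_less_divide_eq)
    then have "(norm q)\<^sup>2 + 2 * Re q < 0" by simp
    moreover have "(norm (1 + q))\<^sup>2 = 1 + ((norm q)\<^sup>2 + 2 * Re q)"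
      unfolding cmod_power2 by (simp add: power2_eq_square algebra_simps)
    ultimately have "(norm (1 + q))\<^sup>2 < 1\<^sup>2" by simp
    then show ?case unfolding q_def by (rule power_less_imp_less_base) simp
  qed
  then have "\<forall>\<^sub>F u in at 0. u \<in> S \<longrightarrow> norm (1 + poly (pderiv Q) (w + u)) < 1"
    unfolding F_def eventually_at_filter by eventually_elim auto
  then have "\<forall>\<^sub>F z in at w. z - w \<in> S \<longrightarrow> norm (1 + poly (pderiv Q) z) < 1"
    by (subst eventually_at_to_0) (simp add: add.commute)
  then show ?thesis
    by (rule eventually_mono[OF eventually_conj[OF _ eventually_neq_at_within[of w w]]])
       (use Q[of "z - w" for z] in \<open>auto simp: S_def\<close>)
qed

section \<open>The residu iteratif at a double fixed point\<close>

text \<open>The integrand is h(z)/(z - w)^2 with h = -(2 + Q')/G holomorphic at \<open>w\<close>, so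
  its residue is h'(w). With Q'(w) = 0 and Q''(w) = 2A this is 2B/A^2 - 2.\<close>

lemma resit_double_fixed_point:
  fixes G :: "complex poly"
  assumes A: "poly G w = of_real A" "A > 0" and B: "poly (pderiv G) w = of_real B"
  shows "resit (poly ([:0, 1:] + [:- w, 1:]\<^sup>2 * G)) w = of_real (1 - B / A\<^sup>2)"
proof -
  define Q where "Q = [:- w, 1:]\<^sup>2 * G"
  define h where "h z = - (2 + poly (pderiv Q) z) / poly G z" for z
  have Ane: "poly G w \<noteq> 0" using A by simp
  have dP: "deriv (poly ([:0, 1:] + Q)) z = 1 + poly (pderiv Q) z" for z
    by (subst DERIV_imp_deriv[OF poly_DERIV]) (simp add: pderiv_add pderiv_pCons)
  have "(\<lambda>z. (1 + deriv (poly ([:0, 1:] + Q)) z) / (z - poly ([:0, 1:] + Q) z)) = (\<lambda>z. h z / (z - w) ^ Suc 1)"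
  proof (rule ext)
    fix z
    have "z - poly ([:0, 1:] + Q) z = - (poly G z * (z - w) ^ Suc 1)"
      by (simp add: Q_def power2_eq_square algebra_simps)
    moreover have "a / - (b * c) = - a / b / c" for a b c :: complex by simp
    moreover have "1 + (1 + poly (pderiv Q) z) = 2 + poly (pderiv Q) z" by simp
    ultimately show "(1 + deriv (poly ([:0, 1:] + Q)) z) / (z - poly ([:0, 1:] + Q) z) = h z / (z - w) ^ Suc 1"
      unfolding dP h_def by (simp only:)
  qed
  then have "residue (\<lambda>z. (1 + deriv (poly ([:0, 1:] + Q)) z) / (z - poly ([:0, 1:] + Q) z)) w
      = residue (\<lambda>z. h z / (z - w) ^ Suc 1) w" by simp
  also have "\<dots> = (deriv ^^ 1) h w / fact 1"
  proof (rule residue_holomorphic_over_power)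
    show "open {z. poly G z \<noteq> 0}" by (intro open_Collect_neq continuous_intros)
    show "h holomorphic_on {z. poly G z \<noteq> 0}" unfolding h_def by (intro holomorphic_intros) auto
  qed (use Ane in auto)
  also have "\<dots> = deriv h w" by simp
  also have "deriv h w = of_real (2 * B / A\<^sup>2 - 2)"
  proof -
    have Q1: "poly (pderiv Q) w = 0" and Q2: "poly (pderiv (pderiv Q)) w = 2 * poly G w"
      by (simp_all add: Q_def pderiv_mult pderiv_power pderiv_pCons pderiv_add pderiv_smult pderiv_diff algebra_simps)
    have "(h has_field_derivative
        (- poly (pderiv (pderiv Q)) w * poly G w - - (2 + poly (pderiv Q) w) * poly (pderiv G) w) / (poly G w * poly G w)) (at w)"
      unfolding h_def by (rule DERIV_divide) (use Ane in \<open>auto intro!: derivative_eq_intros poly_DERIV\<close>)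
    then have "deriv h w = (- (2 * of_real A) * of_real A + 2 * of_real B) / (of_real A * of_real A)"
      by (subst DERIV_imp_deriv) (auto simp: Q1 Q2 A(1) B)
    also have "\<dots> = of_real ((- (2 * A) * A + 2 * B) / (A * A))" by simp
    also have "(- (2 * A) * A + 2 * B) / (A * A) = 2 * B / A\<^sup>2 - 2"
      using A(2) by (simp add: field_simps power2_eq_square)
    finally show ?thesis .
  qed
  finally show ?thesis unfolding resit_def Q_def[symmetric] by (simp only:) (simp add: field_simps)
qed

lemma card_roots_squarefree:
  fixes p :: "complex poly"
  assumes "p \<noteq> 0" "\<And>a. poly p a = 0 \<Longrightarrow> poly (pderiv p) a \<noteq> 0"
  shows "card {x. poly p x = 0} = degree p"
proof -
  have "rsquarefree p" using assms by (auto simp: rsquarefree_roots)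
  from complex_poly_decompose_rsquarefree[OF this]
  have "degree p = degree (smult (lead_coeff p) (\<Prod>z|poly p z = 0. [:- z, 1:]))" by simp
  also have "\<dots> = degree (\<Prod>z|poly p z = 0. [:- z, 1:])" using assms(1) by simp
  also have "\<dots> = (\<Sum>z|poly p z = 0. degree [:- z, 1:])" by (rule degree_prod_sum_eq) auto
  finally show ?thesis by simp
qed

lemma real_coeffs_mult:
  assumes "\<And>i. coeff p i \<in> \<real>" "\<And>i. coeff q i \<in> \<real>"
  shows "coeff (p * q) i \<in> (\<real> :: complex set)"
  unfolding coeff_mult using assms by (intro sum_in_Reals Reals_mult)

subsection \<open>The family of polynomials\<close>

text \<open>\<open>gap\<close> is B_j > A_j^2 divided by A_j, where A_j and B_j are the value and
  the derivative at w_j of the cofactor of (z - w_j)^2 in \<open>Q\<close>; its right-hand side is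
  the logarithmic derivative of that cofactor. The bound 1/2 on \<open>w 0\<close> keeps orbits on
  the real line from jumping over a fixed point.\<close>

locale parabolic_chain =
  fixes N :: nat and w :: "nat \<Rightarrow> real"
  assumes N: "N \<ge> 1" and wN: "w N = 0" and dec: "\<And>j. j < N \<Longrightarrow> w (Suc j) < w j"
    and w0: "w 0 \<le> 1/2"
    and gap: "\<And>j. j < N \<Longrightarrow>
      w j * (\<Prod>k\<in>{..<N}-{j}. (w j - w k)\<^sup>2) < 1 / w j + (\<Sum>k\<in>{..<N}-{j}. 2 / (w j - w k))"
begin

lemma w_strict: "i < j \<Longrightarrow> j \<le> N \<Longrightarrow> w j < w i"
proof (induction j)
  case (Suc j)
  then show ?case using dec[of j] by (cases "i = j") auto
qed simp

lemma w_pos: "j < N \<Longrightarrow> 0 < w j" using w_strict[of j N] wN by simp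

lemma w_nonneg: "j \<le> N \<Longrightarrow> 0 \<le> w j" using w_pos[of j] wN by (cases "j = N") auto

lemma w_le: "j \<le> N \<Longrightarrow> w j \<le> 1/2" using w_strict[of 0 j] w0 by (cases "j = 0") auto

lemma w_eq_iff: "i \<le> N \<Longrightarrow> j \<le> N \<Longrightarrow> w i = w j \<longleftrightarrow> i = j"
  using w_strict[of i j] w_strict[of j i] by (metis less_irrefl linorder_neqE_nat)

definition G :: "nat \<Rightarrow> complex poly" where
  "G j = [:0, 1:] * (\<Prod>k\<in>{..<N}-{j}. [:- of_real (w k), 1:]\<^sup>2)"

definition Q :: "complex poly" where
  "Q = [:0, 1:] * (\<Prod>k<N. [:- of_real (w k), 1:]\<^sup>2)"

definition P :: "complex poly" where "P = [:0, 1:] + Q"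

definition q :: "real \<Rightarrow> real" where "q x = x * (\<Prod>k<N. (x - w k)\<^sup>2)"

lemma Q_eq_G: "j < N \<Longrightarrow> Q = [:- of_real (w j), 1:]\<^sup>2 * G j"
  unfolding Q_def G_def by (subst prod.remove[of _ j]) (auto simp: algebra_simps)

lemma poly_Q: "poly Q z = z * (\<Prod>k<N. (z - of_real (w k))\<^sup>2)"
  by (simp add: Q_def poly_prod)

lemma poly_Q_of_real: "poly Q (of_real x) = of_real (q x)"
  by (simp add: poly_Q q_def)

lemma poly_P: "poly P z = z + poly Q z" by (simp add: P_def)

lemma poly_P_of_real: "poly P (of_real x) = of_real (x + q x)"
  by (simp add: poly_P poly_Q_of_real)

lemma pderiv_P: "poly (pderiv P) z = 1 + poly (pderiv Q) z"
  by (simp add: P_def pderiv_add pderiv_pCons)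

lemma degree_Q: "degree Q = 2 * N + 1"
proof -
  have "(\<Prod>k<N. [:- complex_of_real (w k), 1:]\<^sup>2) \<noteq> 0" by simp
  then have "degree Q = 1 + degree (\<Prod>k<N. [:- complex_of_real (w k), 1:]\<^sup>2)"
    unfolding Q_def by (subst degree_mult_eq) auto
  also have "degree (\<Prod>k<N. [:- complex_of_real (w k), 1:]\<^sup>2) = (\<Sum>k<N. degree ([:- complex_of_real (w k), 1:]\<^sup>2))"
    by (rule degree_prod_sum_eq) auto
  finally show ?thesis by (simp add: degree_linear_power)
qed

lemma lead_coeff_Q: "lead_coeff Q = 1"
  unfolding Q_def by (simp only: lead_coeff_mult lead_coeff_prod lead_coeff_power) simp

lemma degree_P: "degree P = 2 * N + 1"
  unfolding P_def using degree_Q N by (subst degree_add_eq_right) auto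

lemma lead_coeff_P: "lead_coeff P = 1"
  using lead_coeff_Q N unfolding degree_P degree_Q by (simp add: P_def coeff_pCons split: nat.split)

lemma real_coeffs_P: "coeff P i \<in> \<real>"
proof -
  have lin: "coeff [:of_real a :: complex, 1:] i \<in> \<real>" for a i by (auto simp: coeff_pCons split: nat.split)
  have "coeff (\<Prod>k\<in>S. [:- complex_of_real (w k), 1:]\<^sup>2) i \<in> \<real>" for S i
  proof (induction S arbitrary: i rule: infinite_finite_induct)
    case (insert k S)
    have "coeff ([:- complex_of_real (w k), 1:]\<^sup>2) i \<in> \<real>" for i
      unfolding power2_eq_square using lin[of "- w k"] by (intro real_coeffs_mult) auto
    then show ?case using insert by (simp add: real_coeffs_mult)
  qed auto
  then have "coeff Q i \<in> \<real>" unfolding Q_def using lin[of 0] by (intro real_coeffs_mult) auto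
  moreover have "coeff [:0, 1 :: complex:] i \<in> \<real>" using lin[of 0] by simp
  ultimately show ?thesis unfolding P_def coeff_add by (rule Reals_add[rotated])
qed

sublocale monic_poly P
  by unfold_locales (use lead_coeff_P degree_P N in auto)

definition A :: "nat \<Rightarrow> real" where "A j = w j * (\<Prod>k\<in>{..<N}-{j}. (w j - w k)\<^sup>2)"

definition B :: "nat \<Rightarrow> real" where "B j = A j * (1 / w j + (\<Sum>k\<in>{..<N}-{j}. 2 / (w j - w k)))"

lemma A_pos: "j < N \<Longrightarrow> A j > 0"
  unfolding A_def using w_pos w_eq_iff by (intro mult_pos_pos prod_pos) auto

lemma B_gt: "j < N \<Longrightarrow> B j > (A j)\<^sup>2"
  unfolding B_def power2_eq_square using A_pos gap[of j] by (intro mult_strict_left_mono) (auto simp: A_def)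

lemma poly_G: "poly (G j) (of_real (w j)) = of_real (A j)"
  by (simp add: G_def A_def poly_prod)

text \<open>The logarithmic derivative of a product is the sum of those of its factors: z
  contributes 1/z and each squared factor contributes 2/(z - w_k).\<close>

lemma poly_pderiv_G:
  assumes j: "j < N" shows "poly (pderiv (G j)) (of_real (w j)) = of_real (B j)"
proof -
  define M where "M k = [:- complex_of_real (w k), 1:]\<^sup>2" for k
  define x where "x = complex_of_real (w j)"
  have xne: "x \<noteq> 0" using w_pos[OF j] by (simp add: x_def)
  have "poly (pderiv ([:0, 1:] * (\<Prod>k\<in>S. M k))) x =
      poly ([:0, 1:] * (\<Prod>k\<in>S. M k)) x * (1 / x + (\<Sum>k\<in>S. 2 / (x - of_real (w k))))"
    if "finite S" "S \<subseteq> {..<N} - {j}" for S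
    using that
  proof (induction S rule: finite_induct)
    case empty
    then show ?case using xne by (simp add: pderiv_pCons)
  next
    case (insert k S)
    define R where "R = [:0, 1:] * (\<Prod>k\<in>S. M k)"
    have "k < N" "k \<noteq> j" using insert by auto
    then have kne: "x - of_real (w k) \<noteq> 0" using w_eq_iff[of j k] j by (auto simp: x_def)
    have M: "poly (M k) x = (x - of_real (w k))\<^sup>2" "poly (pderiv (M k)) x = 2 * (x - of_real (w k))"
      by (simp_all add: M_def pderiv_power pderiv_pCons)
    have e: "[:0, 1:] * (\<Prod>k\<in>insert k S. M k) = M k * R"
      using insert(1,2) by (simp add: R_def mult_ac)
    have IH: "poly (pderiv R) x = poly R x * (1 / x + (\<Sum>k\<in>S. 2 / (x - of_real (w k))))"
      unfolding R_def using insert by blast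
    have "poly (pderiv (M k * R)) x = (x - of_real (w k))\<^sup>2 * poly (pderiv R) x + poly R x * (2 * (x - of_real (w k)))"
      by (simp add: pderiv_mult M)
    also have "2 * (x - of_real (w k)) = (x - of_real (w k))\<^sup>2 * (2 / (x - of_real (w k)))"
      using kne by (simp add: power2_eq_square)
    also have "(x - of_real (w k))\<^sup>2 * poly (pderiv R) x + poly R x * ((x - of_real (w k))\<^sup>2 * (2 / (x - of_real (w k))))
       = poly (M k * R) x * (1 / x + (\<Sum>k\<in>insert k S. 2 / (x - of_real (w k))))"
      unfolding IH using insert(1,2) by (simp add: M algebra_simps)
    finally show ?case unfolding e .
  qed
  from this[of "{..<N} - {j}"]
  have "poly (pderiv (G j)) x = poly (G j) x * (1 / x + (\<Sum>k\<in>{..<N} - {j}. 2 / (x - of_real (w k))))"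
    by (simp add: G_def M_def)
  then show ?thesis unfolding x_def poly_G by (simp add: B_def)
qed

lemma parabolic_fixed_point:
  assumes j: "j < N"
  shows "poly P (of_real (w j)) = of_real (w j)" "poly (pderiv P) (of_real (w j)) = 1"
    "resit (poly P) (of_real (w j)) = of_real (1 - B j / (A j)\<^sup>2)" "1 - B j / (A j)\<^sup>2 < 0"
proof -
  show "poly P (of_real (w j)) = of_real (w j)" using j by (simp add: poly_P Q_eq_G)
  show "poly (pderiv P) (of_real (w j)) = 1"
    unfolding pderiv_P Q_eq_G[OF j] by (simp add: pderiv_mult pderiv_power pderiv_pCons)
  show "resit (poly P) (of_real (w j)) = of_real (1 - B j / (A j)\<^sup>2)"
    unfolding P_def Q_eq_G[OF j] by (rule resit_double_fixed_point[OF poly_G A_pos[OF j] poly_pderiv_G[OF j]])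
  show "1 - B j / (A j)\<^sup>2 < 0" using B_gt[OF j] A_pos[OF j] by (simp add: field_simps)
qed

lemma pderiv_Q_0: "poly (pderiv Q) 0 = of_real (\<Prod>k<N. (w k)\<^sup>2)"
  by (simp add: Q_def pderiv_mult pderiv_pCons poly_prod)

lemma prod_w_pos: "(\<Prod>k<N. (w k)\<^sup>2) > 0" using w_pos by (intro prod_pos) force

lemma repelling_0: "poly P 0 = 0" "norm (poly (pderiv P) 0) > 1"
proof -
  show "poly P 0 = 0" by (simp add: poly_P poly_Q)
  have "poly (pderiv P) 0 = of_real (1 + (\<Prod>k<N. (w k)\<^sup>2))" by (simp add: pderiv_P pderiv_Q_0)
  then have "norm (poly (pderiv P) 0) = \<bar>1 + (\<Prod>k<N. (w k)\<^sup>2)\<bar>" by (simp only: norm_of_real)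
  then show "norm (poly (pderiv P) 0) > 1" using prod_w_pos by simp
qed

text \<open>The fixed points of \<open>P + \<epsilon>\<close> are the 2N + 1 roots of Q +
  \<epsilon>. At most one of them lies in a small disc around 0, where \<open>Q\<close> is
  injective. The others are close to some \<open>w j\<close> and attracting by
  \<open>double_root_splits_attracting\<close>, which makes at least 2N = degree - 1 attracting
  points.\<close>

lemma eventually_critically_bounded:
  "\<forall>\<^sub>F \<epsilon> in at_right (0::real). critically_bounded (P + [:of_real \<epsilon>:])"
proof -
  have "\<forall>\<^sub>F \<delta> in at_right (0::real). \<forall>z. z \<noteq> of_real (w j) \<and> dist z (of_real (w j)) < \<delta> \<longrightarrow>
      (\<forall>\<epsilon>>0. poly Q z = - of_real \<epsilon> \<longrightarrow> norm (1 + poly (pderiv Q) z) < 1)" if j: "j < N" for j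
  proof -
    have "\<forall>\<^sub>F z in at (of_real (w j)). \<forall>\<epsilon>>0. poly Q z = - of_real \<epsilon> \<longrightarrow> norm (1 + poly (pderiv Q) z) < 1"
      unfolding Q_eq_G[OF j]
      by (rule double_root_splits_attracting[OF poly_G A_pos[OF j] poly_pderiv_G[OF j] B_gt[OF j]])
    then obtain d where "d > 0" "\<And>z. z \<noteq> of_real (w j) \<Longrightarrow> dist z (of_real (w j)) < d \<Longrightarrow>
      (\<forall>\<epsilon>>0. poly Q z = - of_real \<epsilon> \<longrightarrow> norm (1 + poly (pderiv Q) z) < 1)"
      unfolding eventually_at by auto
    then show ?thesis unfolding eventually_at_right_field by (intro exI[of _ d]) auto
  qed
  then have "\<forall>\<^sub>F \<delta> in at_right (0::real). \<forall>j\<in>{..<N}. \<forall>z. z \<noteq> of_real (w j) \<and> dist z (of_real (w j)) < \<delta> \<longrightarrow>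
      (\<forall>\<epsilon>>0. poly Q z = - of_real \<epsilon> \<longrightarrow> norm (1 + poly (pderiv Q) z) < 1)"
    by (intro eventually_ball_finite) auto
  then obtain \<delta>1 where \<delta>1: "\<delta>1 > 0" "\<And>\<delta> j z \<epsilon>. 0 < \<delta> \<Longrightarrow> \<delta> < \<delta>1 \<Longrightarrow> j < N \<Longrightarrow> z \<noteq> of_real (w j) \<Longrightarrow>
      dist z (of_real (w j)) < \<delta> \<Longrightarrow> \<epsilon> > 0 \<Longrightarrow> poly Q z = - of_real \<epsilon> \<Longrightarrow> norm (1 + poly (pderiv Q) z) < 1"
    unfolding eventually_at_right_field by (metis lessThan_iff)
  have "poly (pderiv Q) 0 \<noteq> 0"
    unfolding pderiv_Q_0 of_real_eq_0_iff using prod_w_pos by linarith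
  have holQ: "poly Q holomorphic_on S" for S by (intro holomorphic_intros)
  from \<open>poly (pderiv Q) 0 \<noteq> 0\<close> have "deriv (poly Q) 0 \<noteq> 0" by (simp add: DERIV_imp_deriv[OF poly_DERIV])
  then obtain \<delta>2 where \<delta>2: "\<delta>2 > 0" "inj_on (poly Q) (ball 0 \<delta>2)"
    using has_complex_derivative_locally_injective[OF holQ UNIV_I open_UNIV] by metis
  define \<delta> where "\<delta> = min (\<delta>1 / 2) \<delta>2"
  have \<delta>: "0 < \<delta>" "\<delta> < \<delta>1" "\<delta> \<le> \<delta>2" using \<delta>1(1) \<delta>2(1) by (auto simp: \<delta>_def)
  have inj: "inj_on (poly Q) (ball 0 \<delta>)" by (rule inj_on_subset[OF \<delta>2(2)]) (use \<delta>(3) in auto)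
  have reg: "poly (pderiv Q) z \<noteq> 0" if "z \<in> ball 0 \<delta>" for z
    using holomorphic_injective_imp_regular[OF holQ open_ball inj that]
    by (simp add: DERIV_imp_deriv[OF poly_DERIV])
  \<comment> \<open>\<open>Q\<close> is a product of 2N + 1 linear factors, so below this threshold
    every root of Q + \<epsilon> is closer than \<delta> to 0 or to some \<open>w j\<close>.\<close>
  have "critically_bounded (P + [:of_real \<epsilon>:])" if \<epsilon>: "0 < \<epsilon>" "\<epsilon> < \<delta> ^ (2 * N + 1)" for \<epsilon>
  proof -
    let ?P = "P + [:of_real \<epsilon>:]"
    let ?Q = "Q + [:of_real \<epsilon>:]"
    have mono: "monic_poly ?P" by (rule monic_poly_add_const)
    have deg\<epsilon>: "degree ?P = 2 * N + 1" using degree_P N by (subst degree_add_eq_left) auto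
    have degQ: "degree ?Q = 2 * N + 1" using degree_Q N by (subst degree_add_eq_left) auto
    have root: "poly ?Q z = 0 \<longleftrightarrow> poly Q z = - of_real \<epsilon>" for z
      by (simp add: add_eq_0_iff2)
    have near: "norm z < \<delta> \<or> norm (1 + poly (pderiv Q) z) < 1" if z: "poly Q z = - of_real \<epsilon>" for z
    proof (cases "norm z < \<delta>")
      case False
      have "\<exists>j<N. dist z (of_real (w j)) < \<delta>"
      proof (rule ccontr)
        assume "\<not> ?thesis"
        then have far: "norm (z - of_real (w j)) \<ge> \<delta>" if "j < N" for j using that by (auto simp: dist_norm)
        have "\<delta> ^ (2 * N + 1) = \<delta> * (\<Prod>k<N. \<delta>\<^sup>2)" by (simp add: power_mult)
        also have "\<dots> \<le> norm z * (\<Prod>k<N. (norm (z - of_real (w k)))\<^sup>2)"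
          using False far \<delta> by (intro mult_mono prod_mono prod_nonneg conjI power_mono) auto
        also have "\<dots> = norm (poly Q z)" by (simp add: poly_Q norm_mult prod_norm[symmetric] norm_power)
        also have "\<dots> = \<epsilon>" using z \<epsilon> by simp
        finally show False using \<epsilon> by simp
      qed
      then obtain j where j: "j < N" "dist z (of_real (w j)) < \<delta>" by blast
      have "z \<noteq> of_real (w j)"
      proof
        assume "z = of_real (w j)"
        then have "poly Q z = 0" using j(1) by (simp add: Q_eq_G)
        then show False using z \<epsilon> by simp
      qed
      then show ?thesis using \<delta>1(2)[OF \<delta>(1,2) j(1) _ j(2) \<epsilon>(1) z] by blast
    qed simp
    define Z where "Z = {z. poly ?Q z = 0}"
    \<comment> \<open>All roots are simple: in the disc around 0 by injectivity of \<open>Q\<close>,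
      elsewhere because |1 + Q'| < 1 excludes Q' = 0.\<close>
    have "card Z = 2 * N + 1"
      unfolding Z_def degQ[symmetric]
    proof (rule card_roots_squarefree)
      show "?Q \<noteq> 0" using degQ by auto
      fix a assume "poly ?Q a = 0"
      then have "norm a < \<delta> \<or> norm (1 + poly (pderiv Q) a) < 1" using near root by blast
      then have "poly (pderiv Q) a \<noteq> 0" using reg[of a] by auto
      then show "poly (pderiv ?Q) a \<noteq> 0" by (simp add: pderiv_add pderiv_pCons)
    qed
    define T where "T = Z - ball 0 \<delta>"
    have finZ: "finite Z" using \<open>card Z = 2 * N + 1\<close> by (intro card_ge_0_finite) simp
    have "card (Z \<inter> ball 0 \<delta>) \<le> 1"
    proof -
      have "x = y" if "x \<in> Z \<inter> ball 0 \<delta>" "y \<in> Z \<inter> ball 0 \<delta>" for x y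
        using that inj root by (auto simp: Z_def inj_on_def)
      then show ?thesis using finZ by (simp add: card_le_Suc0_iff_eq)
    qed
    moreover have "card Z = card (Z \<inter> ball 0 \<delta>) + card T"
      unfolding T_def using finZ by (metis add.commute card_Diff_subset_Int card_mono finite_Int inf_le1 le_add_diff_inverse)
    ultimately have "degree ?P \<le> card T + 1" using \<open>card Z = 2 * N + 1\<close> deg\<epsilon> by linarith
    then show ?thesis
    proof (rule monic_poly.attracting_fixed_points_imp_critically_bounded[OF mono])
      fix z assume "z \<in> T"
      then have z: "poly Q z = - of_real \<epsilon>" "\<not> norm z < \<delta>" using root by (auto simp: T_def Z_def)
      have "poly (pderiv ?P) z = 1 + poly (pderiv Q) z" by (simp add: pderiv_add pderiv_pCons pderiv_P)
      then show "poly ?P z = z \<and> norm (poly (pderiv ?P) z) < 1"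
        using near[OF z(1)] z by (simp add: poly_P)
    qed
  qed
  then show ?thesis
    unfolding eventually_at_right_field using \<delta>(1) by (intro exI[of _ "\<delta> ^ (2 * N + 1)"]) auto
qed

sublocale critically_bounded P
  by (rule critically_bounded_limit[OF eventually_critically_bounded])

end

lemma (in critically_bounded) in_connectedness_locus: "P \<in> connectedness_locus (degree P)"
  using boettcher_exists connected_julia monic by (auto simp: connectedness_locus_def)

subsection \<open>Attracting petals and the interior of the filled Julia set\<close>

text \<open>The disc touches the imaginary axis at 0, so inversion straightens it to a half-plane,
  where moving 1/u to the right is visibly an inward motion.\<close>

lemma norm_diff_of_real_less_iff:
  assumes "u \<noteq> 0" "r > 0"
  shows "norm (u - of_real r) < r \<longleftrightarrow> Re (inverse u) > 1 / (2 * r)"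
proof -
  have pos: "(norm u)\<^sup>2 > 0" using assms by simp
  have "norm (u - of_real r) < r \<longleftrightarrow> (norm (u - of_real r))\<^sup>2 < r\<^sup>2"
    using assms(2) power_strict_mono[of "norm (u - of_real r)" r 2]
      power_less_imp_less_base[of "norm (u - of_real r)" 2 r] by auto
  also have "(norm (u - of_real r))\<^sup>2 = (norm u)\<^sup>2 - 2 * r * Re u + r\<^sup>2"
    unfolding cmod_power2 by (simp add: power2_eq_square algebra_simps)
  also have "\<dots> < r\<^sup>2 \<longleftrightarrow> (norm u)\<^sup>2 < Re u * (2 * r)" by (simp add: algebra_simps)
  also have "\<dots> \<longleftrightarrow> (norm u)\<^sup>2 / (2 * r) < Re u" using assms(2) by (simp only: pos_divide_less_eq)
  also have "(norm u)\<^sup>2 / (2 * r) = 1 / (2 * r) * (norm u)\<^sup>2" by simp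
  also have "1 / (2 * r) * (norm u)\<^sup>2 < Re u \<longleftrightarrow> 1 / (2 * r) < Re u / (norm u)\<^sup>2" using pos by (simp only: pos_less_divide_eq)
  also have "Re u / (norm u)\<^sup>2 = Re (inverse u)" by (simp add: cmod_power2)
  finally show ?thesis .
qed

text \<open>With \<open>z = w - u\<close> the map becomes \<open>u \<mapsto> u - u\<^sup>2 G\<close>, i.e. \<open>1/u \<mapsto> 1/u + A + o(1)\<close>, and the disc
  \<open>ball (w - r) r\<close> becomes a right half-plane in the coordinate \<open>1/u\<close>.\<close>

lemma attracting_petal:
  fixes G :: "complex poly"
  assumes A: "poly G w = of_real A" "A > 0"
  obtains r where "r > 0"
    "\<And>z. z \<in> ball (w - of_real r) r \<Longrightarrow> z + (z - w)\<^sup>2 * poly G z \<in> ball (w - of_real r) r"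
proof -
  define g where "g u = poly G (w - u)" for u
  have "((\<lambda>u. w - u) \<longlongrightarrow> w - 0) (at 0)" by (intro tendsto_intros)
  then have g: "(g \<longlongrightarrow> of_real A) (at 0)"
    unfolding g_def A(1)[symmetric] by (intro tendsto_poly) simp
  have "((\<lambda>u. 1 - u * g u) \<longlongrightarrow> 1 - 0 * of_real A) (at 0)" by (intro tendsto_intros g)
  then have lim1: "((\<lambda>u. 1 - u * g u) \<longlongrightarrow> 1) (at 0)" by simp
  then have ne: "\<forall>\<^sub>F u in at 0. 1 - u * g u \<noteq> 0" by (rule tendsto_imp_eventually_ne) simp
  have "((\<lambda>u. Re (g u / (1 - u * g u))) \<longlongrightarrow> Re (of_real A / 1)) (at 0)"
    by (intro tendsto_intros g lim1) simp
  then have "\<forall>\<^sub>F u in at 0. Re (g u / (1 - u * g u)) > 0" using A(2) by (intro order_tendstoD(1)) auto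
  with ne have "\<forall>\<^sub>F u in at 0. 1 - u * g u \<noteq> 0 \<and> Re (g u / (1 - u * g u)) > 0" by (rule eventually_conj)
  then obtain \<delta> where \<delta>: "\<delta> > 0" "\<And>u. u \<noteq> 0 \<Longrightarrow> norm u < \<delta> \<Longrightarrow> 1 - u * g u \<noteq> 0 \<and> Re (g u / (1 - u * g u)) > 0"
    unfolding eventually_at by auto
  define r where "r = \<delta> / 2"
  have r: "r > 0" using \<delta>(1) by (simp add: r_def)
  have iff: "w - u \<in> ball (w - of_real r) r \<longleftrightarrow> norm (u - of_real r) < r" for u
    by (simp add: dist_norm)
  have "z + (z - w)\<^sup>2 * poly G z \<in> ball (w - of_real r) r" if z: "z \<in> ball (w - of_real r) r" for z
  proof -
    define u where "u = w - z"
    have zu: "z = w - u" by (simp add: u_def)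
    have nu: "norm (u - of_real r) < r" using z iff[of u] by (simp add: zu)
    then have "u \<noteq> 0" using r by auto
    have "norm u \<le> norm (u - of_real r) + norm (complex_of_real r)" by (metis diff_add_cancel norm_triangle_ineq)
    then have "norm u < \<delta>" using nu r by (simp add: r_def)
    note \<delta>u = \<delta>(2)[OF \<open>u \<noteq> 0\<close> this]
    define u' where "u' = u * (1 - u * g u)"
    have "u' \<noteq> 0" using \<delta>u \<open>u \<noteq> 0\<close> by (simp add: u'_def)
    have "inverse u' = inverse u + g u / (1 - u * g u)"
      using \<delta>u \<open>u \<noteq> 0\<close> by (simp add: u'_def field_simps)
    then have "Re (inverse u') = Re (inverse u) + Re (g u / (1 - u * g u))" by simp
    moreover have "Re (inverse u) > 1 / (2 * r)" using norm_diff_of_real_less_iff[OF \<open>u \<noteq> 0\<close> r] nu by blast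
    ultimately have "Re (inverse u') > 1 / (2 * r)" using \<delta>u by linarith
    then have "norm (u' - of_real r) < r" using norm_diff_of_real_less_iff[OF \<open>u' \<noteq> 0\<close> r] by blast
    moreover have "z + (z - w)\<^sup>2 * poly G z = w - u'"
      by (simp add: zu u'_def g_def power2_eq_square algebra_simps)
    ultimately show ?thesis using iff[of u'] by simp
  qed
  with r show ?thesis using that by blast
qed

lemma (in monic_poly) invariant_set_subset_filled_julia:
  assumes "bounded S" "\<And>z. z \<in> S \<Longrightarrow> poly P z \<in> S"
  shows "S \<subseteq> filled_julia P"
proof
  fix z assume z: "z \<in> S"
  have "(poly P ^^ n) z \<in> S" for n by (induction n) (auto simp: z assms(2))
  then have "range (\<lambda>n. (poly P ^^ n) z) \<subseteq> S" by auto
  then show "z \<in> filled_julia P" unfolding filled_julia_def using assms(1) bounded_subset by blast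
qed

lemma (in monic_poly) funpow_in_interior_imp:
  assumes "(poly P ^^ n) z \<in> interior (filled_julia P)"
  shows "z \<in> interior (filled_julia P)"
proof (rule interiorI)
  show "open ((poly P ^^ n) -` interior (filled_julia P))"
    using continuous_on_funpow_poly[of UNIV n P] by (intro open_vimage) auto
  show "(poly P ^^ n) -` interior (filled_julia P) \<subseteq> filled_julia P"
    using interior_subset[of "filled_julia P"] filled_julia_funpow_iff by blast
qed (use assms in auto)

text \<open>On a disc inside the filled Julia set one constant bounds all iterates, so Cauchy's
  inequality bounds all their derivatives together. The common Lipschitz constant later excludes the
  \<open>w k\<close> from the interior.\<close>

lemma (in monic_poly) interior_filled_julia_equicontinuous:
  assumes "a \<in> interior (filled_julia P)"
  obtains C s where "C > 0" "s > 0" "ball a s \<subseteq> filled_julia P"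
    "\<And>n x. dist a x < s \<Longrightarrow> norm ((poly P ^^ n) x - (poly P ^^ n) a) \<le> C * norm (x - a)"
proof -
  obtain e where e: "e > 0" "ball a e \<subseteq> filled_julia P" using assms mem_interior by blast
  obtain M where M: "M > 0" "\<And>z. z \<in> filled_julia P \<Longrightarrow> norm z \<le> M"
    using bounded_filled_julia bounded_pos by metis
  define s where "s = e / 4"
  have s: "s > 0" using e by (simp add: s_def)
  have sub: "cball z s \<subseteq> ball a e" if "z \<in> ball a s" for z
  proof
    fix y assume "y \<in> cball z s"
    then have "dist a y \<le> dist a z + s" using dist_triangle[of a y z] by simp
    also have "\<dots> < e" using that e(1) by (simp add: s_def)
    finally show "y \<in> ball a e" by simp
  qed
  have der: "norm (deriv (poly P ^^ n) z) \<le> M / s" if z: "z \<in> ball a s" for n z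
  proof -
    have "norm ((deriv ^^ 1) (poly P ^^ n) z) \<le> fact 1 * M / s ^ 1"
    proof (rule Cauchy_inequality)
      show "norm ((poly P ^^ n) x) \<le> M" if "norm (z - x) = s" for x
      proof -
        have "x \<in> cball z s" using that by (simp add: dist_norm)
        then have "x \<in> filled_julia P" using sub[OF z] e(2) by blast
        then show ?thesis using M(2) filled_julia_funpow_iff by blast
      qed
    qed (use s holomorphic_on_funpow_poly continuous_on_funpow_poly in auto)
    then show ?thesis by simp
  qed
  show ?thesis
  proof
    show "M / s > 0" "s > 0" using M s by auto
    show "ball a s \<subseteq> filled_julia P" using e s by (auto simp: s_def)
    fix n x assume x: "dist a x < s"
    show "norm ((poly P ^^ n) x - (poly P ^^ n) a) \<le> M / s * norm (x - a)"
    proof (rule field_differentiable_bound[of "ball a s" _ "deriv (poly P ^^ n)"])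
      show "((poly P ^^ n) has_field_derivative deriv (poly P ^^ n) z) (at z within ball a s)"
        if "z \<in> ball a s" for z
        using holomorphic_derivI[OF holomorphic_on_funpow_poly open_UNIV] by blast
    qed (use x s der in auto)
  qed
qed

section \<open>Dynamics on the nonnegative real axis\<close>

context parabolic_chain begin

lemma q_nonneg: "0 \<le> x \<Longrightarrow> 0 \<le> q x"
  unfolding q_def by (intro mult_nonneg_nonneg prod_nonneg) auto

lemma q_eq_0_iff: "q x = 0 \<longleftrightarrow> (\<exists>k\<le>N. x = w k)"
proof
  assume "q x = 0"
  then have "x = 0 \<or> (\<exists>k<N. x = w k)" by (auto simp: q_def)
  then show "\<exists>k\<le>N. x = w k" using wN by (metis le_refl less_imp_le)
next
  assume "\<exists>k\<le>N. x = w k"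
  then obtain k where k: "k \<le> N" "x = w k" by blast
  show "q x = 0"
  proof (cases "k = N")
    case False
    then have "k < N" using k by simp
    then have "(\<Prod>k<N. (x - w k)\<^sup>2) = 0" using k(2) by (intro prod_zero) auto
    then show ?thesis by (simp add: q_def)
  qed (use k wN in \<open>simp add: q_def\<close>)
qed

definition p :: "real \<Rightarrow> real" where "p x = x + q x"

lemma poly_P_p: "poly P (of_real x) = of_real (p x)"
  by (simp add: poly_P_of_real p_def)

lemma funpow_P_p: "(poly P ^^ n) (of_real x) = of_real ((p ^^ n) x)"
  by (induction n) (auto simp: poly_P_p)

lemma continuous_on_p: "continuous_on S p"
  unfolding p_def q_def by (intro continuous_intros)

lemma p_w: "k \<le> N \<Longrightarrow> p (w k) = w k" using q_eq_0_iff by (auto simp: p_def)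

lemma funpow_p_w: "k \<le> N \<Longrightarrow> (p ^^ n) (w k) = w k" by (induction n) (auto simp: p_w)

definition I :: "nat \<Rightarrow> real set" where "I j = {w (Suc j)<..<w j}"

lemma w_notin_I: assumes "k \<le> N" "j < N" shows "w k \<notin> I j"
proof (cases "k \<le> j")
  case True
  then have "w j \<le> w k" using w_strict[of k j] assms by (cases "k = j") auto
  then show ?thesis by (simp add: I_def)
next
  case False
  then have "w k \<le> w (Suc j)" using w_strict[of "Suc j" k] assms by (cases "k = Suc j") auto
  then show ?thesis by (simp add: I_def)
qed

lemma I_pos: "j < N \<Longrightarrow> x \<in> I j \<Longrightarrow> 0 < x"
  using w_nonneg[of "Suc j"] by (simp add: I_def)

lemma p_gt: "0 \<le> x \<Longrightarrow> (\<And>k. k \<le> N \<Longrightarrow> x \<noteq> w k) \<Longrightarrow> x < p x"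
  using q_nonneg[of x] q_eq_0_iff[of x] by (auto simp: p_def less_le)

lemma p_I:
  assumes j: "j < N" and x: "x \<in> I j" shows "x < p x" "p x \<in> I j"
proof -
  show gt: "x < p x" using p_gt[of x] I_pos[OF j x] w_notin_I[OF _ j] x by fastforce
  have x': "0 < x" "x < w j" "x \<le> 1/2" "w j \<le> 1/2"
    using I_pos[OF j x] x w_le[of j] j by (auto simp: I_def)
  have le1: "(\<Prod>k\<in>{..<N}-{j}. (x - w k)\<^sup>2) \<le> 1"
  proof (rule prod_le_1)
    fix k assume "k \<in> {..<N} - {j}"
    then have "0 \<le> w k" "w k \<le> 1/2" using w_nonneg[of k] w_le[of k] by auto
    then have "\<bar>x - w k\<bar> \<le> 1" using x' by linarith
    then have "(x - w k)\<^sup>2 \<le> 1" by (simp add: abs_square_le_1)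
    then show "0 \<le> (x - w k)\<^sup>2 \<and> (x - w k)\<^sup>2 \<le> 1" by simp
  qed
  have nn: "0 \<le> (\<Prod>k\<in>{..<N}-{j}. (x - w k)\<^sup>2)" by (intro prod_nonneg) auto
  \<comment> \<open>One factor w_j - x is split off; the remaining product is at most 1/4 because x
    and all the w_k lie in [0, 1/2]. So the step q(x) is shorter than the distance to w_j.\<close>
  have "q x = (w j - x) * (x * (w j - x) * (\<Prod>k\<in>{..<N}-{j}. (x - w k)\<^sup>2))"
    unfolding q_def using j by (subst prod.remove[of _ j]) (auto simp: power2_eq_square algebra_simps)
  moreover have "x * (w j - x) * (\<Prod>k\<in>{..<N}-{j}. (x - w k)\<^sup>2) \<le> 1/2 * (1/2) * 1"
    using x' le1 nn by (intro mult_mono) auto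
  ultimately have "q x \<le> (w j - x) * (1/4)" using x' by (auto intro!: mult_left_mono)
  then have "q x < w j - x" using x' by simp
  then show "p x \<in> I j" using gt x by (simp add: p_def I_def)
qed

lemma nonneg_cases:
  assumes "0 \<le> x"
  obtains j where "j < N" "x \<in> I j" | j where "j \<le> N" "x = w j" | "x > w 0"
proof -
  define m where "m = (LEAST j. w j \<le> x)"
  have wm: "w m \<le> x" unfolding m_def by (rule LeastI[of _ N]) (use wN assms in simp)
  have mN: "m \<le> N" unfolding m_def by (rule Least_le) (use wN assms in simp)
  show ?thesis
  proof (cases m)
    case 0
    then show ?thesis using wm that(2)[of 0] that(3) by (cases "x = w 0") auto
  next
    case (Suc j)
    have "\<not> w j \<le> x" using not_less_Least[of j "\<lambda>j. w j \<le> x"] Suc by (simp add: m_def)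
    then show ?thesis using wm that(2)[of m] that(1)[of j] Suc mN by (cases "x = w m") (auto simp: I_def)
  qed
qed

lemma p_fixed_limit:
  assumes lim: "u \<longlonglongrightarrow> l" "(\<lambda>n. p (u n)) \<longlonglongrightarrow> l"
  shows "\<exists>k\<le>N. l = w k"
  using fixed_point_limit[OF continuous_on_p lim] q_eq_0_iff by (simp add: p_def)

text \<open>The orbit increases inside \<open>I j\<close>, and its limit is a fixed point in the
  closure of \<open>I j\<close> above the starting point, which leaves only
  \<open>w j\<close>.\<close>

lemma forward_orbit:
  assumes j: "j < N" and x: "x \<in> I j" shows "(\<lambda>n. (p ^^ n) x) \<longlonglongrightarrow> w j"
proof -
  have inI: "(p ^^ n) x \<in> I j" for n by (induction n) (auto simp: x p_I[OF j])
  have inc: "incseq (\<lambda>n. (p ^^ n) x)" by (intro incseq_SucI) (use p_I(1)[OF j inI] in \<open>auto intro: less_imp_le\<close>)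
  have "(p ^^ n) x \<le> w j" for n using inI[of n] by (simp add: I_def)
  then obtain l where l: "(\<lambda>n. (p ^^ n) x) \<longlonglongrightarrow> l" "\<forall>n. (p ^^ n) x \<le> l"
    using incseq_convergent[OF inc] by metis
  have "l \<le> w j" using l(1) inI by (intro LIMSEQ_le_const2[OF l(1)]) (auto simp: I_def intro: less_imp_le)
  moreover have "x \<le> l" using l(2)[rule_format, of 0] by simp
  moreover have "(\<lambda>n. p ((p ^^ n) x)) \<longlonglongrightarrow> l" using LIMSEQ_Suc[OF l(1)] by simp
  then obtain k where "k \<le> N" "l = w k" using p_fixed_limit[OF l(1)] by blast
  ultimately have "l = w j" using w_notin_I[of k j] j x by (auto simp: I_def)
  then show ?thesis using l(1) by simp
qed

lemma backward_orbit:
  assumes j: "j < N" and u: "\<And>n. u n \<in> I j" "\<And>n. p (u (Suc n)) = u n"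
  shows "u \<longlonglongrightarrow> w (Suc j)"
proof -
  have dec: "decseq u" by (intro decseq_SucI) (use p_I(1)[OF j u(1)] u(2) in \<open>metis less_imp_le\<close>)
  have "w (Suc j) \<le> u n" for n using u(1)[of n] by (simp add: I_def)
  then obtain l where l: "u \<longlonglongrightarrow> l" "\<forall>n. l \<le> u n" using decseq_convergent[OF dec] by metis
  have "w (Suc j) \<le> l" using u(1) by (intro LIMSEQ_le_const[OF l(1)]) (auto simp: I_def intro: less_imp_le)
  moreover have "l < w j" using l(2)[rule_format, of 0] u(1)[of 0] by (simp add: I_def)
  moreover have "(\<lambda>n. p (u (Suc n))) \<longlonglongrightarrow> l" using l(1) u(2) by simp
  then obtain k where "k \<le> N" "l = w k" using p_fixed_limit[OF LIMSEQ_Suc[OF l(1)]] by blast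
  ultimately have "l = w (Suc j)" using w_notin_I[of k j] j by (auto simp: I_def)
  then show ?thesis using l(1) by simp
qed

lemma p_surj_I:
  assumes j: "j < N" and y: "y \<in> I j" shows "\<exists>x\<in>I j. p x = y"
proof -
  have "\<exists>x\<ge>w (Suc j). x \<le> w j \<and> p x = y"
    by (rule IVT'[OF _ _ _ continuous_on_p]) (use y j p_w[of j] p_w[of "Suc j"] in \<open>auto simp: I_def\<close>)
  then obtain x where x: "w (Suc j) \<le> x" "x \<le> w j" "p x = y" by blast
  have "x \<noteq> w (Suc j)" "x \<noteq> w j" using x(3) y j p_w[of j] p_w[of "Suc j"] by (auto simp: I_def)
  then show ?thesis using x by (auto simp: I_def)
qed

lemma escapes: "w 0 < x \<Longrightarrow> of_real x \<notin> filled_julia P"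
proof (rule of_real_escapes[where c = "w 0"])
  fix x assume x: "w 0 < x"
  have "x \<noteq> w k" if "k \<le> N" for k using w_strict[of 0 k] that x by (cases "k = 0") auto
  then have "x < p x" using x w_nonneg[of 0] by (intro p_gt) auto
  then show "x < Re (poly P (of_real x))" by (simp add: poly_P_p)
qed (use real_coeffs_P in auto)

text \<open>The orbit ends in the attracting petal at \<open>w j\<close>, an open invariant bounded
  set, and interior membership pulls back along iterates.\<close>

lemma interval_subset_interior:
  assumes j: "j < N" and x: "x \<in> I j" shows "of_real x \<in> interior (filled_julia P)"
proof -
  obtain r where r: "r > 0" "\<And>z. z \<in> ball (of_real (w j) - of_real r) r \<Longrightarrow>
      z + (z - of_real (w j))\<^sup>2 * poly (G j) z \<in> ball (of_real (w j) - of_real r) r"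
    using attracting_petal[OF poly_G A_pos[OF j]] by blast
  define D where "D = ball (complex_of_real (w j) - of_real r) r"
  have "D \<subseteq> filled_julia P"
  proof (rule invariant_set_subset_filled_julia)
    fix z assume "z \<in> D"
    moreover have "poly P z = z + (z - of_real (w j))\<^sup>2 * poly (G j) z"
      unfolding poly_P Q_eq_G[OF j] by simp
    ultimately show "poly P z \<in> D" using r(2) by (simp add: D_def)
  qed (simp add: D_def)
  then have D: "D \<subseteq> interior (filled_julia P)" by (simp add: D_def interior_maximal)
  \<comment> \<open>The petal disc meets the real line in the interval from w_j - 2r to w_j, and the
    orbit approaches w_j from the left.\<close>
  have "\<forall>\<^sub>F n in sequentially. dist ((p ^^ n) x) (w j) < 2 * r"
    using forward_orbit[OF j x] r(1) by (intro tendstoD) auto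
  then obtain n where n: "dist ((p ^^ n) x) (w j) < 2 * r" by (auto simp: eventually_sequentially)
  have "(p ^^ n) x \<in> I j" by (induction n) (auto simp: x p_I[OF j])
  then have "(p ^^ n) x < w j" by (simp add: I_def)
  then have "\<bar>w j - r - (p ^^ n) x\<bar> < r" using n by (simp add: dist_real_def abs_if split: if_splits)
  moreover have "norm (complex_of_real (w j) - of_real r - of_real ((p ^^ n) x)) = \<bar>w j - r - (p ^^ n) x\<bar>"
    by (simp only: of_real_diff[symmetric] norm_of_real)
  ultimately have "of_real ((p ^^ n) x) \<in> D" by (simp add: D_def dist_norm)
  then have "(poly P ^^ n) (of_real x) \<in> interior (filled_julia P)" using D by (auto simp: funpow_P_p)
  then show ?thesis by (rule funpow_in_interior_imp)
qed

text \<open>Points to the right of \<open>w 0\<close> escape. At any other \<open>w k\<close>,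
  repelling or parabolic, orbits that start arbitrarily close on the right travel to
  \<open>w (k - 1)\<close>, against the common Lipschitz bound for the iterates near an interior
  point.\<close>

lemma w_notin_interior:
  assumes k: "k \<le> N" shows "of_real (w k) \<notin> interior (filled_julia P)"
proof
  assume "of_real (w k) \<in> interior (filled_julia P)"
  then obtain C s where C: "C > 0" "s > 0" "ball (of_real (w k)) s \<subseteq> filled_julia P"
    "\<And>n x. dist (of_real (w k)) x < s \<Longrightarrow>
       norm ((poly P ^^ n) x - (poly P ^^ n) (of_real (w k))) \<le> C * norm (x - of_real (w k))"
    using interior_filled_julia_equicontinuous by metis
  have dist: "dist (complex_of_real (w k)) (of_real (w k + t)) = t" if "t \<ge> 0" for t
    using that by (simp add: dist_norm)
  show False
  proof (cases k)
    case 0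
    have "complex_of_real (w k + s / 2) \<in> ball (of_real (w k)) s" using dist[of "s/2"] C(2) by simp
    then show False using C(2,3) escapes[of "w k + s / 2"] 0 by auto
  next
    case (Suc j)
    then have j: "j < N" using k by simp
    define b where "b = w j - w k"
    have b: "b > 0" using dec[OF j] Suc by (simp add: b_def)
    \<comment> \<open>b/2 keeps the point in \<open>I j\<close>, s/2 keeps it in the disc of the
      Lipschitz bound, and b/(2C) makes C t \<le> b/2, less than the distance b that the orbit
      covers.\<close>
    define t where "t = min (b / 2) (min (s / 2) (b / (2 * C)))"
    have t: "t > 0" "t \<le> b / 2" "t \<le> s / 2" "t \<le> b / (2 * C)" using b C by (auto simp: t_def)
    have tI: "w k + t \<in> I j" using t b Suc by (auto simp: I_def b_def)
    have le: "\<bar>(p ^^ n) (w k + t) - w k\<bar> \<le> C * t" for n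
    proof -
      have "norm ((poly P ^^ n) (of_real (w k + t)) - (poly P ^^ n) (of_real (w k))) \<le> C * norm (complex_of_real (w k + t) - of_real (w k))"
        using dist[of t] t C(2) by (intro C(4)) auto
      also have "norm (complex_of_real (w k + t) - of_real (w k)) = t" using t(1) by simp
      finally have "norm (complex_of_real ((p ^^ n) (w k + t) - w k)) \<le> C * t"
        unfolding funpow_P_p funpow_p_w[OF k] by (simp only: of_real_diff)
      then show ?thesis by (simp only: norm_of_real)
    qed
    have "(\<lambda>n. \<bar>(p ^^ n) (w k + t) - w k\<bar>) \<longlonglongrightarrow> \<bar>w j - w k\<bar>"
      by (intro tendsto_intros forward_orbit[OF j tI])
    then have "\<bar>w j - w k\<bar> \<le> C * t" using le by (intro LIMSEQ_le_const2) auto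
    also have "C * t \<le> C * (b / (2 * C))" using t C by (intro mult_left_mono) auto
    also have "\<dots> = b / 2" using C by simp
    finally show False using b by (simp add: b_def)
  qed
qed

subsection \<open>The arcs\<close>

text \<open>Fixed in advance as the expected limit of the rays; \<open>hausdorff_limit_rays\<close>
  justifies it.\<close>

definition L :: "complex option set" where "L = real_halfline 0"

definition S :: "complex set" where "S = {z. Some z \<in> L} \<inter> interior (filled_julia P)"

lemma S_eq: "S = of_real ` (\<Union>j<N. I j)"
proof (intro equalityI subsetI)
  fix z assume z: "z \<in> S"
  then obtain x where x: "x \<ge> 0" "z = of_real x" by (auto simp: S_def L_def real_halfline_def)
  from x(1) show "z \<in> of_real ` (\<Union>j<N. I j)"
  proof (cases rule: nonneg_cases)
    case (2 j)
    then show ?thesis using z x w_notin_interior by (auto simp: S_def)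
  next
    case 3
    then show ?thesis using z x escapes[OF 3] subsetD[OF interior_subset] by (auto simp: S_def)
  qed (use x in auto)
next
  fix z :: complex assume "z \<in> of_real ` (\<Union>j<N. I j)"
  then obtain j x where x: "j < N" "x \<in> I j" "z = of_real x" by auto
  then show "z \<in> S" using interval_subset_interior[OF x(1,2)] I_pos[OF x(1,2)]
    by (auto simp: S_def L_def real_halfline_def)
qed

text \<open>The real part maps the component to an interval that avoids all \<open>w k\<close>, so
  it cannot leave \<open>I j\<close>.\<close>

lemma connected_component_S:
  assumes j: "j < N" and x: "x \<in> I j"
  shows "connected_component_set S (of_real x) = of_real ` I j"
proof
  have "connected (of_real ` I j :: complex set)"
    unfolding I_def by (intro connected_continuous_image continuous_intros) auto
  moreover have "of_real ` I j \<subseteq> S" using j by (auto simp: S_eq)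
  ultimately show "of_real ` I j \<subseteq> connected_component_set S (of_real x)"
    using x by (intro connected_component_maximal) auto
  define C where "C = connected_component_set S (complex_of_real x)"
  have CS: "C \<subseteq> S" unfolding C_def by (rule connected_component_subset)
  have xC: "of_real x \<in> C" unfolding C_def using j x by (auto simp: S_eq intro!: connected_component_refl)
  have "connected (Re ` C)" unfolding C_def by (intro connected_continuous_image continuous_intros) auto
  then have ivl: "c \<in> Re ` C" if "a \<in> Re ` C" "b \<in> Re ` C" "a \<le> c" "c \<le> b" for a b c
    using that connected_contains_Icc[of "Re ` C" a b] by auto
  have wC: "w k \<notin> Re ` C" if "k \<le> N" for k
    using CS w_notin_I[OF that] by (auto simp: S_eq)
  have xR: "x \<in> Re ` C" using xC by force
  show "connected_component_set S (of_real x) \<subseteq> of_real ` I j"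
    unfolding C_def[symmetric]
  proof
    fix z assume z: "z \<in> C"
    then obtain t where t: "z = of_real t" using CS by (auto simp: S_eq)
    then have tR: "t \<in> Re ` C" using z by force
    have "t < w j" using ivl[OF xR tR, of "w j"] wC[of j] j x by (force simp: I_def)
    moreover have "w (Suc j) < t" using ivl[OF tR xR, of "w (Suc j)"] wC[of "Suc j"] j x by (force simp: I_def)
    ultimately show "z \<in> of_real ` I j" using t by (simp add: I_def)
  qed
qed

lemma I_nonempty: "j < N \<Longrightarrow> \<exists>x. x \<in> I j"
  using dense[OF dec] by (auto simp: I_def)

lemma components_S: "components S = (\<lambda>j. of_real ` I j) ` {..<N}"
proof -
  have "components S = connected_component_set S ` S" by (simp add: components_def)
  also have "\<dots> = (\<lambda>j. of_real ` I j) ` {..<N}"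
  proof (intro equalityI subsetI)
    fix C assume "C \<in> connected_component_set S ` S"
    then obtain j x where "j < N" "x \<in> I j" "C = connected_component_set S (of_real x)" by (auto simp: S_eq)
    then show "C \<in> (\<lambda>j. of_real ` I j) ` {..<N}" using connected_component_S by auto
  next
    fix C :: "complex set" assume "C \<in> (\<lambda>j. of_real ` I j) ` {..<N}"
    then obtain j where j: "j < N" "C = of_real ` I j" by auto
    obtain x where x: "x \<in> I j" using I_nonempty[OF j(1)] by blast
    show "C \<in> connected_component_set S ` S"
      using connected_component_S[OF j(1) x] j x by (intro image_eqI[of _ _ "of_real x"]) (auto simp: S_eq)
  qed
  finally show ?thesis .
qed

lemma poly_P_image_I: "j < N \<Longrightarrow> poly P ` (of_real ` I j) = of_real ` I j"
proof (intro equalityI subsetI)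
  fix z :: complex assume j: "j < N" and "z \<in> of_real ` I j"
  then obtain y where y: "y \<in> I j" "z = of_real y" by auto
  obtain x where "x \<in> I j" "p x = y" using p_surj_I[OF j y(1)] by blast
  then show "z \<in> poly P ` (of_real ` I j)" using y by (auto simp: poly_P_p image_image intro!: image_eqI[of _ _ x])
qed (auto simp: poly_P_p p_I)

lemma invariant_arc_iff:
  "invariant_arc P L \<gamma> a b \<longleftrightarrow> (\<exists>j<N. \<gamma> = of_real ` I j \<and> a = of_real (w (Suc j)) \<and> b = of_real (w j))"
proof
  assume arc: "invariant_arc P L \<gamma> a b"
  then have "\<gamma> \<in> components S" by (simp add: invariant_arc_def S_def)
  then obtain j where j: "j < N" "\<gamma> = of_real ` I j" by (auto simp: components_S)
  obtain x where x: "x \<in> I j" using I_nonempty[OF j(1)] by blast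
  have "(\<lambda>n. (poly P ^^ n) (of_real x)) \<longlonglongrightarrow> b" using arc x j by (simp add: invariant_arc_def)
  moreover have "(\<lambda>n. (poly P ^^ n) (of_real x)) \<longlonglongrightarrow> of_real (w j)"
    unfolding funpow_P_p by (intro tendsto_of_real forward_orbit j x)
  ultimately have b: "b = of_real (w j)" by (rule LIMSEQ_unique)
  \<comment> \<open>A backward orbit inside the interval exists, so the condition on backward orbits
    is not vacuous and determines \<open>a\<close>.\<close>
  have "\<exists>u. \<forall>n. u n \<in> I j \<and> p (u (Suc n)) = u n"
    by (rule dependent_nat_choice[where P = "\<lambda>_ x. x \<in> I j" and Q = "\<lambda>_ x y. p y = x"])
       (use x p_surj_I[OF j(1)] in blast)+
  then obtain u where u: "\<And>n. u n \<in> I j" "\<And>n. p (u (Suc n)) = u n" by blast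
  have bwd: "\<forall>u. (\<forall>n. u n \<in> \<gamma> \<and> poly P (u (Suc n)) = u n) \<longrightarrow> u \<longlonglongrightarrow> a"
    using arc unfolding invariant_arc_def by (elim conjE)
  have "(\<lambda>n. complex_of_real (u n)) \<longlonglongrightarrow> a"
    by (rule mp[OF spec[OF bwd]]) (use u j in \<open>simp add: poly_P_p\<close>)
  moreover have "(\<lambda>n. complex_of_real (u n)) \<longlonglongrightarrow> of_real (w (Suc j))"
    by (intro tendsto_of_real backward_orbit[OF j(1)] u)
  ultimately have "a = of_real (w (Suc j))" by (rule LIMSEQ_unique)
  with b j show "\<exists>j<N. \<gamma> = of_real ` I j \<and> a = of_real (w (Suc j)) \<and> b = of_real (w j)" by blast
next
  assume "\<exists>j<N. \<gamma> = of_real ` I j \<and> a = of_real (w (Suc j)) \<and> b = of_real (w j)"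
  then obtain j where j: "j < N" and \<gamma>: "\<gamma> = of_real ` I j" and a: "a = of_real (w (Suc j))" and b: "b = of_real (w j)"
    by blast
  have "\<gamma> \<in> components S" using j \<gamma> by (auto simp: components_S)
  moreover have "\<exists>g. simple_path g \<and> pathstart g = a \<and> pathfinish g = b \<and> \<gamma> = g ` {0<..<1}"
  proof (intro exI conjI)
    have lt: "w (Suc j) < w j" using dec[OF j] .
    show "simple_path (linepath a b)" using lt by (intro simple_path_linepath) (simp add: a b)
    have lp: "linepath a b t = of_real (w (Suc j) + t * (w j - w (Suc j)))" for t
      by (simp add: linepath_def a b scaleR_conv_of_real algebra_simps)
    have "I j = (\<lambda>t. w (Suc j) + t * (w j - w (Suc j))) ` {0<..<1}"
    proof (intro equalityI subsetI)
      fix x assume x: "x \<in> I j"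
      have "x = w (Suc j) + ((x - w (Suc j)) / (w j - w (Suc j))) * (w j - w (Suc j))" using lt by simp
      moreover have "(x - w (Suc j)) / (w j - w (Suc j)) \<in> {0<..<1}" using x lt by (simp add: I_def)
      ultimately show "x \<in> (\<lambda>t. w (Suc j) + t * (w j - w (Suc j))) ` {0<..<1}" by (rule image_eqI)
    next
      fix x assume "x \<in> (\<lambda>t. w (Suc j) + t * (w j - w (Suc j))) ` {0<..<1}"
      then obtain t where t: "0 < t" "t < 1" "x = w (Suc j) + t * (w j - w (Suc j))" by auto
      have "0 < t * (w j - w (Suc j))" "t * (w j - w (Suc j)) < 1 * (w j - w (Suc j))"
        using t lt by (auto intro!: mult_pos_pos mult_strict_right_mono)
      then show "x \<in> I j" using t by (simp add: I_def)
    qed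
    then show "\<gamma> = linepath a b ` {0<..<1}" unfolding \<gamma> lp[abs_def] by (simp add: image_image)
  qed auto
  moreover have "poly P ` \<gamma> = \<gamma>" unfolding \<gamma> by (rule poly_P_image_I[OF j])
  moreover have "u \<longlonglongrightarrow> a" if u: "\<forall>n. u n \<in> \<gamma> \<and> poly P (u (Suc n)) = u n" for u
  proof -
    define v where "v n = Re (u n)" for n
    have uv: "u n = of_real (v n)" "v n \<in> I j" for n using u[rule_format, of n] by (auto simp: v_def \<gamma>)
    have "p (v (Suc n)) = v n" for n
    proof -
      have "complex_of_real (p (v (Suc n))) = of_real (v n)"
        using u[rule_format, of n] by (simp add: uv(1) poly_P_p)
      then show ?thesis by (simp only: of_real_eq_iff)
    qed
    then have "v \<longlonglongrightarrow> w (Suc j)" using backward_orbit[OF j] uv(2) by blast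
    then have "(\<lambda>n. complex_of_real (v n)) \<longlonglongrightarrow> a" unfolding a by (rule tendsto_of_real)
    then show ?thesis using uv(1) by presburger
  qed
  moreover have "(\<lambda>n. (poly P ^^ n) z) \<longlonglongrightarrow> b" if "z \<in> \<gamma>" for z
    using that forward_orbit[OF j] unfolding \<gamma> b by (auto simp: funpow_P_p intro!: tendsto_of_real)
  ultimately show "invariant_arc P L \<gamma> a b"
    unfolding invariant_arc_def S_def[symmetric] by (intro conjI allI impI ballI) assumption+
qed

lemma w_Suc_ne: "j < N \<Longrightarrow> w (Suc j) \<noteq> w j"
  using dec[of j] by simp

lemma heteroclinic_arc_iff:
  "heteroclinic_arc P L \<gamma> a b \<longleftrightarrow> (\<exists>j<N. \<gamma> = of_real ` I j \<and> a = of_real (w (Suc j)) \<and> b = of_real (w j))"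
  unfolding heteroclinic_arc_def invariant_arc_iff by (auto simp: w_Suc_ne)

lemma spine_L: "spine P L = L"
proof -
  have "\<not> homoclinic_arc P L \<gamma>" for \<gamma>
    unfolding homoclinic_arc_def invariant_arc_iff by (auto simp: w_Suc_ne)
  then show ?thesis by (auto simp: spine_def)
qed

lemma L_eq_segments: "L = (\<Union>j<N. real_segment (w (Suc j)) (w j)) \<union> real_halfline (w 0)"
proof (intro equalityI subsetI)
  fix z assume z: "z \<in> L"
  show "z \<in> (\<Union>j<N. real_segment (w (Suc j)) (w j)) \<union> real_halfline (w 0)"
  proof (cases z)
    case (Some c)
    then obtain x where x: "x \<ge> 0" "z = Some (of_real x)" using z by (auto simp: L_def real_halfline_def)
    from x(1) show ?thesis
    proof (cases rule: nonneg_cases)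
      case (1 j)
      then show ?thesis using x by (auto simp: real_segment_def I_def intro!: bexI[of _ j] imageI)
    next
      case (2 j)
      show ?thesis
      proof (cases "j = N")
        case True
        then have "x \<in> {w (Suc (N - 1))..w (N - 1)}" using 2 N dec[of "N - 1"] by simp
        then show ?thesis using x N by (auto simp: real_segment_def intro!: bexI[of _ "N - 1"])
      next
        case False
        then have "x \<in> {w (Suc j)..w j}" "j < N" using 2 dec[of j] by auto
        then show ?thesis using x by (auto simp: real_segment_def intro!: bexI[of _ j])
      qed
    next
      case 3
      then show ?thesis using x by (auto simp: real_halfline_def)
    qed
  qed (auto simp: real_halfline_def)
next
  fix z assume "z \<in> (\<Union>j<N. real_segment (w (Suc j)) (w j)) \<union> real_halfline (w 0)"
  then show "z \<in> L"
  proof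
    assume "z \<in> (\<Union>j<N. real_segment (w (Suc j)) (w j))"
    then obtain j x where x: "j < N" "w (Suc j) \<le> x" "z = Some (of_real x)" by (auto simp: real_segment_def)
    then have "x \<ge> 0" using w_nonneg[of "Suc j"] by simp
    then show ?thesis using x by (auto simp: L_def real_halfline_def)
  next
    assume "z \<in> real_halfline (w 0)"
    then show ?thesis using w_nonneg[of 0] by (auto simp: L_def real_halfline_def)
  qed
qed

lemma closed_ray_P: "closed_ray P 0 = real_halfline (w 0)"
proof (rule closed_ray_zero_real)
  show "poly P (of_real (w 0)) = of_real (w 0)" using N parabolic_fixed_point(1)[of 0] by simp
  fix x assume x: "w 0 < x"
  have "x \<noteq> w k" if "k \<le> N" for k using w_strict[of 0 k] that x by (cases "k = 0") auto
  then have "x < p x" using x w_nonneg[of 0] by (intro p_gt) auto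
  then show "x < Re (poly P (of_real x))" by (simp add: poly_P_p)
qed (use real_coeffs_P boettcher_exists in auto)

lemma heteroclinic_arcs_union:
  "\<Union>{Some ` (\<gamma> \<union> {a, b}) | \<gamma> a b. heteroclinic_arc P L \<gamma> a b} = (\<Union>j<N. real_segment (w (Suc j)) (w j))"
proof -
  have seg: "Some ` (complex_of_real ` I j \<union> {of_real (w (Suc j)), of_real (w j)}) = real_segment (w (Suc j)) (w j)"
    if "j < N" for j
  proof -
    have "{w (Suc j)..w j} = I j \<union> {w (Suc j), w j}" using dec[OF that] by (auto simp: I_def)
    then show ?thesis by (auto simp: real_segment_def)
  qed
  have "{Some ` (\<gamma> \<union> {a, b}) | \<gamma> a b. heteroclinic_arc P L \<gamma> a b} = (\<lambda>j. real_segment (w (Suc j)) (w j)) ` {..<N}"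
    unfolding heteroclinic_arc_iff by (auto simp: seg[symmetric])
  then show ?thesis by simp
qed

end

subsection \<open>The Hausdorff limit\<close>

lemma isCont_sphere_point_of_real: "isCont (\<lambda>t. sphere_point (Some (complex_of_real t))) a"
proof -
  have ne: "(norm z)\<^sup>2 + 1 \<noteq> 0" for z :: complex
    by (metis add_nonneg_pos less_irrefl zero_le_power2 zero_less_one)
  have ne': "complex_of_real ((norm z)\<^sup>2 + 1) \<noteq> 0" for z :: complex
    unfolding of_real_eq_0_iff by (rule ne)
  show ?thesis
    unfolding sphere_point_def option.case by (intro continuous_intros ne ne')
qed

lemma compactin_real_halfline: "compactin riemann_sphere (real_halfline a)"
proof (rule closedin_compact_space)
  show "compact_space riemann_sphere" by (rule compact_space_Alexandroff_compactification)
  have top: "topspace riemann_sphere = UNIV" by (auto simp: image_iff)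
  have "closed (complex_of_real ` {a..})"
  proof -
    have "complex_of_real ` {a..} = {z. Im z = 0} \<inter> {z. a \<le> Re z}"
    proof (intro equalityI subsetI)
      fix z assume "z \<in> {z. Im z = 0} \<inter> {z. a \<le> Re z}"
      then show "z \<in> complex_of_real ` {a..}" by (intro image_eqI[of _ _ "Re z"]) (auto simp: complex_eq_iff)
    qed auto
    moreover have "closed {z. Im z = 0}" "closed {z. a \<le> Re z}"
      by (intro closed_Collect_eq closed_Collect_le continuous_intros)+
    ultimately show ?thesis by auto
  qed
  then have "open (- (complex_of_real ` {a..}))" by auto
  moreover have "topspace riemann_sphere - real_halfline a = Some ` (- (complex_of_real ` {a..}))"
  proof (intro equalityI subsetI)
    fix z assume z: "z \<in> topspace riemann_sphere - real_halfline a"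
    then show "z \<in> Some ` (- (complex_of_real ` {a..}))"
      by (cases z) (auto simp: real_halfline_def)
  qed (auto simp: top real_halfline_def)
  ultimately show "closedin riemann_sphere (real_halfline a)"
    unfolding closedin_def top by simp
qed

text \<open>One half-line contains the other, so one of the two suprema is 0; in the other, every
  surplus point \<open>\<sigma> t\<close> is compared with the endpoint
  \<open>\<sigma> a\<close>.\<close>

lemma hausdorff_dist_real_halfline:
  fixes a c :: real
  defines "\<sigma> \<equiv> \<lambda>t. sphere_point (Some (complex_of_real t))"
  assumes "c \<le> a" and e: "\<And>t. c \<le> t \<Longrightarrow> t \<le> a \<Longrightarrow> dist (\<sigma> t) (\<sigma> a) \<le> e"
  shows "\<bar>hausdorff_dist (sphere_point ` real_halfline c) (sphere_point ` real_halfline a)\<bar> \<le> e"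
proof -
  define X where "X = sphere_point ` real_halfline c"
  define Y where "Y = sphere_point ` real_halfline a"
  have X: "X = insert (sphere_point None) (\<sigma> ` {c..})" and Y: "Y = insert (sphere_point None) (\<sigma> ` {a..})"
    by (auto simp: X_def Y_def real_halfline_def \<sigma>_def)
  have "Y \<subseteq> X" using assms(2) by (auto simp: X Y)
  have e0: "0 \<le> e" using e[of a] assms(2) by simp
  have "(SUP y\<in>Y. infdist y X) = (SUP y\<in>Y. 0)"
    using \<open>Y \<subseteq> X\<close> by (intro SUP_cong) (auto intro: infdist_zero)
  also have "\<dots> = 0" by (rule cSUP_const) (simp add: Y)
  finally have 1: "(SUP y\<in>Y. infdist y X) = 0" .
  have 2: "(SUP x\<in>X. infdist x Y) \<le> e"
  proof (rule cSUP_least)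
    fix x assume x: "x \<in> X"
    show "infdist x Y \<le> e"
    proof (cases "x \<in> Y")
      case False
      then obtain t where t: "x = \<sigma> t" "c \<le> t" "t < a" using x by (force simp: X Y)
      have "infdist x Y \<le> dist x (\<sigma> a)" by (intro infdist_le) (simp add: Y)
      also have "\<dots> \<le> e" using e[of t] t by simp
      finally show ?thesis .
    qed (use e0 in simp)
  qed (simp add: X)
  show ?thesis unfolding hausdorff_dist_def X_def[symmetric] Y_def[symmetric] using 1 2 e0 by auto
qed

text \<open>The landing points of the perturbed rays have no closed form, so the endpoint
  \<open>c\<close> is only squeezed between \<open>b x\<close> and \<open>a\<close>.\<close>

lemma hausdorff_limit_real_halfline:
  assumes ev: "\<forall>\<^sub>F x in F. \<exists>c. b x \<le> c \<and> c \<le> a \<and> A x = real_halfline c" and b: "(b \<longlongrightarrow> a) F"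
  shows "hausdorff_limit A (real_halfline a) F"
  unfolding hausdorff_limit_def
proof (intro conjI)
  show "real_halfline a \<noteq> {}" by (simp add: real_halfline_def)
  show "compactin riemann_sphere (real_halfline a)" by (rule compactin_real_halfline)
  show "\<forall>\<^sub>F x in F. A x \<noteq> {} \<and> compactin riemann_sphere (A x)"
    using ev by eventually_elim (metis compactin_real_halfline insert_not_empty real_halfline_def)
  show "((\<lambda>x. hausdorff_dist (sphere_point ` A x) (sphere_point ` real_halfline a)) \<longlongrightarrow> 0) F"
  proof (rule tendstoI)
    fix e :: real assume e: "e > 0"
    have "((\<lambda>t. sphere_point (Some (complex_of_real t))) \<longlongrightarrow> sphere_point (Some (of_real a))) (at a)"
      using isCont_sphere_point_of_real[of a] by (simp add: isCont_def)
    then have "\<forall>\<^sub>F t in at a. dist (sphere_point (Some (complex_of_real t))) (sphere_point (Some (of_real a))) < e / 2"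
      using e by (intro tendstoD) auto
    then obtain d where d: "d > 0" "\<And>t. t \<noteq> a \<Longrightarrow> dist t a < d \<Longrightarrow>
        dist (sphere_point (Some (complex_of_real t))) (sphere_point (Some (of_real a))) < e / 2"
      unfolding eventually_at by auto
    have "\<forall>\<^sub>F x in F. dist (b x) a < d" using b d(1) by (rule tendstoD)
    then show "\<forall>\<^sub>F x in F. dist (hausdorff_dist (sphere_point ` A x) (sphere_point ` real_halfline a)) 0 < e"
      using ev
    proof eventually_elim
      case (elim x)
      then obtain c where c: "b x \<le> c" "c \<le> a" "A x = real_halfline c" by blast
      have "\<bar>hausdorff_dist (sphere_point ` real_halfline c) (sphere_point ` real_halfline a)\<bar> \<le> e / 2"
      proof (rule hausdorff_dist_real_halfline[OF c(2)])
        fix t assume t: "c \<le> t" "t \<le> a"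
        then have "dist t a < d" using elim(1) c by (simp add: dist_real_def)
        then show "dist (sphere_point (Some (complex_of_real t))) (sphere_point (Some (of_real a))) \<le> e / 2"
          using d(2)[of t] e by (cases "t = a") auto
      qed
      then show ?case using e c(3) by simp
    qed
  qed
qed

section \<open>Rays of the perturbed polynomials\<close>

context parabolic_chain begin

text \<open>Real fixed points of \<open>P + \<epsilon>\<close> solve q(x) = -\<epsilon>. None has x
  \<ge> 0, where \<open>q\<close> is nonnegative. For x < 0 write q(x) = x M(x) with
  \<open>M\<close> decreasing there, so that \<open>q\<close> increases and there is exactly one
  solution.\<close>

lemma closed_ray_perturbed:
  assumes \<epsilon>: "\<epsilon> > 0" and cb: "critically_bounded (P + [:of_real \<epsilon>:])"
  shows "\<exists>c. - \<epsilon> / (\<Prod>k<N. (w k)\<^sup>2) \<le> c \<and> c \<le> 0 \<and> closed_ray (P + [:of_real \<epsilon>:]) 0 = real_halfline c"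
proof -
  define M where "M x = (\<Prod>k<N. (x - w k)\<^sup>2)" for x
  have M0: "M 0 = (\<Prod>k<N. (w k)\<^sup>2)" "M 0 > 0" using prod_w_pos by (simp_all add: M_def)
  have q: "q x = x * M x" for x by (simp add: q_def M_def)
  have M_mono: "M y \<le> M x" if "x \<le> y" "y \<le> 0" for x y
    unfolding M_def
  proof (intro prod_mono conjI)
    fix k assume "k \<in> {..<N}"
    then have "\<bar>y - w k\<bar> \<le> \<bar>x - w k\<bar>" using that w_nonneg[of k] by auto
    then show "(y - w k)\<^sup>2 \<le> (x - w k)\<^sup>2" by (simp add: abs_le_square_iff)
  qed auto
  have contq: "continuous_on S q" for S unfolding q_def by (intro continuous_intros)
  \<comment> \<open>Left of 0 one has M \<ge> M(0), so q(b) \<le> b M(0) = -\<epsilon>, and the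
    fixed point lies between \<open>b\<close> and 0.\<close>
  define b where "b = - \<epsilon> / M 0"
  have b0: "b \<le> 0" using \<epsilon> M0(2) by (simp add: b_def)
  have "q b \<le> b * M 0" unfolding q using b0 M_mono[of b 0] by (intro mult_left_mono_neg) auto
  also have "\<dots> = - \<epsilon>" using M0(2) by (simp add: b_def)
  finally have "\<exists>c\<ge>b. c \<le> 0 \<and> q c = - \<epsilon>"
    using b0 \<epsilon> by (intro IVT'[OF _ _ _ contq]) (auto simp: q)
  then obtain c where c: "b \<le> c" "c \<le> 0" "q c = - \<epsilon>" by blast
  have gt: "q x > - \<epsilon>" if "x > c" for x
  proof (cases "x \<ge> 0")
    case True
    then show ?thesis using q_nonneg[of x] \<epsilon> by simp
  next
    case False
    have "M c > 0" using M_mono[of c 0] c(2) M0(2) by simp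
    then have "c * M c < x * M c" using that by (intro mult_strict_right_mono)
    also have "\<dots> \<le> x * M x" using False M_mono[of c x] that by (intro mult_left_mono_neg) auto
    finally show ?thesis using c(3) by (simp add: q)
  qed
  interpret R: critically_bounded "P + [:of_real \<epsilon>:]" by (rule cb)
  have val: "poly (P + [:of_real \<epsilon>:]) (of_real x) = of_real (x + q x + \<epsilon>)" for x
    by (simp add: poly_P_of_real)
  have "closed_ray (P + [:of_real \<epsilon>:]) 0 = real_halfline c"
  proof (rule R.closed_ray_zero_real)
    show "coeff (P + [:of_real \<epsilon>:]) i \<in> \<real>" for i
      using real_coeffs_P[of i] by (auto simp: coeff_pCons split: nat.split)
    show "\<exists>\<beta>. is_boettcher (P + [:of_real \<epsilon>:]) \<beta>" by (rule R.boettcher_exists)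
    show "poly (P + [:of_real \<epsilon>:]) (of_real c) = of_real c" unfolding val using c(3) by simp
    show "x < Re (poly (P + [:of_real \<epsilon>:]) (of_real x))" if "c < x" for x
      unfolding val Re_complex_of_real using gt[OF that] by simp
  qed
  then show ?thesis using c M0 by (auto simp: b_def)
qed

lemma hausdorff_limit_rays:
  "hausdorff_limit (\<lambda>\<epsilon>. closed_ray (P + [:of_real \<epsilon>:]) 0) L (at_right 0)"
  unfolding L_def
proof (rule hausdorff_limit_real_halfline)
  have "\<forall>\<^sub>F \<epsilon> in at_right (0::real). \<epsilon> > 0" by (simp add: eventually_at_filter)
  then show "\<forall>\<^sub>F \<epsilon> in at_right (0::real). \<exists>c. - \<epsilon> / (\<Prod>k<N. (w k)\<^sup>2) \<le> c \<and> c \<le> 0 \<and>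
      closed_ray (P + [:of_real \<epsilon>:]) 0 = real_halfline c"
    using eventually_critically_bounded by eventually_elim (rule closed_ray_perturbed)
  have "((\<lambda>\<epsilon>::real. - \<epsilon> / (\<Prod>k<N. (w k)\<^sup>2)) \<longlongrightarrow> - 0 / (\<Prod>k<N. (w k)\<^sup>2)) (at_right 0)"
    by (intro tendsto_divide tendsto_minus tendsto_ident_at tendsto_const) (use prod_w_pos in linarith)
  then show "((\<lambda>\<epsilon>::real. - \<epsilon> / (\<Prod>k<N. (w k)\<^sup>2)) \<longlongrightarrow> 0) (at_right 0)" by simp
qed

lemma perturbed_in_connectedness_locus:
  "\<forall>\<^sub>F \<epsilon> in at_right (0::real). P + [:of_real \<epsilon>:] \<in> connectedness_locus (2 * N + 1)"
  using eventually_critically_bounded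
proof eventually_elim
  case (elim \<epsilon>)
  have "degree (P + [:of_real \<epsilon>:]) = 2 * N + 1" using degree_P N by (subst degree_add_eq_left) auto
  then show ?case using critically_bounded.in_connectedness_locus[OF elim] by simp
qed

end

text \<open>For rapidly decreasing \<open>w\<close> the term \<open>1 / w j\<close> dominates the negative contributions of the
  larger roots, and scaling \<open>w\<close> down makes the left-hand side of the gap condition small.\<close>

lemma parabolic_chain_exists:
  assumes N: "N \<ge> 1"
  shows "parabolic_chain N (\<lambda>j. if j < N then (1/2) * (1/8) ^ j else 0)"
proof
  let ?w = "\<lambda>j. if j < N then (1/2) * (1/8) ^ j else 0 :: real"
  show "?w (Suc j) < ?w j" if "j < N" for j using that by simp
  fix j assume j: "j < N"
  define v where "v k = (1/2) * (1/8::real) ^ k" for k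
  have v: "?w k = v k" if "k < N" for k using that by (simp add: v_def)
  have vpos: "v k > 0" for k by (simp add: v_def)
  have vle: "v k \<le> 1/2" for k by (simp add: v_def power_le_one)
  have vinv: "1 / v k = 2 * 8 ^ k" for k by (simp add: v_def power_one_over field_simps)
  have vdec: "v k \<le> v i / 8" if "i < k" for i k
  proof -
    have "(1/8::real) ^ k \<le> (1/8) ^ Suc i" using that by (intro power_decreasing) auto
    then show ?thesis by (simp add: v_def)
  qed
  have eq1: "(\<Prod>k\<in>{..<N}-{j}. (v j - ?w k)\<^sup>2) = (\<Prod>k\<in>{..<N}-{j}. (v j - v k)\<^sup>2)"
    by (rule prod.cong) (use j v in auto)
  have eq2: "(\<Sum>k\<in>{..<N}-{j}. 2 / (v j - ?w k)) = (\<Sum>k\<in>{..<N}-{j}. 2 / (v j - v k))"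
    by (rule sum.cong) (use j v in auto)
  have "(\<Prod>k\<in>{..<N}-{j}. (v j - v k)\<^sup>2) \<le> 1"
  proof (rule prod_le_1)
    fix k
    have "\<bar>v j - v k\<bar> \<le> 1" using vpos[of j] vpos[of k] vle[of j] vle[of k] by linarith
    then show "0 \<le> (v j - v k)\<^sup>2 \<and> (v j - v k)\<^sup>2 \<le> 1" by (simp add: abs_square_le_1)
  qed
  then have "v j * (\<Prod>k\<in>{..<N}-{j}. (v j - v k)\<^sup>2) \<le> v j * 1"
    using vpos[of j] by (intro mult_left_mono) auto
  then have lhs: "v j * (\<Prod>k\<in>{..<N}-{j}. (v j - v k)\<^sup>2) \<le> 1/2" using vle[of j] by linarith
  have geo: "(\<Sum>k<j. (8::real) ^ k) \<le> 8 ^ j / 7"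
  proof -
    have "7 * (\<Sum>k<n. (8::real) ^ k) = 8 ^ n - 1" for n by (induction n) (auto simp: algebra_simps)
    from this[of j] show ?thesis by simp
  qed
  \<comment> \<open>The larger roots k < j contribute negatively. The ratio 1/8 gives v_k - v_j
    \<ge> (7/8) v_k, so each term is at least -(16/7)/v_k, and the geometric sum costs at most
    (32/49) 8^j.\<close>
  have "- (16/7) * (2 * (8 ^ j / 7)) \<le> - (16/7) * (2 * (\<Sum>k<j. (8::real) ^ k))"
    using geo by simp
  also have "\<dots> = (\<Sum>k<j. - (16/7) * (1 / v k))" by (simp add: vinv sum_distrib_left)
  also have "\<dots> \<le> (\<Sum>k<j. 2 / (v j - v k))"
  proof (rule sum_mono)
    fix k assume "k \<in> {..<j}"
    then have "v k - v j \<ge> (7/8) * v k" using vdec[of k j] by simp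
    moreover have "(7/8) * v k > 0" using vpos[of k] by simp
    ultimately have "2 / (v k - v j) \<le> 2 / ((7/8) * v k)" by (intro divide_left_mono mult_pos_pos) auto
    also have "\<dots> = (16/7) * (1 / v k)" by simp
    also have "2 / (v k - v j) = - (2 / (v j - v k))" by (metis minus_diff_eq divide_minus_right)
    finally show "- (16/7) * (1 / v k) \<le> 2 / (v j - v k)" by linarith
  qed
  also have "\<dots> \<le> (\<Sum>k<j. 2 / (v j - v k)) + (\<Sum>k\<in>{j<..<N}. 2 / (v j - v k))"
  proof -
    have "0 \<le> (\<Sum>k\<in>{j<..<N}. 2 / (v j - v k))"
    proof (rule sum_nonneg)
      fix k assume "k \<in> {j<..<N}"
      then have "v k < v j" using vdec[of j k] vpos[of j] by (auto intro: le_less_trans)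
      then show "0 \<le> 2 / (v j - v k)" by simp
    qed
    then show ?thesis by simp
  qed
  also have "\<dots> = (\<Sum>k\<in>{..<N}-{j}. 2 / (v j - v k))"
  proof -
    have "{..<N} - {j} = {..<j} \<union> {j<..<N}" using j by auto
    show ?thesis unfolding \<open>{..<N} - {j} = _\<close> by (rule sum.union_disjoint[symmetric]) auto
  qed
  \<comment> \<open>1/v_j = 2 * 8^j and 66/49 = 2 - 32/49. This exceeds the bound 1/2 for the
    left-hand side of \<open>gap\<close> already at j = 0.\<close>
  finally have "1 / v j + (\<Sum>k\<in>{..<N}-{j}. 2 / (v j - v k)) \<ge> 8 ^ j * (66/49)" by (simp add: vinv)
  moreover have "(8::real) ^ j * (66/49) \<ge> 1 * (66/49)" by (intro mult_right_mono) auto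
  ultimately show "?w j * (\<Prod>k\<in>{..<N}-{j}. (?w j - ?w k)\<^sup>2) < 1 / ?w j + (\<Sum>k\<in>{..<N}-{j}. 2 / (?w j - ?w k))"
    unfolding v[OF j] eq1 eq2 using lhs by linarith
qed (use N in auto)

theorem theoremD:
  fixes N :: nat
  assumes "N \<ge> 1"
  shows "\<exists>(w :: nat \<Rightarrow> real) (P :: complex poly).
    w N = 0 \<and> (\<forall>j<N. w (Suc j) < w j) \<and>
    (\<forall>i. coeff P i \<in> \<real>) \<and> lead_coeff P = 1 \<and> degree P = 2 * N + 1 \<and>
    poly P 0 = 0 \<and> norm (poly (pderiv P) 0) > 1 \<and>
    (\<forall>j<N. poly P (of_real (w j)) = of_real (w j) \<and>
           poly (pderiv P) (of_real (w j)) = 1 \<and>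
           (\<exists>r<0. resit (poly P) (of_real (w j)) = of_real r)) \<and>
    P \<in> connectedness_locus (2 * N + 1) \<and>
    (\<forall>\<^sub>F \<epsilon> in at_right (0::real). P + [:of_real \<epsilon>:] \<in> connectedness_locus (2 * N + 1)) \<and>
    (\<exists>L. hausdorff_limit (\<lambda>\<epsilon>. closed_ray (P + [:of_real \<epsilon>:]) 0) L (at_right 0) \<and>
         closed_ray P 0 = real_halfline (w 0) \<and>
         {\<gamma>. \<exists>a b. heteroclinic_arc P L \<gamma> a b} =
           (\<lambda>j. complex_of_real ` {w (Suc j)<..<w j}) ` {..<N} \<and>
         L = closed_ray P 0 \<union>
             \<Union>{Some ` (\<gamma> \<union> {a, b}) | \<gamma> a b. heteroclinic_arc P L \<gamma> a b} \<and>
         L = spine P L \<and>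
         L = real_halfline 0 \<and>
         L = (\<Union>j<N. real_segment (w (Suc j)) (w j)) \<union> real_halfline (w 0))"
proof -
  \<comment> \<open>The default value 0 is at the same time \<open>w N\<close>, the repelling fixed
    point.\<close>
  define w :: "nat \<Rightarrow> real" where "w j = (if j < N then (1/2) * (1/8) ^ j else 0)" for j
  interpret C: parabolic_chain N w
    unfolding w_def[abs_def] by (rule parabolic_chain_exists[OF assms])
  show ?thesis
  proof (intro exI[of _ w] exI[of _ C.P] exI[of _ C.L] conjI allI impI)
    show "\<exists>r<0. resit (poly C.P) (of_real (w j)) = of_real r" if "j < N" for j
      using C.parabolic_fixed_point(3,4)[OF that] by blast
    show "C.P \<in> connectedness_locus (2 * N + 1)"
      using C.in_connectedness_locus C.degree_P by simp
    show "{\<gamma>. \<exists>a b. heteroclinic_arc C.P C.L \<gamma> a b} = (\<lambda>j. complex_of_real ` {w (Suc j)<..<w j}) ` {..<N}"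
      unfolding C.heteroclinic_arc_iff C.I_def by blast
    show "C.L = closed_ray C.P 0 \<union>
        \<Union>{Some ` (\<gamma> \<union> {a, b}) | \<gamma> a b. heteroclinic_arc C.P C.L \<gamma> a b}"
      unfolding C.heteroclinic_arcs_union C.closed_ray_P using C.L_eq_segments by (simp only: Un_commute)
    show "C.L = spine C.P C.L" by (rule C.spine_L[symmetric])
    show "C.L = real_halfline 0" by (rule C.L_def)
    show "C.L = (\<Union>j<N. real_segment (w (Suc j)) (w j)) \<union> real_halfline (w 0)" by (rule C.L_eq_segments)
    show "coeff C.P i \<in> \<real>" for i by (rule C.real_coeffs_P)
  qed (fact C.wN C.dec C.lead_coeff_P C.degree_P C.repelling_0 C.parabolic_fixed_point(1,2)
        C.perturbed_in_connectedness_locus C.hausdorff_limit_rays C.closed_ray_P)+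
qed

end
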